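(* For each rational point $b$ of $X^\omega$ the stabilizer $\mathrm{St}_F(b)$ of $b$ in Thompson's group $F$ is finitely presented.
   Context: Thompson's group $F$ is the group (under composition) of all strictly increasing piecewise linear homeomorphisms of $[0,1]$ onto itself that are differentiable except at finitely many dyadic rationals and whose slopes on intervals of differentiability are integer powers of $2$. Right-action convention: $(fg)(t)=g(f(t))$. $F$ is generated by $x_0,x_1$, where $x_0(t)=t/2$ on $[0,\frac12]$, $t-\frac14$ on $[\frac12,\frac34]$, $2t-1$ on $[\frac34,1]$; $x_1(t)=t$ on $[0,\frac12]$, $\frac t2+\frac14$ on $[\frac12,\frac34]$, $t-\frac18$ on $[\frac34,\frac78]$, $2t-1$ on $[\frac78,1]$. Let $X=\{0,1\}$ and let $X^\omega$ be the set of infinite words over $X$ (Cantor set). $F$ acts on $X^\omega$ via binary expansions; on generators, for every $u\in X^\omega$: $x_0:\ 0u\mapsto 00u,\ 10u\mapsto 01u,\ 11u\mapsto 1u$; $x_1:\ 0u\mapsto 0u,\ 10u\mapsto 100u,\ 110u\mapsto 101u,\ 111u\mapsto 11u$. A point of $X^\omega$ is rational if it is eventually periodic, i.e. of the form $vw^\infty$ with $v,w$ finite words over $X$ and $w$ nonempty. $\mathrm{St}_F(b)$ is the subgroup of elements of $F$ fixing $b$. *)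

theory Defs
  imports "HOL-Analysis.Analysis" "HOL-Algebra.Coset" "HOL-Algebra.Group_Action" "HOL-Library.Stream"
begin

section \<open>Thompson's group $F$\<close>

definition dyadic_rationals :: "real set" where
  "dyadic_rationals = {x. \<exists>(m::int) (n::nat). x = of_int m / 2 ^ n}"

text \<open>A finite set \<open>P\<close> of break points cuts the unit interval into pieces on which \<open>f\<close> is affine.\<close>

definition piecewise_linear :: "(real \<Rightarrow> real) \<Rightarrow> bool" where
  "piecewise_linear f \<longleftrightarrow>
     (\<exists>P. finite P \<and>
        (\<forall>a b. 0 \<le> a \<and> a < b \<and> b \<le> 1 \<and> {a<..<b} \<inter> P = {} \<longrightarrow>
           (\<exists>c d. \<forall>t\<in>{a..b}. f t = c * t + d)))"

text \<open>Maps of the unit interval are represented by functions that are \<^const>\<open>undefined\<close> outside it,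
  so that equality of maps is equality of functions.  Multiplication follows the right-action
  convention: \<open>(f g)(t) = g (f t)\<close>.\<close>

definition thompson_F :: "(real \<Rightarrow> real) monoid" where
  "thompson_F =
     \<lparr>carrier = {f \<in> extensional {0..1}.
         (\<exists>g. homeomorphism {0..1} {0..1} f g) \<and>
         strict_mono_on {0..1} f \<and>
         piecewise_linear f \<and>
         (\<exists>D. finite D \<and> D \<subseteq> dyadic_rationals \<and>
              (\<forall>t\<in>{0<..<1} - D. f differentiable (at t))) \<and>
         (\<forall>t\<in>{0<..<1}. \<forall>d. (f has_real_derivative d) (at t) \<longrightarrow> (\<exists>k::int. d = 2 powi k))},
      mult = (\<lambda>f g. compose {0..1} g f),
      one = (\<lambda>t\<in>{0..1}. t)\<rparr>"

section \<open>The action on infinite binary words\<close>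

text \<open>Infinite words over $\{0,1\}$ are streams of truth values, with \<^const>\<open>False\<close> for the letter
  0 and \<^const>\<open>True\<close> for the letter 1.\<close>

definition binary_value :: "bool stream \<Rightarrow> real" where
  "binary_value u = (\<Sum>n. of_bool (u !! n) / 2 ^ Suc n)"

definition ends_in_ones :: "bool stream \<Rightarrow> bool" where
  "ends_in_ones u \<longleftrightarrow> (\<exists>v. u = v @- sconst True)"

text \<open>A dyadic rational strictly between 0 and 1 has two expansions, one ending in $0^\omega$ and one
  in $1^\omega$; the action of \<open>f\<close> takes the expansion of \<open>t\<close> of either kind to the expansion of
  \<open>f t\<close> of the same kind.  The lemmas \<open>F_action_x0\<close> and \<open>F_action_x1\<close> below recover the usual
  description of this action on generators.\<close>

definition F_action :: "(real \<Rightarrow> real) \<Rightarrow> bool stream \<Rightarrow> bool stream" where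
  "F_action f u =
     (THE v. binary_value v = f (binary_value u) \<and> (ends_in_ones v \<longleftrightarrow> ends_in_ones u))"

definition rational_point :: "bool stream \<Rightarrow> bool" where
  "rational_point b \<longleftrightarrow> (\<exists>v w. w \<noteq> [] \<and> b = v @- cycle w)"

definition St_F :: "bool stream \<Rightarrow> (real \<Rightarrow> real) monoid" where
  "St_F b = thompson_F\<lparr>carrier := stabilizer thompson_F F_action b\<rparr>"

lemma binary_value_summable: "summable (\<lambda>n. of_bool (u !! n) / 2 ^ Suc n :: real)"
proof (rule summable_comparison_test')
  show "summable (\<lambda>n. (1/2) ^ n :: real)" by (rule summable_geometric) simp
  show "norm (of_bool (u !! n) / 2 ^ Suc n :: real) \<le> (1/2) ^ n" for n
    by (auto simp: power_one_over field_simps)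
qed

lemma binary_value_Cons: "binary_value (b ## u) = (of_bool b + binary_value u) / 2"
proof -
  have "binary_value (b ## u) =
      of_bool ((b ## u) !! 0) / 2 ^ Suc 0 + (\<Sum>n. of_bool ((b ## u) !! Suc n) / 2 ^ Suc (Suc n))"
    unfolding binary_value_def using suminf_split_head[OF binary_value_summable[of "b ## u"]] by simp
  also have "(\<Sum>n. of_bool ((b ## u) !! Suc n) / 2 ^ Suc (Suc n)) = (\<Sum>n. (of_bool (u !! n) / 2 ^ Suc n) / 2 :: real)"
    by (simp add: field_simps)
  also have "\<dots> = binary_value u / 2"
    unfolding binary_value_def by (rule suminf_divide[OF binary_value_summable])
  finally show ?thesis by (simp add: add_divide_distrib)
qed

lemma binary_value_nonneg: "0 \<le> binary_value u"
  unfolding binary_value_def by (rule suminf_nonneg[OF binary_value_summable]) simp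

lemma binary_value_le_1: "binary_value u \<le> 1"
proof -
  have "(\<lambda>n. (1/2::real) ^ Suc n) sums 1" by (rule power_half_series)
  then show ?thesis
    unfolding binary_value_def
    by (metis (no_types, lifting) binary_value_summable sums_unique sums_summable suminf_le
        of_bool_eq(1) of_bool_eq(2) of_bool_def power_one_over divide_right_mono zero_le_power
        zero_le_numeral zero_le_one order_refl)
qed

lemma binary_value_eq_1: "binary_value u = 1 \<Longrightarrow> u = sconst True"
proof (coinduction arbitrary: u)
  case (Eq_stream u)
  then have "(of_bool (shd u) + binary_value (stl u)) / 2 = 1"
    by (metis binary_value_Cons stream.collapse)
  with binary_value_le_1[of "stl u"] show ?case by (cases "shd u") auto
qed

lemma binary_value_eq_0: "binary_value u = 0 \<Longrightarrow> u = sconst False"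
proof (coinduction arbitrary: u)
  case (Eq_stream u)
  then have "(of_bool (shd u) + binary_value (stl u)) / 2 = 0"
    by (metis binary_value_Cons stream.collapse)
  with binary_value_nonneg[of "stl u"] show ?case by (cases "shd u") auto
qed

lemma ends_in_ones_Cons: "ends_in_ones (b ## u) \<longleftrightarrow> ends_in_ones u"
proof
  assume "ends_in_ones (b ## u)"
  then obtain v where v: "b ## u = v @- sconst True" by (auto simp: ends_in_ones_def)
  show "ends_in_ones u"
  proof (cases v)
    case Nil
    then have "u = [] @- sconst True" using v by (metis shift.simps(1) siterate.simps(2) stream.sel(2) id_apply)
    then show ?thesis unfolding ends_in_ones_def by blast
  next
    case (Cons a v')
    then show ?thesis using v by (auto simp: ends_in_ones_def)
  qed
next
  assume "ends_in_ones u"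
  then obtain v where "u = v @- sconst True" by (auto simp: ends_in_ones_def)
  then have "b ## u = (b # v) @- sconst True" by simp
  then show "ends_in_ones (b ## u)" unfolding ends_in_ones_def by blast
qed

lemma binary_value_inj:
  assumes "binary_value u = binary_value v" "ends_in_ones u \<longleftrightarrow> ends_in_ones v"
  shows "u = v"
  using assms
proof (coinduction arbitrary: u v)
  case (Eq_stream u v)
  have u: "binary_value u = (of_bool (shd u) + binary_value (stl u)) / 2"
    and v: "binary_value v = (of_bool (shd v) + binary_value (stl v)) / 2"
    by (metis binary_value_Cons stream.collapse)+
  have e: "ends_in_ones (stl u) \<longleftrightarrow> ends_in_ones (stl v)"
    using Eq_stream(2) by (metis ends_in_ones_Cons stream.collapse)
  have ones: "ends_in_ones (sconst True)"
    unfolding ends_in_ones_def by (metis shift.simps(1))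
  have zeros: "\<not> ends_in_ones (sconst False)"
  proof
    assume "ends_in_ones (sconst False)"
    then obtain w where "sconst False = w @- sconst True" by (auto simp: ends_in_ones_def)
    then have "sset (sconst False) = set w \<union> {True}" by (metis sset_shift sset_sconst)
    then show False by auto
  qed
  have bounds: "binary_value (stl u) \<le> 1" "0 \<le> binary_value (stl u)"
    "binary_value (stl v) \<le> 1" "0 \<le> binary_value (stl v)"
    by (rule binary_value_le_1 binary_value_nonneg)+
  have hd: "shd u = shd v"
  proof (rule ccontr)
    assume "shd u \<noteq> shd v"
    then consider "shd u" "\<not> shd v" | "\<not> shd u" "shd v" by blast
    then show False
    proof cases
      case 1
      then have "binary_value (stl u) = 0" "binary_value (stl v) = 1"
        using u v Eq_stream(1) bounds by auto
      then show False using e ones zeros binary_value_eq_0 binary_value_eq_1 by metis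
    next
      case 2
      then have "binary_value (stl u) = 1" "binary_value (stl v) = 0"
        using u v Eq_stream(1) bounds by auto
      then show False using e ones zeros binary_value_eq_0 binary_value_eq_1 by metis
    qed
  qed
  then show ?case using u v Eq_stream(1) e by auto
qed

lemma F_action_eqI:
  assumes "binary_value v = f (binary_value u)" "ends_in_ones v \<longleftrightarrow> ends_in_ones u"
  shows "F_action f u = v"
  unfolding F_action_def
  by (rule the_equality) (use assms binary_value_inj in auto)

definition thompson_x0 :: "real \<Rightarrow> real" where
  "thompson_x0 = (\<lambda>t\<in>{0..1}. if t \<le> 1/2 then t / 2 else if t \<le> 3/4 then t - 1/4 else 2 * t - 1)"

definition thompson_x1 :: "real \<Rightarrow> real" where
  "thompson_x1 = (\<lambda>t\<in>{0..1}. if t \<le> 1/2 then t else if t \<le> 3/4 then t / 2 + 1/4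
                       else if t \<le> 7/8 then t - 1/8 else 2 * t - 1)"

lemma F_action_x0:
  "F_action thompson_x0 (False ## u) = False ## False ## u"
  "F_action thompson_x0 (True ## False ## u) = False ## True ## u"
  "F_action thompson_x0 (True ## True ## u) = True ## u"
  using binary_value_nonneg[of u] binary_value_le_1[of u]
  by (auto intro!: F_action_eqI
      simp: thompson_x0_def binary_value_Cons ends_in_ones_Cons field_simps)

lemma F_action_x1:
  "F_action thompson_x1 (False ## u) = False ## u"
  "F_action thompson_x1 (True ## False ## u) = True ## False ## False ## u"
  "F_action thompson_x1 (True ## True ## False ## u) = True ## False ## True ## u"
  "F_action thompson_x1 (True ## True ## True ## u) = True ## True ## u"
  using binary_value_nonneg[of u] binary_value_le_1[of u]
  by (auto intro!: F_action_eqI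
      simp: thompson_x1_def binary_value_Cons ends_in_ones_Cons field_simps)

section \<open>Finitely presented groups\<close>

text \<open>A letter \<open>(e, s)\<close> stands for the generator \<open>s\<close> if \<open>e\<close> is true and for its inverse otherwise.
  The free group on \<open>S\<close> consists of the words in these letters modulo cancellation.\<close>

definition group_words :: "'s set \<Rightarrow> (bool \<times> 's) list set" where
  "group_words S = lists (UNIV \<times> S)"

inductive_set free_equiv :: "'s set \<Rightarrow> ((bool \<times> 's) list \<times> (bool \<times> 's) list) set" for S where
  refl: "u \<in> group_words S \<Longrightarrow> (u, u) \<in> free_equiv S"
| sym: "(u, v) \<in> free_equiv S \<Longrightarrow> (v, u) \<in> free_equiv S"
| trans: "(u, v) \<in> free_equiv S \<Longrightarrow> (v, w) \<in> free_equiv S \<Longrightarrow> (u, w) \<in> free_equiv S"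
| cancel: "u \<in> group_words S \<Longrightarrow> v \<in> group_words S \<Longrightarrow> s \<in> S \<Longrightarrow>
    (u @ [(e, s), (\<not> e, s)] @ v, u @ v) \<in> free_equiv S"

definition free_group :: "'s set \<Rightarrow> (bool \<times> 's) list set monoid" where
  "free_group S =
     \<lparr>carrier = group_words S // free_equiv S,
      mult = (\<lambda>A B. \<Union>u\<in>A. \<Union>v\<in>B. free_equiv S `` {u @ v}),
      one = free_equiv S `` {[]}\<rparr>"

definition normal_closure :: "('a, 'b) monoid_scheme \<Rightarrow> 'a set \<Rightarrow> 'a set" where
  "normal_closure G R = \<Inter>{N. N \<lhd> G \<and> R \<subseteq> N}"

text \<open>Since only finite generating sets are considered, it is no restriction to take them in \<open>nat\<close>.\<close>

definition finitely_presented :: "('a, 'b) monoid_scheme \<Rightarrow> bool" where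
  "finitely_presented G \<longleftrightarrow> group G \<and>
     (\<exists>(S::nat set) R. finite S \<and> finite R \<and> R \<subseteq> carrier (free_group S) \<and>
        G \<cong> free_group S Mod normal_closure (free_group S) R)"

lemma free_equiv_words:
  assumes "(u, v) \<in> free_equiv S"
  shows "u \<in> group_words S \<and> v \<in> group_words S"
  using assms by induction (auto simp: group_words_def)

lemma equiv_free_equiv: "equiv (group_words S) (free_equiv S)"
  by (rule equivI)
    (auto simp: refl_on_def sym_def trans_def dest: free_equiv_words
      intro: free_equiv.refl free_equiv.sym free_equiv.trans)

lemma free_equiv_append_right:
  assumes "(u, v) \<in> free_equiv S" "w \<in> group_words S"
  shows "(u @ w, v @ w) \<in> free_equiv S"
  using assms
proof induction
  case (refl u)
  then show ?case by (auto simp: group_words_def intro: free_equiv.refl)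
next
  case (cancel u v s e)
  then show ?case using free_equiv.cancel[of u S "v @ w" s e] by (auto simp: group_words_def)
qed (blast intro: free_equiv.sym free_equiv.trans)+

lemma free_equiv_append_left:
  assumes "(u, v) \<in> free_equiv S" "w \<in> group_words S"
  shows "(w @ u, w @ v) \<in> free_equiv S"
  using assms
proof induction
  case (refl u)
  then show ?case by (auto simp: group_words_def intro: free_equiv.refl)
next
  case (cancel u v s e)
  then show ?case using free_equiv.cancel[of "w @ u" S v s e] by (auto simp: group_words_def)
qed (blast intro: free_equiv.sym free_equiv.trans)+

lemma free_equiv_append_congruent:
  "congruent2 (free_equiv S) (free_equiv S) (\<lambda>u v. free_equiv S `` {u @ v})"
proof (rule congruent2I[OF equiv_free_equiv equiv_free_equiv])
  fix u v w assume "(u, v) \<in> free_equiv S" "w \<in> group_words S"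
  then show "free_equiv S `` {u @ w} = free_equiv S `` {v @ w}"
    and "free_equiv S `` {w @ u} = free_equiv S `` {w @ v}"
    using equiv_class_eq[OF equiv_free_equiv] free_equiv_append_right free_equiv_append_left
    by metis+
qed

lemma free_group_mult_class:
  assumes "u \<in> group_words S" "v \<in> group_words S"
  shows "free_equiv S `` {u} \<otimes>\<^bsub>free_group S\<^esub> free_equiv S `` {v} = free_equiv S `` {u @ v}"
  using UN_equiv_class2[OF equiv_free_equiv equiv_free_equiv free_equiv_append_congruent assms]
  by (simp add: free_group_def)

lemma free_equiv_inverse_word:
  "u \<in> group_words S \<Longrightarrow> (rev (map (\<lambda>(e, s). (\<not> e, s)) u) @ u, []) \<in> free_equiv S"
proof (induction u)
  case Nil
  then show ?case by (auto intro: free_equiv.refl)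
next
  case (Cons a u)
  obtain e s where a: "a = (e, s)" by (cases a)
  let ?i = "rev (map (\<lambda>(e, s). (\<not> e, s)) u)"
  have w: "u \<in> group_words S" "s \<in> S" "?i \<in> group_words S"
    using Cons.prems a by (auto simp: group_words_def)
  have "(?i @ [(\<not> e, s), (\<not> \<not> e, s)] @ u, ?i @ u) \<in> free_equiv S"
    using w by (intro free_equiv.cancel)
  then show ?case using free_equiv.trans Cons.IH w(1) a by fastforce
qed

lemma group_free_group: "group (free_group S)"
proof (rule groupI)
  have carrier: "\<exists>u\<in>group_words S. A = free_equiv S `` {u}" if "A \<in> carrier (free_group S)" for A
    using that by (auto simp: free_group_def elim: quotientE)
  have cls: "free_equiv S `` {u} \<in> carrier (free_group S)" if "u \<in> group_words S" for u
    using that by (auto simp: free_group_def intro: quotientI)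
  have Nil: "[] \<in> group_words S" by (simp add: group_words_def)
  have append: "u @ v \<in> group_words S" if "u \<in> group_words S" "v \<in> group_words S" for u v
    using that by (simp add: group_words_def)
  have one: "\<one>\<^bsub>free_group S\<^esub> = free_equiv S `` {[]}" by (simp add: free_group_def)
  show "\<one>\<^bsub>free_group S\<^esub> \<in> carrier (free_group S)" using cls Nil one by simp
  fix A assume "A \<in> carrier (free_group S)"
  then obtain u where u: "u \<in> group_words S" "A = free_equiv S `` {u}" using carrier by blast
  show "\<one>\<^bsub>free_group S\<^esub> \<otimes>\<^bsub>free_group S\<^esub> A = A"
    using u Nil by (simp add: one free_group_mult_class)
  have i: "rev (map (\<lambda>(e, s). (\<not> e, s)) u) \<in> group_words S"
    using u by (auto simp: group_words_def)
  show "\<exists>B\<in>carrier (free_group S). B \<otimes>\<^bsub>free_group S\<^esub> A = \<one>\<^bsub>free_group S\<^esub>"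
    using cls[OF i] u free_group_mult_class[OF i u(1)]
      equiv_class_eq[OF equiv_free_equiv free_equiv_inverse_word[OF u(1)]] one by metis
  fix B assume "B \<in> carrier (free_group S)"
  then obtain v where v: "v \<in> group_words S" "B = free_equiv S `` {v}" using carrier by blast
  show "A \<otimes>\<^bsub>free_group S\<^esub> B \<in> carrier (free_group S)"
    using u v by (simp add: free_group_mult_class cls append)
  fix C assume "C \<in> carrier (free_group S)"
  then obtain w where w: "w \<in> group_words S" "C = free_equiv S `` {w}" using carrier by blast
  show "A \<otimes>\<^bsub>free_group S\<^esub> B \<otimes>\<^bsub>free_group S\<^esub> C = A \<otimes>\<^bsub>free_group S\<^esub> (B \<otimes>\<^bsub>free_group S\<^esub> C)"
    using u v w by (simp add: free_group_mult_class append)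
qed

end

theory Submission
  imports Defs "HOL-Algebra.Generated_Groups"
begin

text \<open>
  Thompson's group is isomorphic to the group \<open>stream_F\<close> of those bijections of the infinite binary words
  that are monotone in the binary value and replace prefixes by prefixes, and the isomorphism
  carries the stabilizer of \<open>b\<close> to a point stabilizer (\<open>realize_St\<close>). If \<open>b\<close> is constant, all elements fix it and
  the stabilizer is the whole group. Otherwise \<open>b = v w w w \<dots>\<close> with a word \<open>v\<close> that contains both letters
  and a word \<open>w\<close> of least possible length. Two subgroups explain the stabilizer.

  The elements that fix every infinite word beginning with \<open>v\<close> form a group \<open>K\<close>. They act independently on the
  words to the left and to the right of this cylinder, and as \<open>v\<close> can be moved to \<open>10\<close> inside Thompson's
  group, \<open>K\<close> is isomorphic to \<open>F \<times> F\<close> (\<open>presents_fixing\<close>). Moreover there is an element \<open>s\<close> with \<open>s (v u) = v w u\<close> for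
  all \<open>u\<close>. It fixes \<open>b\<close>, and since it maps the cylinder of \<open>v\<close> into itself, conjugation by \<open>s\<close> maps \<open>K\<close> into
  itself. An element \<open>g\<close> that fixes \<open>b\<close> replaces some prefix \<open>v w\<^sup>m\<close> of \<open>b\<close> by a prefix with the same tail, and because
  \<open>w\<close> is a shortest period, the new prefix is \<open>v w\<^sup>n\<close> for some \<open>n\<close>. Hence \<open>g = s\<^sup>-\<^sup>m k s\<^sup>n\<close> with \<open>k\<close> in \<open>K\<close>: the
  stabilizer is an ascending HNN extension of \<open>F \<times> F\<close> with stable letter \<open>s\<close>. Direct products and ascending HNN
  extensions of finitely presented groups are finitely presented (\<open>presents_DirProd\<close>,
  \<open>presents_ascending_HNN\<close>), so it remains to treat \<open>F\<close>.

  An element of \<open>F\<close> is given by two binary trees with equally many leaves, and it determines this pair up to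
  attaching carets to corresponding leaves of both trees. Let \<open>y 0, y 1, \<dots>\<close> be elements of any group with
  \<open>y j y i = y i y (j + 1)\<close> for \<open>i < j\<close>. A tree can be evaluated as a product of these elements such that a caret
  attached to leaf \<open>k\<close> contributes a right factor \<open>y k\<close>, or no factor if that leaf is the last one. The quotient of
  the values of two trees is therefore unchanged by common carets, and it defines a homomorphism on
  \<open>F\<close> (\<open>pair_elem_hom\<close>). So \<open>F\<close> is presented by such a sequence of generators with these relations, all of which
  follow from two of them once the sequence is generated by conjugation with \<open>y 0\<close> (\<open>presents_stream_F\<close>).

  Finite presentability is expressed throughout by the universal property of a presentation
  (\<open>presents\<close>). A homomorphism out of a group is then constructed from its graph
  (\<open>homI_graph\<close>), both for tree pairs and for HNN extensions.
\<close>

section \<open>Presentations by their universal property\<close>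

fun eval_word :: "('a, 'b) monoid_scheme \<Rightarrow> ('s \<Rightarrow> 'a) \<Rightarrow> (bool \<times> 's) list \<Rightarrow> 'a" where
  "eval_word G g [] = \<one>\<^bsub>G\<^esub>"
| "eval_word G g ((e, s) # w) = (if e then g s else inv\<^bsub>G\<^esub> g s) \<otimes>\<^bsub>G\<^esub> eval_word G g w"

text \<open>The universal property of a presentation: \<open>S\<close> indexes the generators \<open>g s\<close>, and \<open>R\<close> consists of
  the relators. The test groups \<open>H\<close> range over one fixed type, that of the quotients of free groups on
  sets of natural numbers, because those are the groups to which the property is finally applied.\<close>

definition presents ::
  "('a, 'b) monoid_scheme \<Rightarrow> 's set \<Rightarrow> ('s \<Rightarrow> 'a) \<Rightarrow> (bool \<times> 's) list set \<Rightarrow> bool" where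
  "presents G S g R \<longleftrightarrow> group G \<and> finite S \<and> finite R \<and> R \<subseteq> group_words S \<and> g \<in> S \<rightarrow> carrier G \<and>
     carrier G = generate G (g ` S) \<and> (\<forall>r\<in>R. eval_word G g r = \<one>\<^bsub>G\<^esub>) \<and>
     (\<forall>(H :: (bool \<times> nat) list set set monoid) h.
        group H \<longrightarrow> h \<in> S \<rightarrow> carrier H \<longrightarrow> (\<forall>r\<in>R. eval_word H h r = \<one>\<^bsub>H\<^esub>) \<longrightarrow>
        (\<exists>\<phi>\<in>hom G H. \<forall>s\<in>S. \<phi> (g s) = h s))"

lemma group_words_simps [simp]:
  "[] \<in> group_words S"
  "(e, s) # w \<in> group_words S \<longleftrightarrow> s \<in> S \<and> w \<in> group_words S"
  "u @ v \<in> group_words S \<longleftrightarrow> u \<in> group_words S \<and> v \<in> group_words S"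
  by (auto simp: group_words_def)

lemma group_words_induct [consumes 1, case_names Nil Cons]:
  assumes "w \<in> group_words S" "P []"
    and "\<And>e s w. s \<in> S \<Longrightarrow> w \<in> group_words S \<Longrightarrow> P w \<Longrightarrow> P ((e, s) # w)"
  shows "P w"
  using assms(1) by (induction w) (auto intro: assms)

context group
begin

lemma eval_word_closed [simp]:
  assumes "g \<in> S \<rightarrow> carrier G" "w \<in> group_words S"
  shows "eval_word G g w \<in> carrier G"
  using assms(2) by (induction rule: group_words_induct) (use assms(1) in auto)

lemma eval_word_append:
  assumes "g \<in> S \<rightarrow> carrier G" "u \<in> group_words S" "v \<in> group_words S"
  shows "eval_word G g (u @ v) = eval_word G g u \<otimes> eval_word G g v"
  using assms(2)
proof (induction rule: group_words_induct)
  case (Cons e s w)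
  then have "g s \<in> carrier G" using assms(1) by auto
  then show ?case using Cons assms by (simp add: m_assoc)
qed (use assms in simp)

lemma eval_word_free_equiv:
  assumes "g \<in> S \<rightarrow> carrier G" "(u, v) \<in> free_equiv S"
  shows "eval_word G g u = eval_word G g v"
  using assms(2)
proof induction
  case (cancel u v s e)
  have s: "g s \<in> carrier G" using assms(1) cancel by auto
  have "eval_word G g ([(e, s), (\<not> e, s)] @ v) = eval_word G g v"
    using s cancel assms(1) by (cases e) (simp_all add: m_assoc[symmetric])
  then show ?case using cancel assms(1) by (simp only: eval_word_append group_words_simps(3) simp_thms group_words_simps(2) group_words_simps(1))
qed simp_all

lemma eval_word_generate:
  assumes g: "g \<in> S \<rightarrow> carrier G"
  shows "eval_word G g ` group_words S = generate G (g ` S)"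
proof (intro equalityI subsetI)
  fix x assume "x \<in> eval_word G g ` group_words S"
  then obtain w where w: "w \<in> group_words S" "x = eval_word G g w" by auto
  have "eval_word G g w \<in> generate G (g ` S)"
    using w(1)
  proof (induction rule: group_words_induct)
    case (Cons e s w)
    then show ?case
      using generate.eng[of _ G "g ` S"] generate.incl[of "g s" "g ` S" G]
        generate.inv[of "g s" "g ` S" G] by auto
  qed (auto intro: generate.one)
  then show "x \<in> generate G (g ` S)" using w by simp
next
  fix x assume "x \<in> generate G (g ` S)"
  then show "x \<in> eval_word G g ` group_words S"
  proof induction
    case one
    show ?case by (rule image_eqI[of _ _ "[]"]) auto
  next
    case (incl h)
    then obtain s where "s \<in> S" "h = g s" by auto
    then have "g s \<in> carrier G" using g by auto
    then show ?case using \<open>s \<in> S\<close> \<open>h = g s\<close> by (intro image_eqI[of _ _ "[(True, s)]"]) auto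
  next
    case (inv h)
    then obtain s where "s \<in> S" "h = g s" by auto
    then have "g s \<in> carrier G" using g by auto
    then show ?case using \<open>s \<in> S\<close> \<open>h = g s\<close> by (intro image_eqI[of _ _ "[(False, s)]"]) auto
  next
    case (eng h1 h2)
    then obtain u v where "u \<in> group_words S" "h1 = eval_word G g u"
      "v \<in> group_words S" "h2 = eval_word G g v" by auto
    then show ?case using eval_word_append[OF g] by (intro image_eqI[of _ _ "u @ v"]) auto
  qed
qed

end

lemma eval_word_hom:
  assumes "group G" "group H" "\<phi> \<in> hom G H" "g \<in> S \<rightarrow> carrier G" "w \<in> group_words S"
  shows "\<phi> (eval_word G g w) = eval_word H (\<phi> \<circ> g) w"
proof -
  interpret group_hom G H \<phi> using assms by (simp add: group_hom_def group_hom_axioms_def)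
  show ?thesis using assms(5)
  proof (induction rule: group_words_induct)
    case (Cons e s w)
    then have "g s \<in> carrier G" "eval_word G g w \<in> carrier G" using assms(4) by auto
    then show ?case using Cons by simp
  qed simp
qed

lemma eval_word_cong:
  assumes "\<And>s. s \<in> S \<Longrightarrow> g s = h s" "w \<in> group_words S"
  shows "eval_word G g w = eval_word G h w"
  using assms(2) by (induction rule: group_words_induct) (use assms(1) in auto)

lemma eval_word_map:
  "eval_word G g (map (map_prod id f) w) = eval_word G (g \<circ> f) w"
  by (induction w) auto

lemma map_group_words:
  "w \<in> group_words S \<Longrightarrow> map (map_prod id f) w \<in> group_words (f ` S)"
  by (induction rule: group_words_induct) auto

lemma hom_eq_on_generate:
  assumes "group G" "group H" "\<phi> \<in> hom G H" "\<psi> \<in> hom G H" "A \<subseteq> carrier G"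
    and "\<And>a. a \<in> A \<Longrightarrow> \<phi> a = \<psi> a" "x \<in> generate G A"
  shows "\<phi> x = \<psi> x"
proof -
  interpret a: group_hom G H \<phi> using assms by (simp add: group_hom_def group_hom_axioms_def)
  interpret b: group_hom G H \<psi> using assms by (simp add: group_hom_def group_hom_axioms_def)
  show ?thesis using assms(7)
  proof induction
    case (eng h1 h2)
    then show ?case using a.G.generate_in_carrier[OF assms(5)] by simp
  qed (use assms in auto)
qed

text \<open>A homomorphism given by its graph. A relation closed under products is single-valued as soon as it
  is so over the identity: multiply two values at \<open>x\<close> by one value at the inverse of \<open>x\<close>.\<close>

lemma homI_graph:
  assumes G: "group G" and H: "group H"
    and dom: "\<And>x y. Rel x y \<Longrightarrow> x \<in> carrier G \<and> y \<in> carrier H"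
    and total: "\<And>x. x \<in> carrier G \<Longrightarrow> \<exists>y. Rel x y"
    and mult: "\<And>x y x' y'. Rel x y \<Longrightarrow> Rel x' y' \<Longrightarrow> Rel (x \<otimes>\<^bsub>G\<^esub> x') (y \<otimes>\<^bsub>H\<^esub> y')"
    and one: "\<And>y. Rel \<one>\<^bsub>G\<^esub> y \<Longrightarrow> y = \<one>\<^bsub>H\<^esub>"
  shows "\<exists>\<phi>\<in>hom G H. \<forall>x y. Rel x y \<longrightarrow> \<phi> x = y"
proof -
  interpret G: group G by fact
  interpret H: group H by fact
  have uniq: "y = y'" if "Rel x y" "Rel x y'" for x y y'
  proof -
    have x: "x \<in> carrier G" "y \<in> carrier H" "y' \<in> carrier H" using dom that by auto
    obtain z where z: "Rel (inv\<^bsub>G\<^esub> x) z" using total x by blast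
    have "y \<otimes>\<^bsub>H\<^esub> z = \<one>\<^bsub>H\<^esub>" "y' \<otimes>\<^bsub>H\<^esub> z = \<one>\<^bsub>H\<^esub>"
      using mult[OF that(1) z] mult[OF that(2) z] x by (auto intro: one)
    then show ?thesis using x dom[OF z] by (metis H.inv_equality H.inv_inv)
  qed
  define \<phi> where "\<phi> x = (SOME y. Rel x y)" for x
  have \<phi>: "Rel x (\<phi> x)" if "x \<in> carrier G" for x
    unfolding \<phi>_def using total[OF that] by (rule someI_ex)
  show ?thesis
  proof (intro bexI homI allI impI)
    show "\<phi> x = y" if "Rel x y" for x y using uniq \<phi> dom that by blast
    fix x assume x: "x \<in> carrier G"
    show "\<phi> x \<in> carrier H" using \<phi>[OF x] dom by blast
    fix y assume y: "y \<in> carrier G"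
    show "\<phi> (x \<otimes>\<^bsub>G\<^esub> y) = \<phi> x \<otimes>\<^bsub>H\<^esub> \<phi> y" 
      by (rule uniq[OF \<phi>[OF G.m_closed[OF x y]] mult[OF \<phi>[OF x] \<phi>[OF y]]])
  qed
qed

text \<open>Evaluation of words maps the free group onto \<open>G\<close>, and its kernel contains the normal closure \<open>N\<close> of the
  relators. Conversely, the universal property, applied to the quotient by \<open>N\<close>, yields a homomorphism
  under which the value of a word goes to the coset of that word. A word with trivial value
  therefore lies in \<open>N\<close>.\<close>

lemma presents_finitely_presented_nat:
  fixes S :: "nat set"
  assumes "presents G S g R"
  shows "finitely_presented G"
proof -
  let ?F = "free_group S" and ?c = "\<lambda>w. free_equiv S `` {w}"
  have G: "group G" "finite S" "finite R" "R \<subseteq> group_words S" "g \<in> S \<rightarrow> carrier G"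
    "carrier G = generate G (g ` S)" "\<And>r. r \<in> R \<Longrightarrow> eval_word G g r = \<one>\<^bsub>G\<^esub>"
    and univ: "\<And>(H :: (bool \<times> nat) list set set monoid) h. group H \<Longrightarrow> h \<in> S \<rightarrow> carrier H \<Longrightarrow>
        (\<And>r. r \<in> R \<Longrightarrow> eval_word H h r = \<one>\<^bsub>H\<^esub>) \<Longrightarrow> \<exists>\<phi>\<in>hom G H. \<forall>s\<in>S. \<phi> (g s) = h s"
    using assms unfolding presents_def by blast+
  interpret G: group G by fact
  interpret F: group ?F by (rule group_free_group)
  have cls: "?c w \<in> carrier ?F" if "w \<in> group_words S" for w
    using that by (auto simp: free_group_def intro: quotientI)
  have carrierE: "\<exists>w\<in>group_words S. A = ?c w" if "A \<in> carrier ?F" for A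
    using that by (auto simp: free_group_def elim: quotientE)
  have one: "\<one>\<^bsub>?F\<^esub> = ?c []" by (simp add: free_group_def)
  define ev where "ev A = eval_word G g (SOME w. w \<in> A)" for A
  have ev: "ev (?c w) = eval_word G g w" if "w \<in> group_words S" for w
  proof -
    have "(SOME v. v \<in> ?c w) \<in> ?c w"
      by (rule someI[of _ w]) (use that in \<open>auto intro: free_equiv.refl\<close>)
    then show ?thesis unfolding ev_def using G.eval_word_free_equiv[OF G(5)] by force
  qed
  have hom: "ev \<in> hom ?F G"
  proof (rule homI)
    fix A assume "A \<in> carrier ?F"
    then obtain u where u: "u \<in> group_words S" "A = ?c u" using carrierE by blast
    show "ev A \<in> carrier G" using u ev G(5) by simp
    fix B assume "B \<in> carrier ?F"
    then obtain v where v: "v \<in> group_words S" "B = ?c v" using carrierE by blast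
    show "ev (A \<otimes>\<^bsub>?F\<^esub> B) = ev A \<otimes>\<^bsub>G\<^esub> ev B"
      using u v ev G(5) by (simp add: free_group_mult_class G.eval_word_append)
  qed
  interpret ev: group_hom ?F G ev
    using hom by (simp add: group_hom_def group_hom_axioms_def G F.is_group)
  have surj: "ev ` carrier ?F = carrier G"
  proof -
    have "ev ` carrier ?F = eval_word G g ` group_words S"
      using ev cls carrierE by (auto simp: image_iff) metis+
    then show ?thesis using G.eval_word_generate[OF G(5)] G(6) by simp
  qed
  let ?R = "?c ` R" and ?N = "normal_closure ?F (?c ` R)"
  have R: "?R \<subseteq> carrier ?F" using cls G(4) by auto
  have ker: "kernel ?F G ev \<lhd> ?F" by (rule ev.normal_kernel)
  have Rker: "?R \<subseteq> kernel ?F G ev" using R ev G(4,7) by (auto simp: kernel_def)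
  have N: "?N \<lhd> ?F"
    unfolding normal_closure_def F.normal_inv_iff
  proof (intro conjI ballI)
    show "subgroup (\<Inter>{N. (subgroup N ?F \<and> (\<forall>x\<in>carrier ?F. \<forall>h\<in>N. x \<otimes>\<^bsub>?F\<^esub> h \<otimes>\<^bsub>?F\<^esub> inv\<^bsub>?F\<^esub> x \<in> N)) \<and> ?R \<subseteq> N}) ?F"
      by (rule F.subgroups_Inter) (use ker Rker in \<open>auto simp: F.normal_inv_iff\<close>)
  qed blast
  interpret N: normal ?N ?F by (rule N)
  have RN: "?R \<subseteq> ?N" by (auto simp: normal_closure_def)
  let ?H = "?F Mod ?N"
  have H: "group ?H" by (rule N.factorgroup_is_group)
  have proj: "(\<lambda>a. ?N #>\<^bsub>?F\<^esub> a) \<in> hom ?F ?H" by (rule N.r_coset_hom_Mod)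
  define gen where "gen s = ?c [(True, s)]" for s
  have gen: "gen \<in> S \<rightarrow> carrier ?F" using cls by (auto simp: gen_def)
  have inv_gen: "inv\<^bsub>?F\<^esub> gen s = ?c [(False, s)]" if "s \<in> S" for s
  proof (rule F.inv_equality)
    have "(([(False, s)] @ [(True, s)]) @ [], [] @ []) \<in> free_equiv S"
      using free_equiv.cancel[of "[]" S "[]" s False] that by simp
    then show "?c [(False, s)] \<otimes>\<^bsub>?F\<^esub> gen s = \<one>\<^bsub>?F\<^esub>"
      unfolding gen_def one using that equiv_class_eq[OF equiv_free_equiv]
      by (subst free_group_mult_class) auto
  qed (use that cls gen in auto)
  have ev_gen: "eval_word ?F gen w = ?c w" if "w \<in> group_words S" for w
    using that
  proof (induction rule: group_words_induct)
    case Nil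
    then show ?case by (simp add: one)
  next
    case (Cons e s w)
    then show ?case using free_group_mult_class[of "[(e, s)]" S w] inv_gen
      by (auto simp: gen_def)
  qed
  define h where "h = (\<lambda>a. ?N #>\<^bsub>?F\<^esub> a) \<circ> gen"
  have h: "h \<in> S \<rightarrow> carrier ?H"
    using gen proj by (auto simp: h_def hom_def Pi_def)
  have ev_h: "eval_word ?H h w = ?N #>\<^bsub>?F\<^esub> ?c w" if "w \<in> group_words S" for w
    using eval_word_hom[OF F.is_group H proj gen that] ev_gen[OF that] by (simp add: h_def)
  have "eval_word ?H h r = \<one>\<^bsub>?H\<^esub>" if "r \<in> R" for r
  proof -
    have w: "r \<in> group_words S" and N: "?c r \<in> ?N" using that G(4) RN by auto
    show ?thesis using ev_h[OF w] N.rcos_const[OF F.is_group N] by (simp add: FactGroup_def)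
  qed
  then obtain \<phi> where \<phi>: "\<phi> \<in> hom G ?H" "\<And>s. s \<in> S \<Longrightarrow> \<phi> (g s) = h s"
    using univ[OF H h] by blast
  have "kernel ?F G ev \<subseteq> ?N"
  proof
    fix A assume A: "A \<in> kernel ?F G ev"
    then obtain w where w: "w \<in> group_words S" "A = ?c w"
      using carrierE by (auto simp: kernel_def)
    then have "eval_word G g w = \<one>\<^bsub>G\<^esub>" using A ev by (simp add: kernel_def)
    then have "\<one>\<^bsub>?H\<^esub> = eval_word ?H (\<phi> \<circ> g) w"
      using eval_word_hom[OF G(1) H \<phi>(1) G(5) w(1)] hom_one[OF \<phi>(1) G(1) H] by simp
    also have "\<dots> = eval_word ?H h w"
      by (rule eval_word_cong[OF _ w(1)]) (use \<phi> in auto)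
    finally have "?N #>\<^bsub>?F\<^esub> A = ?N" using ev_h[OF w(1)] w by (simp add: FactGroup_def)
    then show "A \<in> ?N" using F.coset_join1[OF _ _ N.subgroup_axioms] A N.subset by (auto simp: kernel_def)
  qed
  moreover have "?N \<subseteq> kernel ?F G ev"
    using ker Rker by (auto simp: normal_closure_def)
  ultimately have "kernel ?F G ev = ?N" by blast
  then have "?F Mod ?N \<cong> G" using ev.FactGroup_iso[OF surj] by simp
  then have "G \<cong> ?F Mod ?N" using group.iso_sym[OF H] by blast
  then show ?thesis unfolding finitely_presented_def
    using G R by blast
qed

lemma eval_word_reindex:
  assumes "inj_on f S" "w \<in> group_words S"
  shows "eval_word H (h \<circ> inv_into S f) (map (map_prod id f) w) = eval_word H h w"
  unfolding eval_word_map by (rule eval_word_cong[OF _ assms(2)]) (simp add: assms(1))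

lemma presents_reindex:
  assumes "presents G S g R" "bij_betw f S S'"
  shows "presents G S' (g \<circ> inv_into S f) (map (map_prod id f) ` R)"
proof -
  have G: "group G" "finite S" "finite R" "R \<subseteq> group_words S" "g \<in> S \<rightarrow> carrier G"
    "carrier G = generate G (g ` S)" "\<And>r. r \<in> R \<Longrightarrow> eval_word G g r = \<one>\<^bsub>G\<^esub>"
    and univ: "\<And>(H :: (bool \<times> nat) list set set monoid) h. group H \<Longrightarrow> h \<in> S \<rightarrow> carrier H \<Longrightarrow>
        (\<And>r. r \<in> R \<Longrightarrow> eval_word H h r = \<one>\<^bsub>H\<^esub>) \<Longrightarrow> \<exists>\<phi>\<in>hom G H. \<forall>s\<in>S. \<phi> (g s) = h s"
    using assms(1) unfolding presents_def by blast+
  have f: "inj_on f S" "f ` S = S'" using assms(2) by (auto simp: bij_betw_def)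
  have inv: "inv_into S f (f s) = s" if "s \<in> S" for s using f that by simp
  have inv': "inv_into S f s \<in> S" "f (inv_into S f s) = s" if "s \<in> S'" for s
    using f that by (auto simp: inv_into_into f_inv_into_f)
  have im: "(g \<circ> inv_into S f) ` S' = g ` S"
    using f inv by (force simp: image_iff)
  show ?thesis unfolding presents_def
  proof (intro conjI allI impI)
    show "finite S'" using G(2) f by auto
    show "map (map_prod id f) ` R \<subseteq> group_words S'" using map_group_words G(4) f(2) by fastforce
    show "g \<circ> inv_into S f \<in> S' \<rightarrow> carrier G" using G(5) inv' by auto
    show "\<forall>r\<in>map (map_prod id f) ` R. eval_word G (g \<circ> inv_into S f) r = \<one>\<^bsub>G\<^esub>"
    proof
      fix r' assume "r' \<in> map (map_prod id f) ` R"
      then obtain r where r: "r \<in> R" "r' = map (map_prod id f) r" by blast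
      then show "eval_word G (g \<circ> inv_into S f) r' = \<one>\<^bsub>G\<^esub>"
        using eval_word_reindex[OF f(1) subsetD[OF G(4)]] G(7) by metis
    qed
    fix H :: "(bool \<times> nat) list set set monoid" and h
    assume H: "group H" "h \<in> S' \<rightarrow> carrier H"
      "\<forall>r\<in>map (map_prod id f) ` R. eval_word H h r = \<one>\<^bsub>H\<^esub>"
    have "\<exists>\<phi>\<in>hom G H. \<forall>s\<in>S. \<phi> (g s) = (h \<circ> f) s"
    proof (rule univ)
      show "h \<circ> f \<in> S \<rightarrow> carrier H" using H(2) f(2) by auto
      show "eval_word H (h \<circ> f) r = \<one>\<^bsub>H\<^esub>" if "r \<in> R" for r
        using H(3) that by (simp add: eval_word_map)
    qed (rule H)
    then obtain \<phi> where \<phi>: "\<phi> \<in> hom G H" "\<And>s. s \<in> S \<Longrightarrow> \<phi> (g s) = h (f s)" by auto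
    have "\<forall>s\<in>S'. \<phi> ((g \<circ> inv_into S f) s) = h s"
      using \<phi>(2)[OF inv'(1)] inv'(2) by simp
    then show "\<exists>\<phi>\<in>hom G H. \<forall>s\<in>S'. \<phi> ((g \<circ> inv_into S f) s) = h s"
      using \<phi>(1) by blast
  next
    show "carrier G = generate G ((g \<circ> inv_into S f) ` S')" by (subst im) (rule G(6))
  qed (use G in blast)+
qed

theorem presents_finitely_presented:
  assumes "presents G S g R"
  shows "finitely_presented G"
proof -
  have "finite S" using assms by (simp add: presents_def)
  then obtain f where "bij_betw f S {0..<card S}" using ex_bij_betw_finite_nat by blast
  from presents_finitely_presented_nat[OF presents_reindex[OF assms this]] show ?thesis .
qed

section \<open>Isomorphic groups and direct products\<close>

lemma presentsD:
  assumes "presents G S g R"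
  shows "group G" "finite S" "finite R" "R \<subseteq> group_words S" "g \<in> S \<rightarrow> carrier G"
    "carrier G = generate G (g ` S)" "\<And>r. r \<in> R \<Longrightarrow> eval_word G g r = \<one>\<^bsub>G\<^esub>"
  using assms by (auto simp: presents_def)

lemma presents_hom:
  fixes H :: "(bool \<times> nat) list set set monoid"
  assumes "presents G S g R" "group H" "h \<in> S \<rightarrow> carrier H"
    and "\<And>r. r \<in> R \<Longrightarrow> eval_word H h r = \<one>\<^bsub>H\<^esub>"
  shows "\<exists>\<phi>\<in>hom G H. \<forall>s\<in>S. \<phi> (g s) = h s"
proof -
  have "\<forall>(H :: (bool \<times> nat) list set set monoid) h.
        group H \<longrightarrow> h \<in> S \<rightarrow> carrier H \<longrightarrow> (\<forall>r\<in>R. eval_word H h r = \<one>\<^bsub>H\<^esub>) \<longrightarrow>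
        (\<exists>\<phi>\<in>hom G H. \<forall>s\<in>S. \<phi> (g s) = h s)"
    using assms(1) unfolding presents_def by (elim conjE)
  then show ?thesis using assms(2-4) by blast
qed

lemma presentsI:
  assumes "group G" "finite S" "finite R" "R \<subseteq> group_words S" "g \<in> S \<rightarrow> carrier G"
    and "carrier G \<subseteq> generate G (g ` S)" "\<And>r. r \<in> R \<Longrightarrow> eval_word G g r = \<one>\<^bsub>G\<^esub>"
    and "\<And>(H :: (bool \<times> nat) list set set monoid) h.
        group H \<Longrightarrow> h \<in> S \<rightarrow> carrier H \<Longrightarrow> (\<And>r. r \<in> R \<Longrightarrow> eval_word H h r = \<one>\<^bsub>H\<^esub>) \<Longrightarrow>
        \<exists>\<phi>\<in>hom G H. \<forall>s\<in>S. \<phi> (g s) = h s"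
  shows "presents G S g R"
proof -
  have "generate G (g ` S) \<subseteq> carrier G"
    using group.generate_incl[OF assms(1), of "g ` S"] assms(5) by blast
  then show ?thesis unfolding presents_def using assms by auto
qed

lemma presents_iso:
  assumes pres: "presents G S g R" and G': "group G'" and \<psi>: "\<psi> \<in> iso G G'"
  shows "presents G' S (\<psi> \<circ> g) R"
proof -
  note G = presentsD[OF pres]
  have hom: "\<psi> \<in> hom G G'" and bij: "bij_betw \<psi> (carrier G) (carrier G')"
    using \<psi> by (auto simp: iso_def)
  interpret \<psi>: group_hom G G' \<psi> using hom G G' by (simp add: group_hom_def group_hom_axioms_def)
  have inv: "inv_into (carrier G) \<psi> \<in> hom G' G"
    using group.iso_set_sym[OF G(1) \<psi>] by (auto simp: iso_def)
  show ?thesis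
  proof (rule presentsI)
    show "\<psi> \<circ> g \<in> S \<rightarrow> carrier G'" using G(5) hom by (auto simp: hom_def Pi_def)
    have "carrier G' = \<psi> ` generate G (g ` S)" using bij G(6) by (simp add: bij_betw_def)
    also have "\<dots> = generate G' (\<psi> ` g ` S)"
      by (rule \<psi>.generate_img[symmetric]) (use G(5) in auto)
    finally show "carrier G' \<subseteq> generate G' ((\<psi> \<circ> g) ` S)" by (simp add: image_comp)
    show "eval_word G' (\<psi> \<circ> g) r = \<one>\<^bsub>G'\<^esub>" if "r \<in> R" for r
      using eval_word_hom[OF G(1) G' hom G(5) subsetD[OF G(4) that]] G(7)[OF that] \<psi>.hom_one by simp
    fix H :: "(bool \<times> nat) list set set monoid" and h
    assume H: "group H" "h \<in> S \<rightarrow> carrier H" "\<And>r. r \<in> R \<Longrightarrow> eval_word H h r = \<one>\<^bsub>H\<^esub>"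
    obtain \<phi> where \<phi>: "\<phi> \<in> hom G H" "\<And>s. s \<in> S \<Longrightarrow> \<phi> (g s) = h s"
      using presents_hom[OF pres H] by blast
    have "\<phi> \<circ> inv_into (carrier G) \<psi> \<in> hom G' H" using hom_compose[OF inv \<phi>(1)] .
    moreover have "\<forall>s\<in>S. (\<phi> \<circ> inv_into (carrier G) \<psi>) ((\<psi> \<circ> g) s) = h s"
    proof
      fix s assume s: "s \<in> S"
      then have "inv_into (carrier G) \<psi> (\<psi> (g s)) = g s"
        using bij G(5) by (auto simp: bij_betw_def intro!: inv_into_f_f)
      then show "(\<phi> \<circ> inv_into (carrier G) \<psi>) ((\<psi> \<circ> g) s) = h s" using \<phi>(2) s by simp
    qed
    ultimately show "\<exists>\<phi>\<in>hom G' H. \<forall>s\<in>S. \<phi> ((\<psi> \<circ> g) s) = h s" by blast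
  qed (use G G' in blast)+
qed

definition lift_word :: "('s \<Rightarrow> 't) \<Rightarrow> (bool \<times> 's) list \<Rightarrow> (bool \<times> 't) list" where
  "lift_word f = map (map_prod id f)"

lemma eval_lift_word: "eval_word G g (lift_word f w) = eval_word G (g \<circ> f) w"
  by (simp add: lift_word_def eval_word_map)

definition comm_word :: "'s \<Rightarrow> 's \<Rightarrow> (bool \<times> 's) list" where
  "comm_word s t = [(True, s), (True, t), (False, s), (False, t)]"

lemma (in group) eval_comm_word:
  assumes "g s \<in> carrier G" "g t \<in> carrier G"
  shows "eval_word G g (comm_word s t) = \<one> \<longleftrightarrow> g s \<otimes> g t = g t \<otimes> g s"
proof -
  have "eval_word G g (comm_word s t) = (g s \<otimes> g t) \<otimes> inv (g t \<otimes> g s)"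
    using assms by (simp add: comm_word_def m_assoc inv_mult_group)
  then show ?thesis using assms by (metis inv_equality inv_inv inv_closed m_closed r_inv)
qed

lemma (in group) eval_conj_relator:
  assumes "g \<in> S \<rightarrow> carrier G" "w \<in> group_words S" "s \<in> S" "t \<in> S"
  shows "eval_word G g (w @ [(True, s), (False, t), (False, s)]) = \<one> \<longleftrightarrow>
    eval_word G g w = g s \<otimes> g t \<otimes> inv g s"
proof -
  have st: "g s \<in> carrier G" "g t \<in> carrier G" using assms by auto
  have "eval_word G g (w @ [(True, s), (False, t), (False, s)]) =
      eval_word G g w \<otimes> inv (g s \<otimes> g t \<otimes> inv g s)"
    using st assms by (simp add: eval_word_append m_assoc inv_mult_group)
  then show ?thesis
    using st eval_word_closed[OF assms(1,2)]
    by (metis inv_equality inv_inv inv_closed m_closed r_inv)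
qed

text \<open>With powers of \<open>s\<close> for \<open>a\<close> and \<open>b\<close>, this raises both exponents in a product
  \<open>s\<^sup>-\<^sup>m k s\<^sup>n\<close> by one.\<close>

lemma (in group) shift_conj:
  assumes "a \<in> carrier G" "b \<in> carrier G" "s \<in> carrier G" "k \<in> carrier G"
  shows "inv a \<otimes> k \<otimes> b = inv (s \<otimes> a) \<otimes> (s \<otimes> k \<otimes> inv s) \<otimes> (s \<otimes> b)"
proof -
  have "inv s \<otimes> (s \<otimes> x) = x" if "x \<in> carrier G" for x
    using assms that by (simp add: m_assoc[symmetric])
  then show ?thesis using assms by (simp add: m_assoc inv_mult_group)
qed

text \<open>Multiplication of two products \<open>s\<^sup>-\<^sup>m k s\<^sup>n\<close> and \<open>s\<^sup>-\<^sup>n k' s\<^sup>l\<close>, whose inner exponents agree.\<close>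

lemma (in group) cancel_middle:
  assumes "a \<in> carrier G" "b \<in> carrier G" "c \<in> carrier G" "k \<in> carrier G" "k' \<in> carrier G"
  shows "(a \<otimes> k \<otimes> b) \<otimes> (inv b \<otimes> k' \<otimes> c) = a \<otimes> (k \<otimes> k') \<otimes> c"
proof -
  have "b \<otimes> (inv b \<otimes> x) = x" if "x \<in> carrier G" for x
    using assms that by (simp add: m_assoc[symmetric])
  then show ?thesis using assms by (simp add: m_assoc)
qed

lemma (in group) conj_mult:
  assumes "s \<in> carrier G" "x \<in> carrier G" "y \<in> carrier G"
  shows "(s \<otimes> x \<otimes> inv s) \<otimes> (s \<otimes> y \<otimes> inv s) = s \<otimes> (x \<otimes> y) \<otimes> inv s"
  using cancel_middle[of s "inv s" "inv s" x y] assms by simp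

lemma (in group) generate_commute:
  assumes A: "A \<subseteq> carrier G" and B: "B \<subseteq> carrier G"
    and comm: "\<And>a b. a \<in> A \<Longrightarrow> b \<in> B \<Longrightarrow> a \<otimes> b = b \<otimes> a"
    and x: "x \<in> generate G A" and y: "y \<in> generate G B"
  shows "x \<otimes> y = y \<otimes> x"
proof -
  have *: "c \<otimes> z = z \<otimes> c"
    if "C \<subseteq> carrier G" "z \<in> carrier G" "\<And>a. a \<in> C \<Longrightarrow> a \<otimes> z = z \<otimes> a" "c \<in> generate G C" for C z c
    using that(4)
  proof induction
    case (inv h)
    then have h: "h \<in> carrier G" "h \<otimes> z = z \<otimes> h" using that by auto
    have "inv h \<otimes> z = inv h \<otimes> (z \<otimes> h) \<otimes> inv h" using h(1) that(2) by (simp add: m_assoc)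
    also have "\<dots> = z \<otimes> inv h" using h(1) that(2) by (simp add: h(2)[symmetric] m_assoc[symmetric])
    finally show ?case .
  next
    case (eng h1 h2)
    then have h: "h1 \<in> carrier G" "h2 \<in> carrier G" using generate_in_carrier[OF that(1)] by auto
    have "h1 \<otimes> h2 \<otimes> z = h1 \<otimes> (z \<otimes> h2)" using h that(2) eng.IH(2) by (simp add: m_assoc)
    also have "\<dots> = z \<otimes> h1 \<otimes> h2" using h that(2) eng.IH(1) by (simp add: m_assoc[symmetric])
    finally show ?case using h that(2) by (simp add: m_assoc)
  qed (use that in auto)
  have "x \<in> carrier G" using generate_in_carrier[OF A x] .
  moreover have "x \<otimes> b = b \<otimes> x" if "b \<in> B" for b
    using *[OF A _ _ x, of b] comm that B by auto
  ultimately show ?thesis using *[OF B _ _ y, of x] by metis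
qed

text \<open>The relators are those of the factors and the commutators of generators of different factors.
  Homomorphisms of the factors into \<open>H\<close> that commute on generators commute everywhere, so their product is
  a homomorphism.\<close>

lemma presents_DirProd:
  fixes G :: "'a monoid" and G' :: "'b monoid"
  assumes pres: "presents G S g R" and pres': "presents G' S' g' R'"
  shows "presents (G \<times>\<times> G') (S <+> S')
     (case_sum (\<lambda>s. (g s, \<one>\<^bsub>G'\<^esub>)) (\<lambda>s. (\<one>\<^bsub>G\<^esub>, g' s)))
     (lift_word Inl ` R \<union> lift_word Inr ` R' \<union> (\<Union>s\<in>S. \<Union>t\<in>S'. {comm_word (Inl s) (Inr t)}))"
    (is "presents ?P ?S ?g ?R")
proof -
  note G = presentsD[OF pres] and G' = presentsD[OF pres']
  interpret G: group G by fact
  interpret G': group G' by fact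
  interpret P: group ?P by (rule DirProd_group) fact+
  have l: "(\<lambda>x. (x, \<one>\<^bsub>G'\<^esub>)) \<in> hom G ?P" and r: "(\<lambda>x. (\<one>\<^bsub>G\<^esub>, x)) \<in> hom G' ?P"
    by (auto simp: hom_def DirProd_def)
  interpret l: group_hom G ?P "\<lambda>x. (x, \<one>\<^bsub>G'\<^esub>)"
    using l by (simp add: group_hom_def group_hom_axioms_def G P.is_group)
  interpret r: group_hom G' ?P "\<lambda>x. (\<one>\<^bsub>G\<^esub>, x)"
    using r by (simp add: group_hom_def group_hom_axioms_def G' P.is_group)
  \<comment> \<open>As rewrite rules these are inverse to the ones for unit and product in the direct product.\<close>
  note [simp del] = l.hom_one l.hom_mult r.hom_one r.hom_mult
  have gl: "?g \<circ> Inl = (\<lambda>x. (x, \<one>\<^bsub>G'\<^esub>)) \<circ> g" and gr: "?g \<circ> Inr = (\<lambda>x. (\<one>\<^bsub>G\<^esub>, x)) \<circ> g'" by auto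
  show ?thesis
  proof (rule presentsI)
    show "finite ?S" "finite ?R" using G G' by auto
    have "lift_word Inl w \<in> group_words ?S" if "w \<in> group_words S" for w
      using that by (induction rule: group_words_induct) (auto simp: lift_word_def)
    moreover have "lift_word Inr w \<in> group_words ?S" if "w \<in> group_words S'" for w
      using that by (induction rule: group_words_induct) (auto simp: lift_word_def)
    ultimately show "?R \<subseteq> group_words ?S" using G(4) G'(4) by (auto simp: comm_word_def)
    show g: "?g \<in> ?S \<rightarrow> carrier ?P" using G(5) G'(5) by auto
    show "carrier ?P \<subseteq> generate ?P (?g ` ?S)"
    proof
      fix z assume "z \<in> carrier ?P"
      then obtain x y where z: "z = (x, y)" "x \<in> carrier G" "y \<in> carrier G'" by auto
      have "(x, \<one>\<^bsub>G'\<^esub>) \<in> (\<lambda>x. (x, \<one>\<^bsub>G'\<^esub>)) ` generate G (g ` S)" using z G(6) by auto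
      also have "\<dots> = generate ?P ((\<lambda>x. (x, \<one>\<^bsub>G'\<^esub>)) ` g ` S)"
        by (rule l.generate_img[symmetric]) (use G(5) in auto)
      also have "\<dots> \<subseteq> generate ?P (?g ` ?S)" by (rule P.mono_generate) force
      finally have 1: "(x, \<one>\<^bsub>G'\<^esub>) \<in> generate ?P (?g ` ?S)" .
      have "(\<one>\<^bsub>G\<^esub>, y) \<in> (\<lambda>x. (\<one>\<^bsub>G\<^esub>, x)) ` generate G' (g' ` S')" using z G'(6) by auto
      also have "\<dots> = generate ?P ((\<lambda>x. (\<one>\<^bsub>G\<^esub>, x)) ` g' ` S')"
        by (rule r.generate_img[symmetric]) (use G'(5) in auto)
      also have "\<dots> \<subseteq> generate ?P (?g ` ?S)" by (rule P.mono_generate) force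
      finally have 2: "(\<one>\<^bsub>G\<^esub>, y) \<in> generate ?P (?g ` ?S)" .
      show "z \<in> generate ?P (?g ` ?S)" using generate.eng[OF 1 2] z by simp
    qed
    have 1: "eval_word ?P ?g (lift_word Inl w) = \<one>\<^bsub>?P\<^esub>" if "w \<in> R" for w
      unfolding eval_lift_word gl eval_word_hom[OF G(1) P.is_group l G(5) subsetD[OF G(4) that], symmetric]
      by (simp add: G(7)[OF that])
    have 2: "eval_word ?P ?g (lift_word Inr w) = \<one>\<^bsub>?P\<^esub>" if "w \<in> R'" for w
      unfolding eval_lift_word gr eval_word_hom[OF G'(1) P.is_group r G'(5) subsetD[OF G'(4) that], symmetric]
      by (simp add: G'(7)[OF that])
    have 3: "eval_word ?P ?g (comm_word (Inl s) (Inr t)) = \<one>\<^bsub>?P\<^esub>" if "s \<in> S" "t \<in> S'" for s t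
    proof -
      have "g s \<in> carrier G" "g' t \<in> carrier G'" using G(5) G'(5) that by auto
      then show ?thesis by (subst P.eval_comm_word) simp_all
    qed
    show "eval_word ?P ?g w = \<one>\<^bsub>?P\<^esub>" if "w \<in> ?R" for w
      using that by (elim UnE imageE UN_E) (simp_all only: singleton_iff 1 2 3)
  next
    fix H :: "(bool \<times> nat) list set set monoid" and h
    assume H: "group H" and h: "h \<in> ?S \<rightarrow> carrier H" and rel: "\<And>r. r \<in> ?R \<Longrightarrow> eval_word H h r = \<one>\<^bsub>H\<^esub>"
    interpret H: group H by fact
    have h1: "h \<circ> Inl \<in> S \<rightarrow> carrier H" and h2: "h \<circ> Inr \<in> S' \<rightarrow> carrier H" using h by auto
    have "\<exists>\<phi>\<in>hom G H. \<forall>s\<in>S. \<phi> (g s) = (h \<circ> Inl) s"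
      by (rule presents_hom[OF pres H h1]) (use rel in \<open>auto simp: eval_lift_word[symmetric]\<close>)
    then obtain \<phi> where \<phi>: "\<phi> \<in> hom G H" "\<And>s. s \<in> S \<Longrightarrow> \<phi> (g s) = (h \<circ> Inl) s" by blast
    have "\<exists>\<phi>'\<in>hom G' H. \<forall>s\<in>S'. \<phi>' (g' s) = (h \<circ> Inr) s"
      by (rule presents_hom[OF pres' H h2]) (use rel in \<open>auto simp: eval_lift_word[symmetric]\<close>)
    then obtain \<phi>' where \<phi>': "\<phi>' \<in> hom G' H" "\<And>s. s \<in> S' \<Longrightarrow> \<phi>' (g' s) = (h \<circ> Inr) s" by blast
    interpret \<phi>: group_hom G H \<phi> using \<phi> by (simp add: group_hom_def group_hom_axioms_def G H)
    interpret \<phi>': group_hom G' H \<phi>' using \<phi>' by (simp add: group_hom_def group_hom_axioms_def G' H)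
    have comm: "\<phi> x \<otimes>\<^bsub>H\<^esub> \<phi>' y = \<phi>' y \<otimes>\<^bsub>H\<^esub> \<phi> x" if "x \<in> carrier G" "y \<in> carrier G'" for x y
    proof (rule H.generate_commute)
      show "\<phi> x \<in> generate H (\<phi> ` g ` S)"
        using \<phi>.generate_img[of "g ` S"] that G(5,6) by auto
      show "\<phi>' y \<in> generate H (\<phi>' ` g' ` S')"
        using \<phi>'.generate_img[of "g' ` S'"] that G'(5,6) by auto
      fix a b assume "a \<in> \<phi> ` g ` S" "b \<in> \<phi>' ` g' ` S'"
      then obtain s t where st: "s \<in> S" "t \<in> S'" "a = h (Inl s)" "b = h (Inr t)"
        using \<phi>(2) \<phi>'(2) by auto
      then have "eval_word H h (comm_word (Inl s) (Inr t)) = \<one>\<^bsub>H\<^esub>" using rel by blast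
      then show "a \<otimes>\<^bsub>H\<^esub> b = b \<otimes>\<^bsub>H\<^esub> a" using st h by (subst (asm) H.eval_comm_word) auto
    qed (use G(5) G'(5) in \<open>auto intro!: \<phi>.hom_closed \<phi>'.hom_closed\<close>)
    define \<theta> where "\<theta> = (\<lambda>(x, y). \<phi> x \<otimes>\<^bsub>H\<^esub> \<phi>' y)"
    have "\<theta> \<in> hom ?P H"
    proof (rule homI)
      fix p assume "p \<in> carrier ?P"
      then obtain x y where p: "p = (x, y)" "x \<in> carrier G" "y \<in> carrier G'" by auto
      then show "\<theta> p \<in> carrier H" by (simp add: \<theta>_def)
      fix q assume "q \<in> carrier ?P"
      then obtain x' y' where q: "q = (x', y')" "x' \<in> carrier G" "y' \<in> carrier G'" by auto
      show "\<theta> (p \<otimes>\<^bsub>?P\<^esub> q) = \<theta> p \<otimes>\<^bsub>H\<^esub> \<theta> q"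
      proof -
        have "\<phi> x' \<otimes>\<^bsub>H\<^esub> (\<phi>' y \<otimes>\<^bsub>H\<^esub> \<phi>' y') = \<phi>' y \<otimes>\<^bsub>H\<^esub> (\<phi> x' \<otimes>\<^bsub>H\<^esub> \<phi>' y')"
          using p q comm[of x' y] by (simp add: H.m_assoc[symmetric])
        then show ?thesis using p q by (simp add: \<theta>_def H.m_assoc)
      qed
    qed
    moreover have "\<forall>s\<in>?S. \<theta> (?g s) = h s"
    proof
      fix s assume "s \<in> ?S"
      then show "\<theta> (?g s) = h s"
      proof (rule PlusE)
        fix t assume t: "t \<in> S" "s = Inl t"
        then have "h s \<in> carrier H" using h by auto
        then show ?thesis using t \<phi>(2)[OF t(1)] by (simp add: \<theta>_def)
      next
        fix t assume t: "t \<in> S'" "s = Inr t"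
        then have "h s \<in> carrier H" using h by auto
        then show ?thesis using t \<phi>'(2)[OF t(1)] by (simp add: \<theta>_def)
      qed
    qed
    ultimately show "\<exists>\<phi>\<in>hom ?P H. \<forall>s\<in>?S. \<phi> (?g s) = h s" by blast
  qed (rule P.is_group)
qed

section \<open>Ascending HNN extensions\<close>

text \<open>To the relators of \<open>K\<close> one adds, for each generator of \<open>K\<close>, the relator that writes its conjugate by \<open>s\<close>
  as a word in the generators of \<open>K\<close>. A homomorphism \<open>\<phi>\<close> on \<open>K\<close> and an image \<open>\<sigma>\<close> of \<open>s\<close> that satisfy these
  relators extend by \<open>s\<^sup>-\<^sup>m k s\<^sup>n \<mapsto> \<sigma>\<^sup>-\<^sup>m \<phi>(k) \<sigma>\<^sup>n\<close>: raising \<open>m\<close> and \<open>n\<close> together replaces \<open>k\<close> by a conjugate and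
  changes neither side, so the inner exponents of two factors can be made equal. Since no proper
  power of \<open>s\<close> is in \<open>K\<close>, the identity is represented with \<open>m = n\<close> and \<open>k = 1\<close> only.\<close>

lemma (in group) presents_ascending_HNN:
  assumes K: "subgroup K G" and s: "s \<in> carrier G"
    and asc: "\<And>k. k \<in> K \<Longrightarrow> s \<otimes> k \<otimes> inv s \<in> K"
    and decomp: "\<And>x. x \<in> carrier G \<Longrightarrow> \<exists>m n. \<exists>k\<in>K. x = inv (s [^] (m::nat)) \<otimes> k \<otimes> s [^] (n::nat)"
    and free: "\<And>n::nat. s [^] n \<in> K \<Longrightarrow> n = 0"
    and pres: "presents (G\<lparr>carrier := K\<rparr>) S g R"
  shows "\<exists>R'. presents G (insert None (Some ` S)) (case_option s g) R'"
proof -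
  let ?K = "G\<lparr>carrier := K\<rparr>" and ?S = "insert None (Some ` S)" and ?g = "case_option s g"
  note P = presentsD[OF pres]
  interpret K: group ?K by fact
  have KG: "K \<subseteq> carrier G" using K by (rule subgroup.subset)
  have gK: "g \<in> S \<rightarrow> K" using P(5) by simp
  have ev: "eval_word ?K f w = eval_word G f w" if "f \<in> S \<rightarrow> K" "w \<in> group_words S" for f w
    using that(2)
  proof (induction rule: group_words_induct)
    case (Cons e s w)
    then have "inv\<^bsub>?K\<^esub> f s = inv (f s)" using that(1) m_inv_consistent[OF K, of "f s"] by auto
    then show ?case using Cons by simp
  qed simp
  have "\<exists>w\<in>group_words S. eval_word G g w = s \<otimes> g i \<otimes> inv s" if "i \<in> S" for i
  proof -
    have "g i \<in> K" using gK that by auto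
    then have "s \<otimes> g i \<otimes> inv s \<in> eval_word ?K g ` group_words S"
      using K.eval_word_generate[OF P(5)] P(6) asc[of "g i"] by simp
    then show ?thesis using ev[OF gK] by auto
  qed
  then obtain W where W: "\<And>i. i \<in> S \<Longrightarrow> W i \<in> group_words S"
    "\<And>i. i \<in> S \<Longrightarrow> eval_word G g (W i) = s \<otimes> g i \<otimes> inv s" by metis
  define rel where "rel i = lift_word Some (W i) @ [(True, None), (False, Some i), (False, None)]" for i
  have lift: "lift_word Some w \<in> group_words ?S" if "w \<in> group_words S" for w
    using that by (induction rule: group_words_induct) (auto simp: lift_word_def)
  have rel_words: "rel i \<in> group_words ?S" if "i \<in> S" for i
    using lift[OF W(1)[OF that]] that by (simp add: rel_def)
  have g: "?g \<in> ?S \<rightarrow> carrier G" using gK KG s by auto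
  have gSome: "?g \<circ> Some = g" by auto
  have "presents G ?S ?g (lift_word Some ` R \<union> rel ` S)"
  proof (rule presentsI)
    show "finite ?S" "finite (lift_word Some ` R \<union> rel ` S)" using P by auto
    show "lift_word Some ` R \<union> rel ` S \<subseteq> group_words ?S" using lift rel_words P(4) by auto
    show "carrier G \<subseteq> generate G (?g ` ?S)"
    proof
      fix x assume "x \<in> carrier G"
      then obtain m n k where k: "k \<in> K" "x = inv (s [^] (m::nat)) \<otimes> k \<otimes> s [^] (n::nat)"
        using decomp by blast
      have sub: "subgroup (generate G (?g ` ?S)) G"
        by (rule generate_is_subgroup) (use g in auto)
      have sg: "s \<in> generate G (?g ` ?S)" by (rule generate.incl) force
      have pow: "s [^] (n::nat) \<in> generate G (?g ` ?S)" for n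
        by (induction n) (use sub sg in \<open>auto intro: subgroup.m_closed subgroup.one_closed\<close>)
      have "k \<in> eval_word ?K g ` group_words S"
        using K.eval_word_generate[OF P(5)] P(6) k by simp
      then obtain w where w: "w \<in> group_words S" "k = eval_word G (?g \<circ> Some) w"
        using ev[OF gK] by (auto simp: gSome)
      then have "k = eval_word G ?g (lift_word Some w)" by (simp add: eval_lift_word)
      then have "k \<in> generate G (?g ` ?S)"
        using lift[OF w(1)] eval_word_generate[OF g] by blast
      then show "x \<in> generate G (?g ` ?S)"
        unfolding k using sub pow by (intro subgroup.m_closed subgroup.m_inv_closed)
    qed
    fix r assume "r \<in> lift_word Some ` R \<union> rel ` S"
    then consider r' where "r' \<in> R" "r = lift_word Some r'" | i where "i \<in> S" "r = rel i" by auto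
    then show "eval_word G ?g r = \<one>"
    proof cases
      case 1
      then show ?thesis using ev[OF gK, of r'] P(4) P(7)[of r'] by (auto simp: eval_lift_word gSome)
    next
      case 2
      then show ?thesis
        using g gK KG s W(2)[OF 2(1)] unfolding 2(2) rel_def
        by (subst eval_conj_relator[of _ ?S]) (auto simp: lift W(1) eval_lift_word gSome)
    qed
  next
    fix H :: "(bool \<times> nat) list set set monoid" and h
    assume H: "group H" and h: "h \<in> ?S \<rightarrow> carrier H"
      and hrel: "\<And>r. r \<in> lift_word Some ` R \<union> rel ` S \<Longrightarrow> eval_word H h r = \<one>\<^bsub>H\<^esub>"
    interpret H: group H by fact
    have hS: "h \<circ> Some \<in> S \<rightarrow> carrier H" using h by auto
    define \<sigma> where "\<sigma> = h None"
    have \<sigma>: "\<sigma> \<in> carrier H" using h by (auto simp: \<sigma>_def)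
    have "\<exists>\<phi>\<in>hom ?K H. \<forall>i\<in>S. \<phi> (g i) = (h \<circ> Some) i"
      by (rule presents_hom[OF pres H hS]) (use hrel in \<open>auto simp: eval_lift_word[symmetric]\<close>)
    then obtain \<phi> where \<phi>: "\<phi> \<in> hom ?K H" "\<And>i. i \<in> S \<Longrightarrow> \<phi> (g i) = (h \<circ> Some) i" by blast
    interpret \<phi>: group_hom ?K H \<phi> using \<phi> by (simp add: group_hom_def group_hom_axioms_def P H)
    have \<phi>_closed: "\<phi> k \<in> carrier H" if "k \<in> K" for k using \<phi>.hom_closed that by simp
    have \<phi>_mult: "\<phi> (k \<otimes> k') = \<phi> k \<otimes>\<^bsub>H\<^esub> \<phi> k'" if "k \<in> K" "k' \<in> K" for k k'
      using \<phi>.hom_mult that by simp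
    have \<phi>_conj: "\<phi> (s \<otimes> k \<otimes> inv s) = \<sigma> \<otimes>\<^bsub>H\<^esub> \<phi> k \<otimes>\<^bsub>H\<^esub> inv\<^bsub>H\<^esub> \<sigma>" if k: "k \<in> K" for k
    proof (rule hom_eq_on_generate[of ?K H "\<lambda>k. \<phi> (s \<otimes> k \<otimes> inv s)" "\<lambda>k. \<sigma> \<otimes>\<^bsub>H\<^esub> \<phi> k \<otimes>\<^bsub>H\<^esub> inv\<^bsub>H\<^esub> \<sigma>" "g ` S"])
      show "(\<lambda>k. \<phi> (s \<otimes> k \<otimes> inv s)) \<in> hom ?K H"
      proof (rule homI)
        fix x y assume xy: "x \<in> carrier ?K" "y \<in> carrier ?K"
        then have "x \<in> carrier G" "y \<in> carrier G" using KG by auto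
        then have "s \<otimes> (x \<otimes> y) \<otimes> inv s = (s \<otimes> x \<otimes> inv s) \<otimes> (s \<otimes> y \<otimes> inv s)"
          using s by (simp add: conj_mult)
        then show "\<phi> (s \<otimes> (x \<otimes>\<^bsub>?K\<^esub> y) \<otimes> inv s) = \<phi> (s \<otimes> x \<otimes> inv s) \<otimes>\<^bsub>H\<^esub> \<phi> (s \<otimes> y \<otimes> inv s)"
          using xy asc by (simp add: \<phi>_mult)
      qed (use asc \<phi>_closed in auto)
      show "(\<lambda>k. \<sigma> \<otimes>\<^bsub>H\<^esub> \<phi> k \<otimes>\<^bsub>H\<^esub> inv\<^bsub>H\<^esub> \<sigma>) \<in> hom ?K H"
      proof (rule homI)
        fix x y assume "x \<in> carrier ?K" "y \<in> carrier ?K"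
        then show "\<sigma> \<otimes>\<^bsub>H\<^esub> \<phi> (x \<otimes>\<^bsub>?K\<^esub> y) \<otimes>\<^bsub>H\<^esub> inv\<^bsub>H\<^esub> \<sigma> =
            (\<sigma> \<otimes>\<^bsub>H\<^esub> \<phi> x \<otimes>\<^bsub>H\<^esub> inv\<^bsub>H\<^esub> \<sigma>) \<otimes>\<^bsub>H\<^esub> (\<sigma> \<otimes>\<^bsub>H\<^esub> \<phi> y \<otimes>\<^bsub>H\<^esub> inv\<^bsub>H\<^esub> \<sigma>)"
          using \<sigma> \<phi>_closed by (simp add: \<phi>_mult H.conj_mult)
      qed (use \<sigma> \<phi>_closed in auto)
      fix a assume "a \<in> g ` S"
      then obtain i where i: "i \<in> S" "a = g i" by auto
      have "\<phi> (s \<otimes> a \<otimes> inv s) = \<phi> (eval_word ?K g (W i))"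
        using W[OF i(1)] ev[OF gK] i by simp
      also have "\<dots> = eval_word H (\<phi> \<circ> g) (W i)"
        by (rule eval_word_hom[OF P(1) H \<phi>(1) P(5) W(1)[OF i(1)]])
      also have "\<dots> = eval_word H (h \<circ> Some) (W i)"
        by (rule eval_word_cong[OF _ W(1)[OF i(1)]]) (use \<phi> in auto)
      also have "\<dots> = \<sigma> \<otimes>\<^bsub>H\<^esub> h (Some i) \<otimes>\<^bsub>H\<^esub> inv\<^bsub>H\<^esub> \<sigma>"
      proof -
        have "eval_word H h (rel i) = \<one>\<^bsub>H\<^esub>" using hrel i by blast
        then show ?thesis unfolding rel_def \<sigma>_def using i h W(1)[OF i(1)]
          by (subst (asm) H.eval_conj_relator[of h ?S]) (auto simp: lift eval_lift_word)
      qed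
      finally show "\<phi> (s \<otimes> a \<otimes> inv s) = \<sigma> \<otimes>\<^bsub>H\<^esub> \<phi> a \<otimes>\<^bsub>H\<^esub> inv\<^bsub>H\<^esub> \<sigma>"
        using i \<phi> by simp
    qed (use P H k gK in auto)
    define Q where "Q m n x y \<longleftrightarrow> (\<exists>k\<in>K. x = inv (s [^] (m::nat)) \<otimes> k \<otimes> s [^] (n::nat) \<and>
      y = inv\<^bsub>H\<^esub> (\<sigma> [^]\<^bsub>H\<^esub> m) \<otimes>\<^bsub>H\<^esub> \<phi> k \<otimes>\<^bsub>H\<^esub> \<sigma> [^]\<^bsub>H\<^esub> n)" for m n x y
    have Q_Suc: "Q (Suc m) (Suc n) x y" if "Q m n x y" for m n x y
    proof -
      from that obtain k where k: "k \<in> K" "x = inv (s [^] m) \<otimes> k \<otimes> s [^] n"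
        "y = inv\<^bsub>H\<^esub> (\<sigma> [^]\<^bsub>H\<^esub> m) \<otimes>\<^bsub>H\<^esub> \<phi> k \<otimes>\<^bsub>H\<^esub> \<sigma> [^]\<^bsub>H\<^esub> n" by (auto simp: Q_def)
      have "x = inv (s [^] Suc m) \<otimes> (s \<otimes> k \<otimes> inv s) \<otimes> s [^] Suc n"
        unfolding k nat_pow_Suc2[OF s] by (rule shift_conj) (use s k KG in auto)
      moreover have "y = inv\<^bsub>H\<^esub> (\<sigma> [^]\<^bsub>H\<^esub> Suc m) \<otimes>\<^bsub>H\<^esub> \<phi> (s \<otimes> k \<otimes> inv s) \<otimes>\<^bsub>H\<^esub> \<sigma> [^]\<^bsub>H\<^esub> Suc n"
        unfolding k \<phi>_conj[OF k(1)] H.nat_pow_Suc2[OF \<sigma>] by (rule H.shift_conj) (use \<sigma> k \<phi>_closed in auto)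
      ultimately show ?thesis unfolding Q_def using asc[OF k(1)] by blast
    qed
    have Q_add: "Q (m + d) (n + d) x y" if "Q m n x y" for m n d x y
      by (induction d) (use that Q_Suc in auto)
    have "\<exists>\<theta>\<in>hom G H. \<forall>x y. (\<exists>m n. Q m n x y) \<longrightarrow> \<theta> x = y"
    proof (rule homI_graph)
      fix x y assume "\<exists>m n. Q m n x y"
      then show "x \<in> carrier G \<and> y \<in> carrier H"
        using s \<sigma> KG \<phi>_closed by (auto simp: Q_def)
    next
      fix x assume "x \<in> carrier G"
      then show "\<exists>y. \<exists>m n. Q m n x y" using decomp unfolding Q_def by blast
    next
      fix x y x' y' assume "\<exists>m n. Q m n x y" "\<exists>m n. Q m n x' y'"
      then obtain m n m' n' where "Q m n x y" "Q m' n' x' y'" by blast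
      then have Q1: "Q (m + m') (n + m') x y" and Q2: "Q (n + m') (n' + n) x' y'"
        using Q_add[of m' n' x' y' n] Q_add[of m n x y m'] by (auto simp: add.commute)
      from Q1 obtain k where k: "k \<in> K" "x = inv (s [^] (m + m')) \<otimes> k \<otimes> s [^] (n + m')"
        "y = inv\<^bsub>H\<^esub> (\<sigma> [^]\<^bsub>H\<^esub> (m + m')) \<otimes>\<^bsub>H\<^esub> \<phi> k \<otimes>\<^bsub>H\<^esub> \<sigma> [^]\<^bsub>H\<^esub> (n + m')" by (auto simp: Q_def)
      from Q2 obtain k' where k': "k' \<in> K" "x' = inv (s [^] (n + m')) \<otimes> k' \<otimes> s [^] (n' + n)"
        "y' = inv\<^bsub>H\<^esub> (\<sigma> [^]\<^bsub>H\<^esub> (n + m')) \<otimes>\<^bsub>H\<^esub> \<phi> k' \<otimes>\<^bsub>H\<^esub> \<sigma> [^]\<^bsub>H\<^esub> (n' + n)" by (auto simp: Q_def)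
      have "x \<otimes> x' = inv (s [^] (m + m')) \<otimes> (k \<otimes> k') \<otimes> s [^] (n' + n)"
        unfolding k k' by (rule cancel_middle) (use s k k' KG in auto)
      moreover have "y \<otimes>\<^bsub>H\<^esub> y' = inv\<^bsub>H\<^esub> (\<sigma> [^]\<^bsub>H\<^esub> (m + m')) \<otimes>\<^bsub>H\<^esub> \<phi> (k \<otimes> k') \<otimes>\<^bsub>H\<^esub> \<sigma> [^]\<^bsub>H\<^esub> (n' + n)"
        unfolding k k' \<phi>_mult[OF k(1) k'(1)] by (rule H.cancel_middle) (use \<sigma> k k' \<phi>_closed in auto)
      ultimately show "\<exists>m n. Q m n (x \<otimes> x') (y \<otimes>\<^bsub>H\<^esub> y')"
        unfolding Q_def using subgroup.m_closed[OF K k(1) k'(1)] by blast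
    next
      fix y assume "\<exists>m n. Q m n \<one> y"
      then obtain m n k where k: "k \<in> K" "\<one> = inv (s [^] (m::nat)) \<otimes> k \<otimes> s [^] (n::nat)"
        "y = inv\<^bsub>H\<^esub> (\<sigma> [^]\<^bsub>H\<^esub> m) \<otimes>\<^bsub>H\<^esub> \<phi> k \<otimes>\<^bsub>H\<^esub> \<sigma> [^]\<^bsub>H\<^esub> n" unfolding Q_def by blast
      have kG: "k \<in> carrier G" using k KG by auto
      have eq: "s [^] m = k \<otimes> s [^] n"
      proof -
        have "s [^] m = s [^] m \<otimes> (inv (s [^] m) \<otimes> k \<otimes> s [^] n)" using k(2)[symmetric] s by simp
        also have "\<dots> = k \<otimes> s [^] n" using s kG by (simp add: m_assoc[symmetric])
        finally show ?thesis .
      qed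
      have mn: "m = n"
      proof (cases "n \<le> m")
        case True
        then have "s [^] (m - n) \<otimes> s [^] n = k \<otimes> s [^] n" using eq s by (simp add: nat_pow_mult)
        then have "s [^] (m - n) = k" using s kG by simp
        then show ?thesis using free[of "m - n"] k(1) True by simp
      next
        case False
        then have "s [^] n = s [^] (n - m) \<otimes> s [^] m" using s by (simp add: nat_pow_mult)
        then have "\<one> \<otimes> s [^] m = k \<otimes> s [^] (n - m) \<otimes> s [^] m"
          using eq s kG by (simp add: m_assoc)
        then have "\<one> = k \<otimes> s [^] (n - m)" using s kG by (simp only: right_cancel nat_pow_closed m_closed one_closed)
        then have "s [^] (n - m) = inv k" using s kG by (metis inv_equality inv_inv nat_pow_closed inv_closed)
        then show ?thesis using free[of "n - m"] subgroup.m_inv_closed[OF K k(1)] False by simp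
      qed
      then have "k = \<one>" using eq s kG by (metis l_one nat_pow_closed one_closed right_cancel)
      then have "\<phi> k = \<one>\<^bsub>H\<^esub>" using \<phi>.hom_one by simp
      then show "y = \<one>\<^bsub>H\<^esub>" using k(3) mn \<sigma> by simp
    qed (use H in auto)
    then obtain \<theta> where \<theta>: "\<theta> \<in> hom G H" "\<And>m n x y. Q m n x y \<Longrightarrow> \<theta> x = y" by blast
    have "\<theta> s = \<sigma>"
    proof (rule \<theta>(2))
      show "Q 0 1 s \<sigma>" unfolding Q_def
        by (rule bexI[of _ \<one>]) (use s \<sigma> \<phi>.hom_one subgroup.one_closed[OF K] in auto)
    qed
    moreover have "\<theta> (g i) = h (Some i)" if "i \<in> S" for i
    proof (rule \<theta>(2))
      have gi: "g i \<in> K" "g i \<in> carrier G" and "h (Some i) \<in> carrier H"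
        using that gK KG h by auto
      then show "Q 0 0 (g i) (h (Some i))" unfolding Q_def
        using \<phi>(2)[OF that] by (intro bexI[OF _ gi(1)]) simp
    qed
    ultimately show "\<exists>\<phi>\<in>hom G H. \<forall>s\<in>?S. \<phi> (?g s) = h s"
      using \<theta>(1) by (auto simp: \<sigma>_def)
  qed (use g is_group in auto)
  then show ?thesis by blast
qed

section \<open>Thompson's group on infinite binary words\<close>

abbreviation "bv \<equiv> binary_value"

definition zeros :: "bool stream" where "zeros = sconst False"
definition ones :: "bool stream" where "ones = sconst True"

lemma zeros_unfold: "zeros = False ## zeros" and ones_unfold: "ones = True ## ones"
  unfolding zeros_def ones_def by (metis siterate.code id_apply)+

text \<open>If \<open>q\<close> were a proper extension \<open>p @ r\<close> of \<open>p\<close>, every infinite word would begin with the letters of \<open>r\<close>.\<close>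

lemma shift_same_tail_cancel:
  assumes "\<And>u :: bool stream. p @- u = q @- u"
  shows "p = q"
proof -
  have *: "p = q" if eq: "\<And>u :: bool stream. p @- u = q @- u" and le: "length p \<le> length q" for p q
  proof -
    have "p = take (length p) q"
      using arg_cong[OF eq[of zeros], of "stake (length p)"] le by (simp add: stake_shift)
    then obtain r where r: "q = p @ r" by (metis append_take_drop_id)
    then have "u = r @- u" for u using eq[of u] by (simp add: shift_left_inj)
    then have "r = []"
      using zeros_unfold ones_unfold by (cases r) (metis (full_types) shift.simps(2) stream.inject)+
    then show ?thesis using r by simp
  qed
  show ?thesis using *[of p q] *[of q p] assms by (metis le_cases)
qed

lemma ends_in_ones_shift [simp]: "ends_in_ones (p @- u) \<longleftrightarrow> ends_in_ones u"
  by (induction p) (simp_all add: ends_in_ones_Cons)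

lemma bv_zeros [simp]: "bv zeros = 0"
proof -
  have "bv zeros = (of_bool False + bv zeros) / 2" by (metis binary_value_Cons zeros_unfold)
  then show ?thesis by simp
qed

lemma bv_ones [simp]: "bv ones = 1"
proof -
  have "bv ones = (of_bool True + bv ones) / 2" by (metis binary_value_Cons ones_unfold)
  then show ?thesis by simp
qed

lemma bv_eq_0_iff: "bv u = 0 \<longleftrightarrow> u = zeros" and bv_eq_1_iff: "bv u = 1 \<longleftrightarrow> u = ones"
  by (metis binary_value_eq_0 zeros_def bv_zeros) (metis binary_value_eq_1 ones_def bv_ones)

lemma bv_shift: "bv (p @- u) = bv (p @- zeros) + bv u / 2 ^ length p"
  by (induction p) (simp_all add: binary_value_Cons field_simps)

lemma bv_Cons_le:
  "bv (a ## u) \<le> bv (a ## v) \<longleftrightarrow> bv u \<le> bv v"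
  "bv (False ## u) \<le> bv (True ## v) \<longleftrightarrow> True"
  "bv (True ## u) \<le> bv (False ## v) \<longleftrightarrow> bv v = 1 \<and> bv u = 0"
  using binary_value_nonneg[of u] binary_value_le_1[of u] binary_value_nonneg[of v] binary_value_le_1[of v]
  by (auto simp: binary_value_Cons divide_le_cancel)

text \<open>An equivalence, so that equality of values is respected as well: the two expansions of a dyadic
  rational go to words with a common value.\<close>

definition monotone_map :: "(bool stream \<Rightarrow> bool stream) \<Rightarrow> bool" where
  "monotone_map g \<longleftrightarrow> (\<forall>u v. bv u \<le> bv v \<longleftrightarrow> bv (g u) \<le> bv (g v))"

definition prefix_map :: "(bool stream \<Rightarrow> bool stream) \<Rightarrow> nat \<Rightarrow> bool" where
  "prefix_map g N \<longleftrightarrow> (\<forall>p. length p = N \<longrightarrow> (\<exists>q. \<forall>u. g (p @- u) = q @- u))"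

text \<open>Thompson's group in its action on the Cantor set, with the right-action convention for products.\<close>

definition stream_F :: "(bool stream \<Rightarrow> bool stream) monoid" where
  "stream_F = \<lparr>carrier = {g. surj g \<and> monotone_map g \<and> (\<exists>N. prefix_map g N)},
         mult = (\<lambda>f g. g \<circ> f), one = id\<rparr>"

lemma stream_F_simps [simp]: "f \<otimes>\<^bsub>stream_F\<^esub> g = g \<circ> f" "\<one>\<^bsub>stream_F\<^esub> = id"
  by (simp_all add: stream_F_def)

lemma prefix_map_long:
  assumes "prefix_map g N" "N \<le> length p"
  shows "\<exists>q. \<forall>u. g (p @- u) = q @- u"
proof -
  obtain q where q: "\<And>u. g (take N p @- u) = q @- u"
    using assms unfolding prefix_map_def by (metis length_take min.absorb2)
  have "g (p @- u) = (q @ drop N p) @- u" for u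
    using q[of "drop N p @- u"] by (metis append_take_drop_id shift_append)
  then show ?thesis by blast
qed

lemma prefix_map_mono: "prefix_map g N \<Longrightarrow> N \<le> M \<Longrightarrow> prefix_map g M"
  using prefix_map_long unfolding prefix_map_def by blast

lemma stream_F_D:
  assumes "g \<in> carrier stream_F"
  shows stream_F_surj: "surj g" and stream_F_le_iff: "bv (g u) \<le> bv (g v) \<longleftrightarrow> bv u \<le> bv v"
    and stream_F_prefix: "\<exists>N. prefix_map g N"
  using assms by (auto simp: stream_F_def monotone_map_def)

lemma stream_F_eq_iff: "g \<in> carrier stream_F \<Longrightarrow> bv (g u) = bv (g v) \<longleftrightarrow> bv u = bv v"
  using stream_F_le_iff by (metis order_antisym order_refl)

lemma stream_F_I:
  assumes "surj g" "\<And>u v. bv u \<le> bv v \<longleftrightarrow> bv (g u) \<le> bv (g v)" "prefix_map g N"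
  shows "g \<in> carrier stream_F"
  using assms by (auto simp: stream_F_def monotone_map_def)

lemma stream_F_ends_in_ones:
  assumes "g \<in> carrier stream_F"
  shows "ends_in_ones (g u) \<longleftrightarrow> ends_in_ones u"
proof -
  obtain N where "prefix_map g N" using stream_F_prefix[OF assms] by blast
  then obtain q where "g (stake N u @- sdrop N u) = q @- sdrop N u"
    using prefix_map_long[of g N "stake N u"] by auto
  then have "g u = q @- sdrop N u" by (simp add: stake_sdrop)
  then show ?thesis by (metis ends_in_ones_shift stake_sdrop)
qed

text \<open>Words of equal value coincide once both or neither of them end in ones, and prefix replacement
  leaves tails alone.\<close>

lemma stream_F_inj: "g \<in> carrier stream_F \<Longrightarrow> inj g"
  by (rule injI) (metis binary_value_inj stream_F_eq_iff stream_F_ends_in_ones)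

lemma stream_F_bij: "g \<in> carrier stream_F \<Longrightarrow> bij g"
  using stream_F_inj stream_F_surj by (simp add: bij_def)

lemma stream_F_bv_0 [simp]:
  assumes g: "g \<in> carrier stream_F"
  shows "bv (g u) = 0 \<longleftrightarrow> bv u = 0"
proof -
  obtain w where w: "g w = zeros" using stream_F_surj[OF g] by (metis surjD)
  have "bv w = 0"
    using stream_F_le_iff[OF g, of w zeros] binary_value_nonneg[of "g zeros"] binary_value_nonneg[of w] w by simp
  then show ?thesis using stream_F_eq_iff[OF g, of u w] w by simp
qed

lemma stream_F_bv_1 [simp]:
  assumes g: "g \<in> carrier stream_F"
  shows "bv (g u) = 1 \<longleftrightarrow> bv u = 1"
proof -
  obtain w where w: "g w = ones" using stream_F_surj[OF g] by (metis surjD)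
  have "bv w = 1"
    using stream_F_le_iff[OF g, of ones w] binary_value_le_1[of "g ones"] binary_value_le_1[of w] w by simp
  then show ?thesis using stream_F_eq_iff[OF g, of u w] w by simp
qed

lemma stream_F_mult_closed:
  assumes f: "f \<in> carrier stream_F" and g: "g \<in> carrier stream_F"
  shows "g \<circ> f \<in> carrier stream_F"
proof -
  obtain N M where N: "prefix_map f N" and M: "prefix_map g M" using stream_F_prefix assms by blast
  have "prefix_map (g \<circ> f) (N + M)" unfolding prefix_map_def
  proof (intro allI impI)
    fix p :: "bool list" assume p: "length p = N + M"
    obtain q where q: "\<And>u. f (take N p @- u) = q @- u"
      using prefix_map_long[OF N, of "take N p"] p by auto
    obtain q' where q': "\<And>u. g ((q @ drop N p) @- u) = q' @- u"
      using prefix_map_long[OF M, of "q @ drop N p"] p by auto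
    have "(g \<circ> f) (p @- u) = q' @- u" for u
      using q[of "drop N p @- u"] q'[of u] by (metis append_take_drop_id shift_append comp_apply)
    then show "\<exists>q. \<forall>u. (g \<circ> f) (p @- u) = q @- u" by blast
  qed
  moreover have "surj (g \<circ> f)" by (intro comp_surj stream_F_surj assms)
  ultimately show ?thesis
    using assms by (intro stream_F_I) (simp_all add: stream_F_le_iff)
qed

text \<open>Let \<open>M\<close> bound the lengths of the prefixes \<open>Q p\<close> by which \<open>g\<close> replaces words \<open>p\<close> of length \<open>N\<close>. Then a word
  of length \<open>M\<close> begins with some \<open>Q p\<close>, and the inverse of \<open>g\<close> puts \<open>p\<close> back in its place.\<close>

lemma stream_F_inv_closed:
  assumes g: "g \<in> carrier stream_F"
  shows "inv_into UNIV g \<in> carrier stream_F"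
proof -
  have bij: "bij g" by (rule stream_F_bij[OF g])
  have gi: "g (inv_into UNIV g u) = u" "inv_into UNIV g (g u) = u" for u
    using bij by (simp_all add: bij_is_surj surj_f_inv_f bij_is_inj inv_f_f)
  obtain N where "prefix_map g N" using stream_F_prefix[OF g] by blast
  then obtain Q where Q: "\<And>p u. length p = N \<Longrightarrow> g (p @- u) = Q p @- u"
    unfolding prefix_map_def by metis
  define L where "L = {p :: bool list. length p = N}"
  have "finite L" using finite_lists_length_eq[of "UNIV :: bool set" N] by (simp add: L_def)
  define M where "M = Max ((length \<circ> Q) ` L)"
  have M: "length (Q p) \<le> M" if "length p = N" for p
    using \<open>finite L\<close> that unfolding M_def by (intro Max_ge) (auto simp: L_def)
  have "prefix_map (inv_into UNIV g) M" unfolding prefix_map_def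
  proof (intro allI impI)
    fix y :: "bool list" assume y: "length y = M"
    define z where "z = inv_into UNIV g (y @- zeros)"
    let ?p = "stake N z" and ?q = "Q (stake N z)"
    have eq: "y @- zeros = ?q @- sdrop N z"
      using Q[of ?p "sdrop N z"] gi(1)[of "y @- zeros"] by (simp add: stake_sdrop z_def)
    have "?q = take (length ?q) y"
      using arg_cong[OF eq, of "stake (length ?q)"] M[of ?p] y by (simp add: stake_shift)
    then obtain y' where y': "y = ?q @ y'" by (metis append_take_drop_id)
    have "inv_into UNIV g (y @- u) = (?p @ y') @- u" for u
      using Q[of ?p "y' @- u"] gi(2)[of "?p @- y' @- u"] by (subst y') simp
    then show "\<exists>q. \<forall>u. inv_into UNIV g (y @- u) = q @- u" by blast
  qed
  moreover have "bv u \<le> bv v \<longleftrightarrow> bv (inv_into UNIV g u) \<le> bv (inv_into UNIV g v)" for u v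
    using stream_F_le_iff[OF g, of "inv_into UNIV g u" "inv_into UNIV g v"] gi by simp
  ultimately show ?thesis using bij by (intro stream_F_I) (simp_all add: bij_imp_bij_inv bij_is_surj)
qed

lemma stream_F_one_closed: "id \<in> carrier stream_F"
  by (rule stream_F_I[of _ 0]) (auto simp: prefix_map_def intro: exI[of _ "[]"])

lemma group_stream_F: "group stream_F"
proof (rule groupI)
  fix g assume g: "g \<in> carrier stream_F"
  show "\<exists>h\<in>carrier stream_F. h \<otimes>\<^bsub>stream_F\<^esub> g = \<one>\<^bsub>stream_F\<^esub>"
    using stream_F_inv_closed[OF g] stream_F_surj[OF g] by (intro bexI[of _ "inv_into UNIV g"]) (simp_all add: surj_iff)
qed (auto simp: stream_F_mult_closed stream_F_one_closed comp_assoc)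

interpretation stream_F: group stream_F by (rule group_stream_F)

lemma stream_F_inv:
  assumes "g \<in> carrier stream_F"
  shows "inv\<^bsub>stream_F\<^esub> g = inv_into UNIV g"
  using stream_F_inv_closed[OF assms] stream_F_surj[OF assms] assms
  by (intro stream_F.inv_equality) (simp_all add: surj_iff)

lemma stream_F_inv_apply: "g \<in> carrier stream_F \<Longrightarrow> g u = v \<Longrightarrow> (inv\<^bsub>stream_F\<^esub> g) v = u"
  by (metis stream_F_inv stream_F_inj inv_f_f)

definition node :: "(bool stream \<Rightarrow> bool stream) \<Rightarrow> (bool stream \<Rightarrow> bool stream) \<Rightarrow> bool stream \<Rightarrow> bool stream" where
  "node f g u = shd u ## (if shd u then g (stl u) else f (stl u))"

lemma node_simps [simp]: "node f g (False ## u) = False ## f u" "node f g (True ## u) = True ## g u"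
  by (simp_all add: node_def)

lemma stream_cases: obtains v where "u = False ## v" | v where "u = True ## v"
  by (cases u) (metis (full_types))

text \<open>Between the two halves values can agree only at one half, for the words \<open>0111\<dots>\<close> and \<open>1000\<dots>\<close>; these are
  fixed because \<open>f\<close> and \<open>g\<close> fix both constant words.\<close>

lemma node_closed:
  assumes f: "f \<in> carrier stream_F" and g: "g \<in> carrier stream_F"
  shows "node f g \<in> carrier stream_F"
proof -
  obtain N M where "prefix_map f N" "prefix_map g M" using stream_F_prefix assms by blast
  then have N: "prefix_map f (max N M)" "prefix_map g (max N M)" by (auto intro: prefix_map_mono)
  have "prefix_map (node f g) (Suc (max N M))" unfolding prefix_map_def
  proof (intro allI impI)
    fix p :: "bool list" assume "length p = Suc (max N M)"
    then obtain a p' where p: "p = a # p'" "length p' = max N M" by (cases p) auto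
    obtain q where "\<And>u. (if a then g else f) (p' @- u) = q @- u"
      using N p(2) unfolding prefix_map_def by (metis (full_types))
    then have "node f g (p @- u) = (a # q) @- u" for u using p by (cases a) auto
    then show "\<exists>q. \<forall>u. node f g (p @- u) = q @- u" by blast
  qed
  moreover have "surj (node f g)"
    unfolding surj_def
  proof
    fix v
    show "\<exists>u. v = node f g u"
      by (cases v rule: stream_cases) (metis node_simps stream_F_surj[OF f] stream_F_surj[OF g] surjD)+
  qed
  moreover have "bv u \<le> bv v \<longleftrightarrow> bv (node f g u) \<le> bv (node f g v)" for u v
  proof -
    show ?thesis
      by (cases u rule: stream_cases; cases v rule: stream_cases)
        (simp_all only: node_simps bv_Cons_le stream_F_le_iff[OF f] stream_F_le_iff[OF g] stream_F_bv_1[OF f] stream_F_bv_0[OF g])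
  qed
  ultimately show ?thesis by (intro stream_F_I)
qed

lemma node_comp: "node f g \<circ> node f' g' = node (f \<circ> f') (g \<circ> g')"
  by (auto simp: fun_eq_iff node_def)

lemma node_eqD: "node f g = node f' g' \<Longrightarrow> f = f' \<and> g = g'"
  by (metis (no_types, lifting) ext node_simps stream.inject)

lemma node_decomp:
  assumes h: "h \<in> carrier stream_F" and hd: "\<And>u. shd (h u) = shd u"
  obtains f g where "f \<in> carrier stream_F" "g \<in> carrier stream_F" "h = node f g"
proof -
  define r where "r b u = stl (h (b ## u))" for b u
  have hr: "h (b ## u) = b ## r b u" for b u
    using hd[of "b ## u"] by (cases "h (b ## u)") (simp add: r_def)
  have "r b \<in> carrier stream_F" for b
  proof -
    obtain N where N: "prefix_map h N" using stream_F_prefix[OF h] by blast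
    have "prefix_map (r b) (Suc N)" unfolding prefix_map_def
    proof (intro allI impI)
      fix p :: "bool list" assume p: "length p = Suc N"
      obtain q where q: "\<And>u. h ((b # p) @- u) = q @- u"
        using prefix_map_long[OF N, of "b # p"] p by auto
      show "\<exists>q. \<forall>u. r b (p @- u) = q @- u"
      proof (cases q)
        case Nil
        have "u = b ## r b (p @- u)" for u using q[of u] hr[of b "p @- u"] Nil by simp
        from this[of "(\<not> b) ## zeros"] show ?thesis by (metis stream.inject)
      next
        case (Cons a q')
        then have "r b (p @- u) = q' @- u" for u using q[of u] hr[of b "p @- u"] Cons by auto
        then show ?thesis by blast
      qed
    qed
    moreover have "surj (r b)"
      unfolding surj_def
    proof
      fix v
      obtain w where w: "h w = b ## v" using stream_F_surj[OF h] by (metis surjD)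
      then have "w = b ## stl w" using hd[of w] by (cases w) simp
      then have "v = r b (stl w)" using w by (simp add: r_def)
      then show "\<exists>u. v = r b u" by blast
    qed
    moreover have "bv u \<le> bv v \<longleftrightarrow> bv (r b u) \<le> bv (r b v)" for u v
      using stream_F_le_iff[OF h, of "b ## u" "b ## v"] by (simp add: hr binary_value_Cons divide_le_cancel)
    ultimately show ?thesis by (intro stream_F_I)
  qed
  moreover have "h = node (r False) (r True)"
  proof
    fix u show "h u = node (r False) (r True) u" by (cases u rule: stream_cases) (simp_all add: hr)
  qed
  ultimately show ?thesis using that by blast
qed

text \<open>The first two of these maps are the inverses of \<^const>\<open>thompson_x0\<close> and \<^const>\<open>thompson_x1\<close> in their
  action on infinite words. The map with index \<open>n\<close> carries a right vine with a caret attached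
  to leaf \<open>n\<close> to a longer right vine, unless leaf \<open>n\<close> is the last one; see \<open>matches_caret\<close> below.\<close>

fun caret :: "nat \<Rightarrow> bool stream \<Rightarrow> bool stream" where
  "caret 0 u = (if shd u then True ## u else if shd (stl u) then True ## False ## stl (stl u)
            else False ## stl (stl u))"
| "caret (Suc n) u = node id (caret n) u"

lemma caret_0_simps [simp]:
  "caret 0 (True ## u) = True ## True ## u" "caret 0 (False ## True ## u) = True ## False ## u"
  "caret 0 (False ## False ## u) = False ## u"
  by simp_all

lemma caret_Suc: "caret (Suc n) = node id (caret n)"
  by (rule ext) simp

declare caret.simps [simp del]

lemma stream_cases2:
  obtains v where "u = False ## False ## v" | v where "u = False ## True ## v" | v where "u = True ## v"
  by (metis stream_cases)

lemma caret_0_closed: "caret 0 \<in> carrier stream_F"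
proof -
  have "prefix_map (caret 0) 2" unfolding prefix_map_def
  proof (intro allI impI)
    fix p :: "bool list" assume "length p = 2"
    then obtain a b where p: "p = [a, b]" by (auto simp: numeral_2_eq_2 length_Suc_conv)
    have "caret 0 (p @- u) = (if a then [True, True, b] else if b then [True, False] else [False]) @- u" for u
      using p by (cases a; cases b) auto
    then show "\<exists>q. \<forall>u. caret 0 (p @- u) = q @- u" by blast
  qed
  moreover have "surj (caret 0)"
    unfolding surj_def
  proof
    fix v
    consider w where "v = False ## w" | w where "v = True ## False ## w" | w where "v = True ## True ## w"
      by (metis stream_cases)
    then show "\<exists>u. v = caret 0 u" by cases (metis caret_0_simps)+
  qed
  moreover have "bv u \<le> bv v \<longleftrightarrow> bv (caret 0 u) \<le> bv (caret 0 v)" for u v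
  proof (cases u rule: stream_cases2; cases v rule: stream_cases2)
    fix u' v'
    note b = binary_value_nonneg[of u'] binary_value_le_1[of u'] binary_value_nonneg[of v'] binary_value_le_1[of v']
    show "u = False ## False ## u' \<Longrightarrow> v = False ## False ## v' \<Longrightarrow> ?thesis"
      "u = False ## False ## u' \<Longrightarrow> v = False ## True ## v' \<Longrightarrow> ?thesis"
      "u = False ## False ## u' \<Longrightarrow> v = True ## v' \<Longrightarrow> ?thesis"
      "u = False ## True ## u' \<Longrightarrow> v = False ## False ## v' \<Longrightarrow> ?thesis"
      "u = False ## True ## u' \<Longrightarrow> v = False ## True ## v' \<Longrightarrow> ?thesis"
      "u = False ## True ## u' \<Longrightarrow> v = True ## v' \<Longrightarrow> ?thesis"
      "u = True ## u' \<Longrightarrow> v = False ## False ## v' \<Longrightarrow> ?thesis"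
      "u = True ## u' \<Longrightarrow> v = False ## True ## v' \<Longrightarrow> ?thesis"
      "u = True ## u' \<Longrightarrow> v = True ## v' \<Longrightarrow> ?thesis"
      using b by (simp_all only: caret_0_simps bv_Cons_le, simp_all add: binary_value_Cons)
  qed
  ultimately show ?thesis by (intro stream_F_I)
qed

lemma caret_closed [simp]: "caret n \<in> carrier stream_F"
  by (induction n) (simp_all add: caret_0_closed caret_Suc node_closed stream_F_one_closed)

lemma caret_commute: "i < j \<Longrightarrow> caret i \<circ> caret j = caret (Suc j) \<circ> caret i"
proof (induction i arbitrary: j)
  case 0
  then obtain k where k: "j = Suc k" by (cases j) auto
  show ?case
  proof
    fix u show "(caret 0 \<circ> caret j) u = (caret (Suc j) \<circ> caret 0) u"
      by (cases u rule: stream_cases2) (simp_all add: k caret_Suc)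
  qed
next
  case (Suc i)
  then obtain k where k: "j = Suc k" "i < k" by (cases j) auto
  show ?case using Suc.IH[OF k(2)] unfolding k(1) caret_Suc node_comp by (simp only:)
qed

section \<open>Tree pairs\<close>

datatype tree = Leaf | Node tree tree

fun leaves :: "tree \<Rightarrow> bool list list" where
  "leaves Leaf = [[]]"
| "leaves (Node l r) = map (Cons False) (leaves l) @ map (Cons True) (leaves r)"

fun nl :: "tree \<Rightarrow> nat" where
  "nl Leaf = 1"
| "nl (Node l r) = nl l + nl r"

text \<open>Attaches a caret to the leaf with number \<open>k\<close>, counted from the left and from 0.\<close>

fun expand :: "nat \<Rightarrow> tree \<Rightarrow> tree" where
  "expand k Leaf = Node Leaf Leaf"
| "expand k (Node l r) = (if k < nl l then Node (expand k l) r else Node l (expand (k - nl l) r))"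

lemma length_leaves [simp]: "length (leaves T) = nl T"
  by (induction T) auto

lemma nl_pos [simp]: "0 < nl T"
  by (induction T) auto

lemma nl_expand: "k < nl T \<Longrightarrow> nl (expand k T) = Suc (nl T)"
  by (induction T arbitrary: k) auto

lemma leaves_expand:
  "k < nl T \<Longrightarrow> leaves (expand k T) =
     take k (leaves T) @ [leaves T ! k @ [False], leaves T ! k @ [True]] @ drop (Suc k) (leaves T)"
proof (induction T arbitrary: k)
  case (Node l r)
  then show ?case
    by (auto simp: take_map drop_map nth_append not_less Suc_diff_le less_diff_conv2)
qed simp

lemma leaves_cover: "\<exists>p\<in>set (leaves T). \<exists>v. u = p @- v"
proof (induction T arbitrary: u)
  case Leaf
  then show ?case by simp
next
  case (Node l r)
  show ?case
  proof (cases u rule: stream_cases)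
    case (1 v)
    obtain p w where "p \<in> set (leaves l)" "v = p @- w" using Node.IH(1) by blast
    then show ?thesis using 1 by (intro bexI[of _ "False # p"]) auto
  next
    case (2 v)
    obtain p w where "p \<in> set (leaves r)" "v = p @- w" using Node.IH(2) by blast
    then show ?thesis using 2 by (intro bexI[of _ "True # p"]) auto
  qed
qed

lemma leaves_inj: "leaves S = leaves T \<Longrightarrow> S = T"
proof (induction S arbitrary: T)
  case Leaf
  then show ?case by (cases T) (auto simp: append_eq_Cons_conv map_eq_Cons_conv Cons_eq_append_conv Cons_eq_map_conv)
next
  case (Node l r)
  show ?case
  proof (cases T)
    case Leaf
    then show ?thesis using Node.prems
      by (auto simp: append_eq_Cons_conv map_eq_Cons_conv Cons_eq_append_conv Cons_eq_map_conv)
  next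
    case (Node l' r')
    have *: "filter (\<lambda>p. hd p = b) (map (Cons False) A @ map (Cons True) B) =
      (if b then map (Cons True) B else map (Cons False) A)" for b A B
      by (cases b) (simp_all add: filter_map o_def filter_empty_conv)
    have "map (Cons b) (leaves (if b then r else l)) = map (Cons b) (leaves (if b then r' else l'))" for b
      using arg_cong[OF Node.prems[unfolded Node leaves.simps], of "filter (\<lambda>p. hd p = b)"]
      unfolding * by (cases b) simp_all
    from this[of False] this[of True] have "leaves l = leaves l'" "leaves r = leaves r'"
      by (simp_all add: inj_map_eq_map)
    then show ?thesis using Node.IH Node by simp
  qed
qed

text \<open>The tree pair description of elements of Thompson's group.\<close>

definition matches :: "(bool stream \<Rightarrow> bool stream) \<Rightarrow> tree \<Rightarrow> tree \<Rightarrow> bool" where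
  "matches g S T \<longleftrightarrow> list_all2 (\<lambda>p q. \<forall>u. g (p @- u) = q @- u) (leaves S) (leaves T)"

lemma matches_nl: "matches g S T \<Longrightarrow> nl S = nl T"
  unfolding matches_def by (drule list_all2_lengthD) simp

lemma matches_id: "matches id S S"
  unfolding matches_def by (rule list_all2_refl) simp

lemma matches_comp: "matches f S T \<Longrightarrow> matches g T U \<Longrightarrow> matches (g \<circ> f) S U"
  unfolding matches_def by (erule list_all2_trans[rotated]) auto

lemma matches_inv: "inj g \<Longrightarrow> matches g S T \<Longrightarrow> matches (inv_into UNIV g) T S"
  unfolding matches_def
  by (subst list_all2_conv_all_nth) (auto simp: list_all2_conv_all_nth inv_f_eq)

lemma matches_unique:
  assumes "matches f S T" "matches g S T"
  shows "f = g"
proof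
  fix u
  obtain p v where p: "p \<in> set (leaves S)" "u = p @- v" using leaves_cover by blast
  then obtain i where i: "i < nl S" "p = leaves S ! i" by (metis in_set_conv_nth length_leaves)
  then show "f u = g u" using assms p by (auto simp: matches_def list_all2_conv_all_nth)
qed

lemma matches_id_eq:
  assumes "matches id S T"
  shows "S = T"
proof (rule leaves_inj)
  have "list_all2 (=) (leaves S) (leaves T)"
    using assms unfolding matches_def by (rule list_all2_mono) (auto intro: shift_same_tail_cancel)
  then show "leaves S = leaves T" by (simp add: list_all2_eq)
qed

lemma matches_expand:
  assumes "matches g S T" "k < nl S"
  shows "matches g (expand k S) (expand k T)"
proof -
  have k: "k < nl T" using assms matches_nl by auto
  have "g (leaves S ! k @- u) = leaves T ! k @- u" for u
    using assms by (auto simp: matches_def list_all2_conv_all_nth)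
  then show ?thesis
    using assms k unfolding matches_def leaves_expand[OF assms(2)] leaves_expand[OF k]
    by (intro list_all2_appendI list_all2_takeI list_all2_dropI) auto
qed

lemma matches_node:
  "matches f l l' \<Longrightarrow> matches g r r' \<Longrightarrow> matches (node f g) (Node l r) (Node l' r')"
  unfolding matches_def
  by (auto simp: list_all2_map1 list_all2_map2 intro!: list_all2_appendI elim: list_all2_mono)

inductive subdivides :: "tree \<Rightarrow> tree \<Rightarrow> bool" where
  refl: "subdivides S S"
| step: "subdivides S T \<Longrightarrow> k < nl T \<Longrightarrow> subdivides S (expand k T)"

lemma subdivides_trans: "subdivides T U \<Longrightarrow> subdivides S T \<Longrightarrow> subdivides S U"
  by (induction rule: subdivides.induct) (auto intro: subdivides.intros)

lemma subdivides_Node_left: "subdivides l l' \<Longrightarrow> subdivides (Node l r) (Node l' r)"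
proof (induction rule: subdivides.induct)
  case (step S T k)
  then show ?case using subdivides.step[of "Node S r" "Node T r" k] by simp
qed (rule subdivides.refl)

lemma subdivides_Node_right: "subdivides r r' \<Longrightarrow> subdivides (Node l r) (Node l r')"
proof (induction rule: subdivides.induct)
  case (step S T k)
  then show ?case using subdivides.step[of "Node l S" "Node l T" "nl l + k"] by simp
qed (rule subdivides.refl)

lemma subdivides_Node: "subdivides l l' \<Longrightarrow> subdivides r r' \<Longrightarrow> subdivides (Node l r) (Node l' r')"
  using subdivides_trans subdivides_Node_left subdivides_Node_right by blast

lemma subdivides_caret: "subdivides Leaf (Node Leaf Leaf)"
  using subdivides.step[OF subdivides.refl[of Leaf], of 0] by simp

lemma subdivides_Leaf: "subdivides Leaf T"
proof (induction T)
  case (Node l r)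
  then show ?case using subdivides_trans[OF subdivides_Node subdivides_caret] by blast
qed (rule subdivides.refl)

fun full :: "nat \<Rightarrow> tree" where
  "full 0 = Leaf"
| "full (Suc n) = Node (full n) (full n)"

fun depth :: "tree \<Rightarrow> nat" where
  "depth Leaf = 0"
| "depth (Node l r) = Suc (max (depth l) (depth r))"

lemma subdivides_full: "depth T \<le> n \<Longrightarrow> subdivides T (full n)"
proof (induction n arbitrary: T)
  case 0
  then show ?case by (cases T) (auto intro: subdivides.refl)
next
  case (Suc n)
  show ?case
  proof (cases T)
    case Leaf
    then show ?thesis using subdivides_Leaf by simp
  next
    case (Node l r)
    then show ?thesis using Suc by (auto intro!: subdivides_Node)
  qed
qed

lemma leaves_full: "p \<in> set (leaves (full n)) \<Longrightarrow> length p = n"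
  by (induction n arbitrary: p) auto

text \<open>The cylinders of the words in the list are intervals; read from left to right, each begins where
  its predecessor ends, and together they lead from \<open>a\<close> to \<open>b\<close>.\<close>

fun chain :: "real \<Rightarrow> bool list list \<Rightarrow> real \<Rightarrow> bool" where
  "chain a [] b \<longleftrightarrow> a = b"
| "chain a (p # ps) b \<longleftrightarrow> bv (p @- zeros) = a \<and> chain (bv (p @- ones)) ps b"

lemma chain_append: "chain a (ps @ qs) b \<longleftrightarrow> (\<exists>c. chain a ps c \<and> chain c qs b)"
  by (induction ps arbitrary: a) auto

lemma chain_map_Cons:
  "chain a ps b \<Longrightarrow> chain ((of_bool c + a) / 2) (map (Cons c) ps) ((of_bool c + b) / 2)"
  by (induction ps arbitrary: a) (auto simp: binary_value_Cons)

lemma chain_leaves: "chain 0 (leaves T) 1"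
proof (induction T)
  case (Node l r)
  then show ?case
    using chain_map_Cons[OF Node.IH(1), of False] chain_map_Cons[OF Node.IH(2), of True]
    by (auto simp: chain_append)
qed simp

lemma bv_zeros_less_ones: "bv (p @- zeros) < bv (p @- ones)"
  using bv_shift[of p ones] by simp

lemma chain_le: "chain a ps b \<Longrightarrow> a \<le> b"
  by (induction ps arbitrary: a) (auto intro: order_trans[OF less_imp_le[OF bv_zeros_less_ones]])

lemma chain_upper_half:
  assumes "chain a ps b" "1 / 2 \<le> a" "[] \<notin> set ps"
  shows "\<exists>qs. ps = map (Cons True) qs \<and> chain (2 * a - 1) qs (2 * b - 1)"
  using assms
proof (induction ps arbitrary: a)
  case (Cons p ps)
  then obtain c p' where p: "p = c # p'" by (cases p) auto
  have c: "c" using Cons.prems binary_value_le_1[of "p' @- ones"] bv_zeros_less_ones[of p'] unfolding p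
    by (cases c) (auto simp: binary_value_Cons)
  have "chain (bv (p @- ones)) ps b" "1 / 2 \<le> bv (p @- ones)"
    using Cons.prems bv_zeros_less_ones[of p] by auto
  then obtain qs where "ps = map (Cons True) qs" "chain (2 * bv (p @- ones) - 1) qs (2 * b - 1)"
    using Cons.IH Cons.prems(3) by auto
  moreover have "2 * bv (p @- ones) - 1 = bv (p' @- ones)" using c by (simp add: p binary_value_Cons field_simps)
  ultimately show ?case using Cons.prems(1) p c by (intro exI[of _ "p' # qs"]) (auto simp: binary_value_Cons)
qed simp

lemma chain_split:
  assumes "chain a ps b" "a \<le> 1 / 2" "1 / 2 \<le> b" "[] \<notin> set ps"
  shows "\<exists>qs rs. ps = map (Cons False) qs @ map (Cons True) rs \<and>
    chain (2 * a) qs 1 \<and> chain 0 rs (2 * b - 1)"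
  using assms
proof (induction ps arbitrary: a)
  case Nil
  then show ?case by (intro exI[of _ "[]"]) auto
next
  case (Cons p ps)
  then obtain c p' where p: "p = c # p'" by (cases p) auto
  show ?case
  proof (cases c)
    case True
    then have "a = 1 / 2"
      using Cons.prems(1,2) binary_value_nonneg[of "p' @- zeros"] by (auto simp: p binary_value_Cons)
    then obtain rs where "p # ps = map (Cons True) rs" "chain (2 * a - 1) rs (2 * b - 1)"
      using chain_upper_half[OF Cons.prems(1) _ Cons.prems(4)] by (metis order_refl)
    then show ?thesis using \<open>a = 1 / 2\<close>
      by (intro exI[of _ "[]"] exI[of _ rs]) simp
  next
    case False
    then have "chain (bv (p @- ones)) ps b" "bv (p @- ones) \<le> 1 / 2"
      using Cons.prems(1) binary_value_le_1[of "p' @- ones"] by (auto simp: p binary_value_Cons)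
    then obtain qs rs where "ps = map (Cons False) qs @ map (Cons True) rs"
      "chain (2 * bv (p @- ones)) qs 1" "chain 0 rs (2 * b - 1)"
      using Cons.IH[OF _ _ Cons.prems(3)] Cons.prems(4) by (metis list.set_intros(2))
    then show ?thesis using Cons.prems(1) p False
      by (intro exI[of _ "p' # qs"] exI[of _ rs]) (auto simp: binary_value_Cons)
  qed
qed

lemma sum_length_map_Cons: "sum_list (map length (map (Cons c) ps)) = length ps + sum_list (map length ps)"
  by (induction ps) auto

text \<open>Unless the list consists of the empty word alone, every interval lies in one half of the unit
  interval, so the list splits at the point one half and each part describes a subtree.\<close>

lemma chain_imp_leaves:
  assumes "chain 0 ps 1"
  shows "\<exists>T. leaves T = ps"
  using assms
proof (induction "sum_list (map length ps)" arbitrary: ps rule: less_induct)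
  case less
  show ?case
  proof (cases "[] \<in> set ps")
    case True
    then obtain qs rs where ps: "ps = qs @ [] # rs" by (metis split_list)
    then have "chain 0 qs 0" "chain 1 rs 1" using less.prems by (auto simp: chain_append)
    moreover have "qs = []" if "chain a qs a" for a qs
      using that
    proof (cases qs)
      case (Cons p qs')
      then have "bv (p @- ones) \<le> bv (p @- zeros)" using that chain_le by auto
      then show ?thesis using bv_zeros_less_ones[of p] by simp
    qed simp
    ultimately have "ps = leaves Leaf" using ps by auto
    then show ?thesis by metis
  next
    case False
    obtain qs rs where ps: "ps = map (Cons False) qs @ map (Cons True) rs" "chain 0 qs 1" "chain 0 rs 1"
      using chain_split[OF less.prems _ _ False] by auto
    then have "qs \<noteq> []" "rs \<noteq> []" by auto
    then have "sum_list (map length qs) < sum_list (map length ps)"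
      "sum_list (map length rs) < sum_list (map length ps)"
      unfolding ps(1) map_append sum_list_append sum_length_map_Cons by (simp_all add: add_strict_increasing2 neq_Nil_conv)
    then obtain l r where "leaves l = qs" "leaves r = rs" using less.hyps ps by metis
    then have "leaves (Node l r) = ps" using ps by simp
    then show ?thesis by metis
  qed
qed

text \<open>Neighbouring words of length \<open>N\<close> have cylinders with a common end point. As \<open>g\<close> respects equality of values,
  the replacing prefixes are neighbours too, and they are the leaves of a tree.\<close>

lemma prefix_map_matches:
  assumes N: "prefix_map g N" and eq: "\<And>u v. bv u = bv v \<Longrightarrow> bv (g u) = bv (g v)"
    and "bv (g zeros) = 0" "bv (g ones) = 1"
  shows "\<exists>T. matches g (full N) T"
proof -
  obtain Q where Q: "\<And>p u. length p = N \<Longrightarrow> g (p @- u) = Q p @- u"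
    using N unfolding prefix_map_def by metis
  have *: "chain (bv (g u)) (map Q ps) (bv (g v))"
    if "chain (bv u) ps (bv v)" "\<And>p. p \<in> set ps \<Longrightarrow> length p = N" for ps u v
    using that
  proof (induction ps arbitrary: u)
    case (Cons p ps)
    then have p: "length p = N" by simp
    have "chain (bv (g (p @- ones))) (map Q ps) (bv (g v))"
      by (rule Cons.IH) (use Cons.prems in auto)
    moreover have "bv (g (p @- zeros)) = bv (g u)" by (rule eq) (use Cons.prems in auto)
    ultimately show ?case by (simp add: Q[OF p])
  next
    case Nil
    then have "bv (g u) = bv (g v)" by (intro eq) simp
    then show ?case by simp
  qed
  have "chain (bv (g zeros)) (map Q (leaves (full N))) (bv (g ones))"
    by (rule *) (use chain_leaves leaves_full in auto)
  then obtain T where T: "leaves T = map Q (leaves (full N))"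
    using chain_imp_leaves[of "map Q (leaves (full N))"] assms(3,4) by auto
  have "matches g (full N) T"
    unfolding matches_def T list_all2_map2 by (auto simp: list_all2_conv_all_nth intro!: Q leaves_full)
  then show ?thesis ..
qed

lemma matches_exists:
  assumes g: "g \<in> carrier stream_F"
  obtains S T where "matches g S T"
proof -
  obtain N where N: "prefix_map g N" using stream_F_prefix[OF g] by blast
  have "\<exists>T. matches g (full N) T" by (rule prefix_map_matches[OF N]) (simp_all add: g stream_F_eq_iff)
  then show ?thesis using that by blast
qed

lemma matches_surj:
  assumes "matches g S T"
  shows "surj g"
  unfolding surj_def
proof
  fix v
  obtain q w where q: "q \<in> set (leaves T)" "v = q @- w" using leaves_cover by blast
  then obtain i where "i < nl T" "q = leaves T ! i" by (metis in_set_conv_nth length_leaves)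
  then have "v = g (leaves S ! i @- w)" using assms q matches_nl[OF assms]
    by (auto simp: matches_def list_all2_conv_all_nth)
  then show "\<exists>u. v = g u" by blast
qed

section \<open>A finite presentation of Thompson's group\<close>

text \<open>The relations between carets attached to a row of roots: a caret at position \<open>i\<close> moves all
  later positions by one.\<close>

locale forest_rep = group G for G (structure) +
  fixes y :: "nat \<Rightarrow> 'a"
  assumes y_closed [simp]: "y n \<in> carrier G"
    and y_commute: "i < j \<Longrightarrow> y j \<otimes> y i = y i \<otimes> y (Suc j)"
begin

primrec forest_elem :: "tree \<Rightarrow> nat \<Rightarrow> 'a" where
  "forest_elem Leaf i = \<one>"
| "forest_elem (Node l r) i = y i \<otimes> forest_elem l i \<otimes> forest_elem r (i + nl l)"

primrec tree_elem :: "tree \<Rightarrow> nat \<Rightarrow> 'a" where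
  "tree_elem Leaf i = \<one>"
| "tree_elem (Node l r) i = forest_elem l i \<otimes> tree_elem r (i + nl l)"

lemma forest_elem_closed [simp]: "forest_elem T i \<in> carrier G"
  by (induction T arbitrary: i) auto

lemma tree_elem_closed [simp]: "tree_elem T i \<in> carrier G"
  by (induction T arbitrary: i) auto

lemma forest_elem_commute:
  "i < j \<Longrightarrow> forest_elem T j \<otimes> y i = y i \<otimes> forest_elem T (Suc j)"
proof (induction T arbitrary: j)
  case (Node l r)
  have "forest_elem (Node l r) j \<otimes> y i = y j \<otimes> forest_elem l j \<otimes> (forest_elem r (j + nl l) \<otimes> y i)"
    by (simp add: m_assoc)
  also have "\<dots> = y j \<otimes> (forest_elem l j \<otimes> y i) \<otimes> forest_elem r (Suc j + nl l)"
    using Node.IH(2)[of "j + nl l"] Node.prems by (simp add: m_assoc)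
  also have "\<dots> = (y j \<otimes> y i) \<otimes> forest_elem l (Suc j) \<otimes> forest_elem r (Suc j + nl l)"
    using Node.IH(1)[of j] Node.prems by (simp add: m_assoc)
  also have "\<dots> = y i \<otimes> forest_elem (Node l r) (Suc j)"
    using y_commute[OF Node.prems] by (simp add: m_assoc)
  finally show ?case .
qed simp

lemma tree_elem_commute:
  "i < j \<Longrightarrow> tree_elem T j \<otimes> y i = y i \<otimes> tree_elem T (Suc j)"
proof (induction T arbitrary: j)
  case (Node l r)
  have "tree_elem (Node l r) j \<otimes> y i = forest_elem l j \<otimes> (tree_elem r (j + nl l) \<otimes> y i)"
    by (simp add: m_assoc)
  also have "\<dots> = (forest_elem l j \<otimes> y i) \<otimes> tree_elem r (Suc j + nl l)"
    using Node.IH(2)[of "j + nl l"] Node.prems by (simp add: m_assoc)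
  also have "\<dots> = y i \<otimes> tree_elem (Node l r) (Suc j)"
    using forest_elem_commute[OF Node.prems] by (simp add: m_assoc)
  finally show ?case .
qed simp

text \<open>The factor of a caret at a leaf is moved to the end past all factors that stem from positions to
  the right of it.\<close>

lemma forest_elem_expand:
  "k < nl T \<Longrightarrow> forest_elem (expand k T) i = forest_elem T i \<otimes> y (i + k)"
proof (induction T arbitrary: i k)
  case (Node l r)
  show ?case
  proof (cases "k < nl l")
    case True
    then show ?thesis
      using Node.IH(1)[OF True] forest_elem_commute[of "i + k" "i + nl l" r] nl_expand[OF True]
      by (simp add: m_assoc)
  next
    case False
    then show ?thesis using Node by (simp add: m_assoc)
  qed
qed simp

lemma tree_elem_expand:
  "k < nl T \<Longrightarrow> tree_elem (expand k T) i = (if Suc k < nl T then tree_elem T i \<otimes> y (i + k) else tree_elem T i)"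
proof (induction T arbitrary: i k)
  case (Node l r)
  show ?case
  proof (cases "k < nl l")
    case True
    moreover have "Suc k < nl l + nl r" using True nl_pos[of r] by linarith
    ultimately show ?thesis
      using forest_elem_expand[OF True] tree_elem_commute[of "i + k" "i + nl l" r] nl_expand[OF True]
      by (simp add: m_assoc)
  next
    case False
    then have "Suc (k - nl l) < nl r \<longleftrightarrow> Suc k < nl l + nl r" by linarith
    then show ?thesis using False Node.IH(2)[of "k - nl l" "i + nl l"] Node.prems by (simp add: m_assoc)
  qed
qed simp

text \<open>In Thompson's group itself, and for trees with equally many leaves, this is the element that
  carries \<open>S\<close> to \<open>T\<close>: the value of a tree carries it to a right vine.\<close>

definition pair_elem :: "tree \<Rightarrow> tree \<Rightarrow> 'a" where
  "pair_elem S T = tree_elem S 0 \<otimes> inv (tree_elem T 0)"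

lemma pair_elem_closed [simp]: "pair_elem S T \<in> carrier G"
  by (simp add: pair_elem_def)

text \<open>Both values acquire the same right factor, or none if the caret is attached to the last leaf.\<close>

lemma pair_elem_expand:
  assumes "nl S = nl T" "k < nl S"
  shows "pair_elem (expand k S) (expand k T) = pair_elem S T"
proof (cases "Suc k < nl S")
  case True
  have "y k \<otimes> (inv (y k) \<otimes> inv (tree_elem T 0)) = inv (tree_elem T 0)"
    by (simp add: m_assoc[symmetric])
  then show ?thesis using assms True
    by (simp add: pair_elem_def tree_elem_expand inv_mult_group m_assoc)
qed (use assms in \<open>simp add: pair_elem_def tree_elem_expand\<close>)

lemma subdivide_left:
  assumes "subdivides S S'" "matches g S T"
  shows "\<exists>T'. matches g S' T' \<and> pair_elem S' T' = pair_elem S T"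
  using assms
proof (induction rule: subdivides.induct)
  case (step S S' k)
  then obtain T' where "matches g S' T'" "pair_elem S' T' = pair_elem S T" by blast
  then show ?case using matches_expand[of g S' T' k] pair_elem_expand[of S' T' k] matches_nl step.hyps by metis
qed blast

lemma subdivide_right:
  assumes "subdivides T T'" "matches g S T"
  shows "\<exists>S'. matches g S' T' \<and> pair_elem S' T' = pair_elem S T"
  using assms
proof (induction rule: subdivides.induct)
  case (step T T' k)
  then obtain S' where "matches g S' T'" "pair_elem S' T' = pair_elem S T" by blast
  then show ?case using matches_expand[of g S' T' k] pair_elem_expand[of S' T' k] matches_nl step.hyps by metis
qed blast

text \<open>For a product, the two tree pairs are subdivided until the target tree of the first and the source
  tree of the second are the same full tree; the values then telescope. Only pairs of equal trees
  describe the identity, so the value does not depend on the tree pair.\<close>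

lemma pair_elem_hom:
  "\<exists>\<phi>\<in>hom stream_F G. \<forall>g S T. g \<in> carrier stream_F \<longrightarrow> matches g S T \<longrightarrow> \<phi> g = pair_elem S T"
proof -
  define Rel where "Rel g x \<longleftrightarrow> g \<in> carrier stream_F \<and> (\<exists>S T. matches g S T \<and> x = pair_elem S T)" for g x
  have "\<exists>\<phi>\<in>hom stream_F G. \<forall>g x. Rel g x \<longrightarrow> \<phi> g = x"
  proof (rule homI_graph[OF group_stream_F is_group])
    fix g x assume "Rel g x"
    then show "g \<in> carrier stream_F \<and> x \<in> carrier G" by (auto simp: Rel_def)
  next
    fix g assume "g \<in> carrier stream_F"
    then show "\<exists>x. Rel g x" unfolding Rel_def by (metis matches_exists)
  next
    fix g x g' x' assume "Rel g x" "Rel g' x'"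
    then obtain S T S' T' where g: "g \<in> carrier stream_F" "matches g S T" "x = pair_elem S T"
      and g': "g' \<in> carrier stream_F" "matches g' S' T'" "x' = pair_elem S' T'" by (auto simp: Rel_def)
    let ?C = "full (max (depth T) (depth S'))"
    obtain S1 where S1: "matches g S1 ?C" "pair_elem S1 ?C = x"
      using subdivide_right[OF subdivides_full g(2)] g(3) by (metis max.cobounded1)
    obtain T1 where T1: "matches g' ?C T1" "pair_elem ?C T1 = x'"
      using subdivide_left[OF subdivides_full g'(2)] g'(3) by (metis max.cobounded2)
    have "x \<otimes> x' = pair_elem S1 T1"
    proof -
      have "inv (tree_elem ?C 0) \<otimes> (tree_elem ?C 0 \<otimes> inv (tree_elem T1 0)) = inv (tree_elem T1 0)"
        by (simp add: m_assoc[symmetric])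
      then show ?thesis unfolding S1(2)[symmetric] T1(2)[symmetric] by (simp add: pair_elem_def m_assoc)
    qed
    then show "Rel (g \<otimes>\<^bsub>stream_F\<^esub> g') (x \<otimes> x')"
      using matches_comp[OF S1(1) T1(1)] stream_F.m_closed[OF g(1) g'(1)] by (auto simp: Rel_def)
  next
    fix x assume "Rel \<one>\<^bsub>stream_F\<^esub> x"
    then obtain S T where "matches id S T" "x = pair_elem S T" by (auto simp: Rel_def)
    then show "x = \<one>" using matches_id_eq[of S T] by (simp add: pair_elem_def)
  qed
  then show ?thesis unfolding Rel_def by blast
qed

end

primrec vine :: "nat \<Rightarrow> tree" where
  "vine 0 = Leaf"
| "vine (Suc n) = Node Leaf (vine n)"

lemma nl_vine [simp]: "nl (vine n) = Suc n"
  by (induction n) auto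

lemma expand_vine_last: "expand n (vine n) = vine (Suc n)"
  by (induction n) auto

lemma matches_caret: "k < n \<Longrightarrow> matches (caret k) (expand k (vine n)) (vine (Suc n))"
proof (induction k arbitrary: n)
  case 0
  then obtain m where "n = Suc m" by (cases n) auto
  then show ?case by (auto simp: matches_def list_all2_map1 list_all2_map2 intro!: list_all2_refl)
next
  case (Suc k)
  then obtain m where m: "n = Suc m" "k < m" by (cases n) auto
  then show ?case using matches_node[OF matches_id[of Leaf] Suc.IH[OF m(2)]] by (simp add: caret_Suc)
qed

interpretation stream_F_forest: forest_rep stream_F caret
  by unfold_locales (simp_all add: caret_commute)

lemma (in forest_rep) tree_elem_vine [simp]: "tree_elem (vine n) i = \<one>"
  by (induction n arbitrary: i) auto

lemma (in forest_rep) pair_elem_caret: "k < n \<Longrightarrow> pair_elem (expand k (vine n)) (vine (Suc n)) = y k"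
  by (simp add: pair_elem_def tree_elem_expand del: vine.simps)

text \<open>Each caret added to \<open>S\<close> appears on the corresponding leaf of the vine, and the factor contributed by the
  caret carries the result to the next vine; a caret on the last leaf of a vine makes the next vine.\<close>

lemma matches_tree_elem: "matches (stream_F_forest.tree_elem S 0) S (vine (nl S - 1))"
proof -
  have "matches (stream_F_forest.tree_elem S 0) S (vine (nl S - 1))" if "subdivides L S" "L = Leaf" for L
    using that
  proof (induction rule: subdivides.induct)
    case (refl S)
    then show ?case using matches_id[of Leaf] by (simp add: id_def)
  next
    case (step S T k)
    let ?n = "nl T - 1"
    have n: "nl T = Suc ?n" "nl (expand k T) - 1 = Suc ?n" using nl_pos[of T] nl_expand[OF step.hyps(2)] by auto
    have *: "matches (stream_F_forest.tree_elem T 0) (expand k T) (expand k (vine ?n))"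
      using step by (intro matches_expand) auto
    show ?case
    proof (cases "k < ?n")
      case True
      then have "Suc k < nl T" by linarith
      then show ?thesis using matches_comp[OF * matches_caret[OF True]] n
        by (simp add: stream_F_forest.tree_elem_expand[OF step.hyps(2)] o_def)
    next
      case False
      then have k: "k = ?n" and "\<not> Suc k < nl T" using n step.hyps(2) by auto
      then have "stream_F_forest.tree_elem (expand k T) 0 = stream_F_forest.tree_elem T 0"
        using stream_F_forest.tree_elem_expand[OF step.hyps(2), of 0] by (simp only: if_False)
      then show ?thesis using * k n(2) expand_vine_last[of ?n] by metis
    qed
  qed
  then show ?thesis using subdivides_Leaf by blast
qed

lemma stream_F_generated: "carrier stream_F \<subseteq> generate stream_F (range caret)"
proof
  fix g assume g: "g \<in> carrier stream_F"
  then obtain S T where ST: "matches g S T" by (rule matches_exists)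
  let ?s = "stream_F_forest.tree_elem S 0" and ?t = "stream_F_forest.tree_elem T 0"
  have "matches (inv_into UNIV ?t) (vine (nl T - 1)) T"
    by (rule matches_inv[OF stream_F_inj matches_tree_elem]) simp
  then have "matches (inv_into UNIV ?t \<circ> ?s) S T"
    using matches_comp[OF matches_tree_elem[of S]] matches_nl[OF ST] by simp
  then have "g = inv_into UNIV ?t \<circ> ?s" by (rule matches_unique[OF ST])
  then have eq: "g = ?s \<otimes>\<^bsub>stream_F\<^esub> inv\<^bsub>stream_F\<^esub> ?t" by (simp add: stream_F_inv)
  have sub: "subgroup (generate stream_F (range caret)) stream_F" by (rule stream_F.generate_is_subgroup) auto
  have caret: "caret i \<in> generate stream_F (range caret)" for i by (rule generate.incl) simp
  have forest: "stream_F_forest.forest_elem T i \<in> generate stream_F (range caret)" for T i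
    by (induction T arbitrary: i)
      (use caret subgroup.m_closed[OF sub] subgroup.one_closed[OF sub] in simp_all)
  have "stream_F_forest.tree_elem T i \<in> generate stream_F (range caret)" for T i
    by (induction T arbitrary: i)
      (use forest subgroup.m_closed[OF sub] subgroup.one_closed[OF sub] in simp_all)
  then show "g \<in> generate stream_F (range caret)"
    unfolding eq by (intro subgroup.m_closed[OF sub] subgroup.m_inv_closed[OF sub])
qed

text \<open>The sequence that \<open>a\<close> and \<open>b\<close> begin if conjugation by \<open>a\<close> moves each term from index 1 on to the next.\<close>

definition conj_seq :: "('a, 'b) monoid_scheme \<Rightarrow> 'a \<Rightarrow> 'a \<Rightarrow> nat \<Rightarrow> 'a" where
  "conj_seq G a b n = (case n of 0 \<Rightarrow> a
     | Suc m \<Rightarrow> inv\<^bsub>G\<^esub> (a [^]\<^bsub>G\<^esub> m) \<otimes>\<^bsub>G\<^esub> b \<otimes>\<^bsub>G\<^esub> a [^]\<^bsub>G\<^esub> m)"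

context group
begin

text \<open>The induction step for the relations with index 1: \<open>t\<close> is the term with index 1, and \<open>p\<close>, \<open>q\<close>, \<open>r\<close>, \<open>s\<close>
  are consecutive terms.\<close>

lemma commutation_step:
  assumes closed: "p \<in> carrier G" "q \<in> carrier G" "r \<in> carrier G" "s \<in> carrier G" "t \<in> carrier G"
    and "q \<otimes> p = p \<otimes> r" "p \<otimes> t = t \<otimes> q" "q \<otimes> t = t \<otimes> r" "r \<otimes> q = q \<otimes> s"
  shows "r \<otimes> t = t \<otimes> s"
proof -
  have "p \<otimes> (r \<otimes> t) = (q \<otimes> p) \<otimes> t" using closed by (simp only: assms(6) m_assoc)
  also have "\<dots> = (q \<otimes> t) \<otimes> q" using closed by (simp only: assms(7) m_assoc)
  also have "\<dots> = t \<otimes> (r \<otimes> q)" using closed by (simp only: assms(8) m_assoc)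
  also have "\<dots> = (t \<otimes> q) \<otimes> s" using closed by (simp only: assms(9) m_assoc)
  also have "\<dots> = p \<otimes> (t \<otimes> s)" using closed by (simp only: assms(7)[symmetric] m_assoc)
  finally show ?thesis using closed by simp
qed

text \<open>Conjugation by \<open>a\<close> turns a relation between terms of index at least 1 into the one with both indices
  raised, so it suffices to let the smaller index be 1. Among those relations the first two imply
  the others by \<open>commutation_step\<close>.\<close>

lemma forest_rep_conj_seq:
  assumes a: "a \<in> carrier G" and b: "b \<in> carrier G"
  defines "y \<equiv> conj_seq G a b"
  assumes rel1: "y 2 \<otimes> y 1 = y 1 \<otimes> y 3" and rel2: "y 3 \<otimes> y 1 = y 1 \<otimes> y 4"
  shows "forest_rep G y"
proof -
  have closed [simp]: "y n \<in> carrier G" for n using a b by (simp add: y_def conj_seq_def split: nat.split)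
  have y0: "y 0 = a" by (simp add: y_def conj_seq_def)
  \<comment> \<open>Index 0 is exempt: \<open>a\<close> commutes with itself, so conjugation by \<open>a\<close> would not move it.\<close>
  have conj: "y (Suc (Suc n)) = inv a \<otimes> y (Suc n) \<otimes> a" for n
    using a b by (simp add: y_def conj_seq_def m_assoc inv_mult_group)
  have shift: "y (Suc n) \<otimes> a = a \<otimes> y (Suc (Suc n))" for n
    using a closed[of "Suc n"] by (simp add: conj m_assoc[symmetric])
  have conj_prod: "inv a \<otimes> (u \<otimes> v) \<otimes> a = (inv a \<otimes> u \<otimes> a) \<otimes> (inv a \<otimes> v \<otimes> a)"
    if "u \<in> carrier G" "v \<in> carrier G" for u v
    using conj_mult[of "inv a" u v] a that by simp
  have up: "y (Suc (i + d)) \<otimes> y (Suc i) = y (Suc i) \<otimes> y (Suc (Suc (i + d)))"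
    if "y (Suc d) \<otimes> y 1 = y 1 \<otimes> y (Suc (Suc d))" for d i
  proof (induction i)
    case (Suc i)
    have "y (Suc (Suc i + d)) \<otimes> y (Suc (Suc i)) = inv a \<otimes> (y (Suc (i + d)) \<otimes> y (Suc i)) \<otimes> a"
      by (simp add: conj conj_prod)
    also have "\<dots> = y (Suc (Suc i)) \<otimes> y (Suc (Suc (Suc i + d)))"
      unfolding Suc.IH by (subst conj_prod) (simp_all add: conj a)
    finally show ?case .
  qed (use that in simp)
  have one: "y (Suc (Suc d)) \<otimes> y 1 = y 1 \<otimes> y (Suc (Suc (Suc d)))" for d
  proof (induction d rule: less_induct)
    case (less d)
    consider "d = 0" | "d = 1" | e where "d = Suc (Suc e)" by (metis One_nat_def not0_implies_Suc)
    then show ?case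
    proof cases
      case 3
      have step: "y (Suc (Suc i)) \<otimes> y (Suc i) = y (Suc i) \<otimes> y (Suc (Suc (Suc i)))" for i
        using up[of 1 i] rel1 by (simp add: numeral_2_eq_2 numeral_3_eq_3)
      show ?thesis unfolding 3
        by (rule commutation_step[of "y (Suc (Suc e))" "y (Suc (Suc (Suc e)))"])
          (use step[of "Suc e"] step[of "Suc (Suc e)"] less.IH[of e] less.IH[of "Suc e"] 3 in auto)
    qed (use rel1 rel2 in \<open>simp_all add: eval_nat_numeral\<close>)
  qed
  show ?thesis
  proof (unfold_locales)
    show "y n \<in> carrier G" for n by (rule closed)
    fix i j :: nat assume "i < j"
    show "y j \<otimes> y i = y i \<otimes> y (Suc j)"
    proof (cases i)
      case 0
      then show ?thesis using shift[of "j - 1"] \<open>i < j\<close> by (simp add: y0)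
    next
      case (Suc k)
      obtain d where "j = Suc (i + d)" using less_imp_Suc_add[OF \<open>i < j\<close>] by blast
      then have "j = Suc (k + Suc d)" using Suc by simp
      then show ?thesis using up[of "Suc d" k, OF one] Suc by simp
    qed
  qed
qed

end

lemma (in forest_rep) y_eq_conj_seq: "y = conj_seq G (y 0) (y 1)"
proof
  fix n
  have *: "y 0 [^] m \<otimes> y (Suc m) = y 1 \<otimes> y 0 [^] m" for m
  proof (induction m)
    case (Suc m)
    have "y 0 [^] Suc m \<otimes> y (Suc (Suc m)) = y 0 [^] m \<otimes> (y (Suc m) \<otimes> y 0)"
      using y_commute[of 0 "Suc m"] by (simp add: m_assoc)
    also have "\<dots> = y 1 \<otimes> y 0 [^] Suc m" using Suc by (simp add: m_assoc[symmetric])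
    finally show ?case .
  qed simp
  show "y n = conj_seq G (y 0) (y 1) n"
  proof (cases n)
    case (Suc m)
    have "y (Suc m) = inv (y 0 [^] m) \<otimes> (y 0 [^] m \<otimes> y (Suc m))" by (simp add: m_assoc[symmetric])
    also have "\<dots> = inv (y 0 [^] m) \<otimes> y 1 \<otimes> y 0 [^] m" unfolding * by (simp add: m_assoc)
    finally show ?thesis by (simp add: Suc conj_seq_def)
  qed (simp add: conj_seq_def)
qed

definition conj_word :: "nat \<Rightarrow> (bool \<times> nat) list" where
  "conj_word n = (case n of 0 \<Rightarrow> [(True, 0)]
     | Suc m \<Rightarrow> replicate m (False, 0) @ [(True, Suc 0)] @ replicate m (True, 0))"

definition inverse_word :: "(bool \<times> 's) list \<Rightarrow> (bool \<times> 's) list" where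
  "inverse_word w = rev (map (\<lambda>(e, s). (\<not> e, s)) w)"

lemma inverse_word_closed [simp]: "w \<in> group_words S \<Longrightarrow> inverse_word w \<in> group_words S"
  by (auto simp: inverse_word_def group_words_def)

lemma conj_word_closed [simp]: "conj_word n \<in> group_words {0, Suc 0}"
  by (auto simp: conj_word_def group_words_def split: nat.split)

context group
begin

lemma eval_inverse_word:
  assumes "g \<in> S \<rightarrow> carrier G" "w \<in> group_words S"
  shows "eval_word G g (inverse_word w) = inv (eval_word G g w)"
  using assms(2)
proof (induction rule: group_words_induct)
  case (Cons e s w)
  have s: "g s \<in> carrier G" using Cons assms(1) by auto
  have "eval_word G g (inverse_word ((e, s) # w)) = eval_word G g (inverse_word w @ [(\<not> e, s)])"
    by (simp add: inverse_word_def)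
  also have "\<dots> = eval_word G g (inverse_word w) \<otimes> eval_word G g [(\<not> e, s)]"
    by (rule eval_word_append[OF assms(1)]) (use Cons in auto)
  finally show ?case using Cons s assms(1) by (auto simp: inv_mult_group)
qed (simp add: inverse_word_def)

lemma eval_relator:
  assumes "g \<in> S \<rightarrow> carrier G" "u \<in> group_words S" "v \<in> group_words S"
  shows "eval_word G g (u @ inverse_word v) = \<one> \<longleftrightarrow> eval_word G g u = eval_word G g v"
proof -
  have "eval_word G g (u @ inverse_word v) = eval_word G g u \<otimes> inv (eval_word G g v)"
    using assms by (simp add: eval_word_append eval_inverse_word)
  then show ?thesis using eval_word_closed[OF assms(1)] assms(2,3)
    by (metis inv_equality inv_inv inv_closed r_inv)
qed

lemma eval_conj_word:
  assumes "g 0 \<in> carrier G" "g (Suc 0) \<in> carrier G"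
  shows "eval_word G g (conj_word n) = conj_seq G (g 0) (g (Suc 0)) n"
proof -
  have g: "g \<in> {0, Suc 0} \<rightarrow> carrier G" using assms by auto
  have w: "replicate m (e, 0) \<in> group_words {0, Suc 0}" for m e
    by (auto simp: group_words_def)
  have t: "eval_word G g (replicate m (True, 0)) = g 0 [^] m" for m
    by (induction m) (use nat_pow_Suc2[OF assms(1)] in simp_all)
  have "replicate m (False, 0 :: nat) = inverse_word (replicate m (True, 0))" for m
    by (simp add: inverse_word_def)
  then have f: "eval_word G g (replicate m (False, 0)) = inv (g 0 [^] m)" for m
    using eval_inverse_word[OF g w] t by simp
  show ?thesis
  proof (cases n)
    case (Suc m)
    have "eval_word G g (conj_word n) = eval_word G g (replicate m (False, 0)) \<otimes>
        eval_word G g ([(True, Suc 0)] @ replicate m (True, 0))"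
      unfolding conj_word_def Suc nat.case by (rule eval_word_append[OF g w]) (simp add: w)
    then show ?thesis using assms by (simp add: conj_seq_def Suc f t m_assoc)
  qed (use assms in \<open>simp add: conj_word_def conj_seq_def\<close>)
qed

end

definition stream_F_relators :: "(bool \<times> nat) list set" where
  "stream_F_relators = {(conj_word 2 @ conj_word 1) @ inverse_word (conj_word 1 @ conj_word 3),
     (conj_word 3 @ conj_word 1) @ inverse_word (conj_word 1 @ conj_word 4)}"

lemma (in group) stream_F_relators_iff:
  assumes "g 0 \<in> carrier G" "g (Suc 0) \<in> carrier G"
  shows "(\<forall>r\<in>stream_F_relators. eval_word G g r = \<one>) \<longleftrightarrow>
    (let y = conj_seq G (g 0) (g (Suc 0)) in y 2 \<otimes> y 1 = y 1 \<otimes> y 3 \<and> y 3 \<otimes> y 1 = y 1 \<otimes> y 4)"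
proof -
  have g: "g \<in> {0, Suc 0} \<rightarrow> carrier G" using assms by auto
  have *: "eval_word G g ((conj_word i @ conj_word j) @ inverse_word (conj_word k @ conj_word l)) = \<one> \<longleftrightarrow>
    (let y = conj_seq G (g 0) (g (Suc 0)) in y i \<otimes> y j = y k \<otimes> y l)" for i j k l
    unfolding Let_def by (subst eval_relator[OF g])
      (simp_all add: eval_word_append[OF g] eval_conj_word[OF assms, symmetric])
  show ?thesis unfolding stream_F_relators_def by (simp only: * Let_def ball_simps) auto
qed

theorem presents_stream_F: "presents stream_F {0, Suc 0} caret stream_F_relators"
proof (rule presentsI)
  show "stream_F_relators \<subseteq> group_words {0, Suc 0}" by (simp add: stream_F_relators_def)
  show "carrier stream_F \<subseteq> generate stream_F (caret ` {0, Suc 0})"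
  proof -
    have sub: "subgroup (generate stream_F (caret ` {0, Suc 0})) stream_F" by (rule stream_F.generate_is_subgroup) auto
    have gen: "caret 0 \<in> generate stream_F (caret ` {0, Suc 0})" "caret (Suc 0) \<in> generate stream_F (caret ` {0, Suc 0})"
      by (auto intro: generate.incl)
    have pow: "caret 0 [^]\<^bsub>stream_F\<^esub> (m :: nat) \<in> generate stream_F (caret ` {0, Suc 0})" for m
    proof (induction m)
      case (Suc m)
      then show ?case unfolding stream_F.nat_pow_Suc using gen by (intro subgroup.m_closed[OF sub])
    next
      case 0
      show ?case unfolding stream_F.nat_pow_0 by (rule subgroup.one_closed[OF sub])
    qed
    have "caret n \<in> generate stream_F (caret ` {0, Suc 0})" for n
    proof (cases n)
      case 0
      then show ?thesis using gen by simp
    next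
      case (Suc m)
      have "caret (Suc m) = inv\<^bsub>stream_F\<^esub> (caret 0 [^]\<^bsub>stream_F\<^esub> m) \<otimes>\<^bsub>stream_F\<^esub> caret (Suc 0) \<otimes>\<^bsub>stream_F\<^esub> caret 0 [^]\<^bsub>stream_F\<^esub> m"
        by (subst stream_F_forest.y_eq_conj_seq) (simp only: conj_seq_def nat.case One_nat_def)
      then show ?thesis unfolding Suc
        using gen pow by (metis subgroup.m_closed[OF sub] subgroup.m_inv_closed[OF sub])
    qed
    then have "range caret \<subseteq> generate stream_F (caret ` {0, Suc 0})" by auto
    then have "generate stream_F (range caret) \<subseteq> generate stream_F (caret ` {0, Suc 0})"
      by (rule stream_F.generate_subgroup_incl[OF _ sub])
    then show ?thesis using stream_F_generated by blast
  qed
  show "eval_word stream_F caret r = \<one>\<^bsub>stream_F\<^esub>" if "r \<in> stream_F_relators" for r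
  proof -
    have S: "Suc 2 = (3 :: nat)" "Suc 3 = (4 :: nat)" by simp_all
    have "caret 2 \<otimes>\<^bsub>stream_F\<^esub> caret 1 = caret 1 \<otimes>\<^bsub>stream_F\<^esub> caret 3" "caret 3 \<otimes>\<^bsub>stream_F\<^esub> caret 1 = caret 1 \<otimes>\<^bsub>stream_F\<^esub> caret 4"
      by (rule stream_F_forest.y_commute[of 1 2, unfolded S] stream_F_forest.y_commute[of 1 3, unfolded S], simp)+
    then show ?thesis
      using stream_F.stream_F_relators_iff[of caret] stream_F_forest.y_eq_conj_seq[symmetric] that
      by (simp only: Let_def caret_closed One_nat_def) blast
  qed
  fix H :: "(bool \<times> nat) list set set monoid" and h
  assume H: "group H" and h: "h \<in> {0, Suc 0} \<rightarrow> carrier H"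
    and rel: "\<And>r. r \<in> stream_F_relators \<Longrightarrow> eval_word H h r = \<one>\<^bsub>H\<^esub>"
  interpret H: group H by fact
  let ?y = "conj_seq H (h 0) (h (Suc 0))"
  have h01: "h 0 \<in> carrier H" "h (Suc 0) \<in> carrier H" using h by auto
  have "forest_rep H ?y"
    using H.stream_F_relators_iff[OF h01] rel by (intro H.forest_rep_conj_seq h01) (auto simp: Let_def)
  then interpret forest_rep H ?y .
  obtain \<phi> where \<phi>: "\<phi> \<in> hom stream_F H"
    "\<And>g S T. g \<in> carrier stream_F \<Longrightarrow> matches g S T \<Longrightarrow> \<phi> g = pair_elem S T"
    using pair_elem_hom by blast
  have "\<phi> (caret k) = ?y k" for k
    using \<phi>(2)[OF caret_closed matches_caret[of k "Suc k"]] pair_elem_caret[of k "Suc k"] by (simp del: vine.simps)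
  moreover have "?y 0 = h 0" "?y (Suc 0) = h (Suc 0)" using h01 by (simp_all add: conj_seq_def)
  ultimately show "\<exists>\<phi>\<in>hom stream_F H. \<forall>s\<in>{0, Suc 0}. \<phi> (caret s) = h s" using \<phi>(1) by (metis insertE singletonD)
qed (auto simp: stream_F_relators_def group_stream_F)

section \<open>Stabilizers of eventually periodic words\<close>

definition fixing :: "bool list \<Rightarrow> (bool stream \<Rightarrow> bool stream) set" where
  "fixing v = {g \<in> carrier stream_F. \<forall>u. g (v @- u) = v @- u}"

definition stream_St :: "bool stream \<Rightarrow> (bool stream \<Rightarrow> bool stream) set" where
  "stream_St b = {g \<in> carrier stream_F. g b = b}"

lemma stream_F_inv_closed' [simp]: "g \<in> carrier stream_F \<Longrightarrow> inv_into UNIV g \<in> carrier stream_F"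
  by (rule stream_F_inv_closed)

lemma stream_F_inv_cancel [simp]:
  assumes "g \<in> carrier stream_F"
  shows "inv_into UNIV g (g u) = u" "g (inv_into UNIV g u) = u"
  using stream_F_inj[OF assms] stream_F_surj[OF assms] by (simp_all add: surj_f_inv_f)

lemma subgroup_fixing: "subgroup (fixing v) stream_F"
proof (rule stream_F.subgroupI)
  fix a assume "a \<in> fixing v"
  then show "inv\<^bsub>stream_F\<^esub> a \<in> fixing v" using stream_F_inv_apply by (auto simp: fixing_def)
qed (auto simp: fixing_def stream_F_mult_closed intro: exI[of _ id] stream_F_one_closed)

lemma subgroup_St: "subgroup (stream_St b) stream_F"
proof (rule stream_F.subgroupI)
  fix a assume "a \<in> stream_St b"
  then show "inv\<^bsub>stream_F\<^esub> a \<in> stream_St b" using stream_F_inv_apply by (auto simp: stream_St_def)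
qed (auto simp: stream_St_def stream_F_mult_closed intro: exI[of _ id] stream_F_one_closed)

lemma move_10: "\<exists>\<gamma>\<in>carrier stream_F. \<forall>u. \<gamma> ((True # False # y) @- u) = [True, False] @- u"
proof (induction y)
  case Nil
  then show ?case using stream_F_one_closed by (intro bexI[of _ id]) auto
next
  case (Cons a y)
  then obtain \<gamma> where \<gamma>: "\<gamma> \<in> carrier stream_F" "\<And>u. \<gamma> ((True # False # y) @- u) = [True, False] @- u" by blast
  show ?case
  proof (cases a)
    case False
    have "\<gamma> \<circ> caret (Suc 0) \<in> carrier stream_F" using \<gamma> by (simp add: stream_F_mult_closed)
    then show ?thesis using \<gamma>(2) False by (intro bexI[of _ "\<gamma> \<circ> caret (Suc 0)"]) (auto simp: caret_Suc)
  next
    case True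
    let ?i = "inv_into UNIV (caret 0)"
    have "?i (True ## True ## False ## u) = True ## False ## u" for u
      using stream_F_inv_cancel(1)[OF caret_closed, of 0 "True ## False ## u"] by simp
    moreover have "\<gamma> \<circ> (?i \<circ> caret (Suc 0)) \<in> carrier stream_F" using \<gamma> by (simp add: stream_F_mult_closed)
    ultimately show ?thesis using \<gamma>(2) True
      by (intro bexI[of _ "\<gamma> \<circ> (?i \<circ> caret (Suc 0))"]) (auto simp: caret_Suc)
  qed
qed

text \<open>The available moves replace the prefix \<open>00\<close> by \<open>0\<close>, \<open>11\<close> by \<open>1\<close> and \<open>01\<close> by \<open>10\<close>; by \<open>move_10\<close> a prefix \<open>10\<close> absorbs all
  further letters.\<close>

lemma move_to_10:
  assumes "True \<in> set v" "False \<in> set v"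
  shows "\<exists>\<gamma>\<in>carrier stream_F. \<forall>u. \<gamma> (v @- u) = [True, False] @- u"
  using assms
proof (induction "length v" arbitrary: v rule: less_induct)
  case less
  then obtain a b y where v: "v = a # b # y"
    by (metis empty_iff list.exhaust list.set(1) set_ConsD)
  consider "\<not> a" "\<not> b" | "\<not> a" "b" | "a" "\<not> b" | "a" "b" by blast
  then show ?case
  proof cases
    case 1
    then obtain \<gamma> where \<gamma>: "\<gamma> \<in> carrier stream_F" "\<And>u. \<gamma> ((False # y) @- u) = [True, False] @- u"
      using less.hyps[of "False # y"] less.prems v by auto
    then have "\<gamma> \<circ> caret 0 \<in> carrier stream_F" by (simp add: stream_F_mult_closed)
    then show ?thesis using \<gamma>(2) 1 v by (intro bexI[of _ "\<gamma> \<circ> caret 0"]) auto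
  next
    case 2
    obtain \<gamma> where \<gamma>: "\<gamma> \<in> carrier stream_F" "\<And>u. \<gamma> ((True # False # y) @- u) = [True, False] @- u"
      using move_10 by blast
    then have "\<gamma> \<circ> caret 0 \<in> carrier stream_F" by (simp add: stream_F_mult_closed)
    then show ?thesis using \<gamma>(2) 2 v by (intro bexI[of _ "\<gamma> \<circ> caret 0"]) auto
  next
    case 3
    then show ?thesis using move_10[of y] v by simp
  next
    case 4
    then obtain \<gamma> where \<gamma>: "\<gamma> \<in> carrier stream_F" "\<And>u. \<gamma> ((True # y) @- u) = [True, False] @- u"
      using less.hyps[of "True # y"] less.prems v by auto
    let ?i = "inv_into UNIV (caret 0)"
    have "?i (True ## True ## u) = True ## u" for u
      using stream_F_inv_cancel(1)[OF caret_closed, of 0 "True ## u"] by simp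
    moreover have "\<gamma> \<circ> ?i \<in> carrier stream_F" using \<gamma> by (simp add: stream_F_mult_closed)
    ultimately show ?thesis using \<gamma>(2) 4 v by (intro bexI[of _ "\<gamma> \<circ> ?i"]) auto
  qed
qed

text \<open>A monotone bijection that fixes the cylinder of \<open>10\<close> maps the cylinders \<open>0\<close> and \<open>11\<close> on either side of it to
  themselves.\<close>

lemma fixing_10_decomp:
  assumes h: "h \<in> fixing [True, False]"
  obtains f g where "f \<in> carrier stream_F" "g \<in> carrier stream_F" "h = node f (node id g)"
proof -
  have hT: "h \<in> carrier stream_F" and fix_10: "\<And>u. h (True ## False ## u) = True ## False ## u"
    using h by (auto simp: fixing_def)
  have inj: "h u = h v \<Longrightarrow> u = v" for u v using stream_F_inj[OF hT] by (simp add: inj_def)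
  have "shd (h u) = shd u" for u
  proof (rule ccontr)
    assume ne: "shd (h u) \<noteq> shd u"
    \<comment> \<open>The left end point of the cylinder of \<open>10\<close> has value one half and separates the two halves.\<close>
    have z: "h (True ## zeros) = True ## zeros" using fix_10[of zeros] zeros_unfold by simp
    show False
    proof (cases u rule: stream_cases)
      case (1 v)
      then obtain w where w: "h u = True ## w" using ne by (cases "h u") auto
      have "bv (h u) \<le> bv (h (True ## zeros))" unfolding stream_F_le_iff[OF hT] 1 bv_Cons_le by simp
      then have "w = zeros" using binary_value_nonneg[of w] unfolding z w bv_Cons_le by (simp add: bv_eq_0_iff[symmetric])
      then have "u = True ## zeros" using inj z w by metis
      then show False using 1 by simp
    next
      case (2 v)
      then obtain w where w: "h u = False ## w" using ne by (cases "h u") auto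
      have "bv (h (True ## zeros)) \<le> bv (h u)" unfolding stream_F_le_iff[OF hT] 2 bv_Cons_le
        using binary_value_nonneg[of v] by simp
      then have "bv w = 1" unfolding z w bv_Cons_le by simp
      then have "bv (h u) = bv (h (True ## zeros))" unfolding z w by (simp add: binary_value_Cons)
      then have "bv v = 0" unfolding stream_F_eq_iff[OF hT] 2 by (simp add: binary_value_Cons)
      then have "u = True ## zeros" using 2 by (simp add: bv_eq_0_iff)
      then show False using z w by simp
    qed
  qed
  then obtain f h' where f: "f \<in> carrier stream_F" and h': "h' \<in> carrier stream_F" and eq: "h = node f h'"
    using node_decomp[OF hT] by blast
  have fix_0: "h' (False ## u) = False ## u" for u using fix_10[of u] by (simp add: eq)
  have "shd (h' u) = shd u" for u
  proof (cases u rule: stream_cases)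
    case (2 v)
    show ?thesis
    proof (cases "h' u" rule: stream_cases)
      case (1 w)
      then have "h' u = h' (False ## w)" by (simp add: fix_0)
      then have "u = False ## w" using stream_F_inj[OF h'] by (simp add: inj_def)
      then show ?thesis using 2 by simp
    qed (use 2 in simp)
  qed (simp add: fix_0)
  then obtain f' g where "f' \<in> carrier stream_F" and g: "g \<in> carrier stream_F" and eq': "h' = node f' g"
    using node_decomp[OF h'] by blast
  moreover have "f' = id" using fix_0 by (auto simp: eq')
  ultimately show ?thesis using that[OF f g] eq by simp
qed

text \<open>Conjugation by an element that moves the cylinder of \<open>v\<close> to that of \<open>10\<close> identifies the group with the
  direct product of two copies of Thompson's group.\<close>

lemma presents_fixing:
  assumes "True \<in> set v" "False \<in> set v"
  shows "\<exists>(g :: nat + nat \<Rightarrow> _) S R. presents (stream_F\<lparr>carrier := fixing v\<rparr>) S g R"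
proof -
  obtain \<gamma> where \<gamma>: "\<gamma> \<in> carrier stream_F" "\<And>u. \<gamma> (v @- u) = [True, False] @- u"
    using move_to_10[OF assms] by blast
  let ?i = "inv_into UNIV \<gamma>"
  have \<gamma>i: "?i (True ## False ## u) = v @- u" for u
    using stream_F_inv_cancel(1)[OF \<gamma>(1), of "v @- u"] \<gamma>(2) by simp
  note c = stream_F_inv_cancel[OF \<gamma>(1)]
  define \<psi> where "\<psi> = (\<lambda>(f, g). ?i \<circ> node f (node id g) \<circ> \<gamma>)"
  let ?K = "stream_F\<lparr>carrier := fixing v\<rparr>"
  have grp: "group ?K" by (rule stream_F.subgroup_imp_group[OF subgroup_fixing])
  have node: "node f (node id g) \<in> carrier stream_F" if "f \<in> carrier stream_F" "g \<in> carrier stream_F" for f g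
    using that by (intro node_closed stream_F_one_closed)
  have hom: "\<psi> \<in> hom (stream_F \<times>\<times> stream_F) ?K"
  proof (rule homI)
    fix p assume p: "p \<in> carrier (stream_F \<times>\<times> stream_F)"
    then show "\<psi> p \<in> carrier ?K"
      using \<gamma> node by (auto simp: \<psi>_def fixing_def \<gamma>i intro!: stream_F_mult_closed)
    fix q assume q: "q \<in> carrier (stream_F \<times>\<times> stream_F)"
    show "\<psi> (p \<otimes>\<^bsub>stream_F \<times>\<times> stream_F\<^esub> q) = \<psi> p \<otimes>\<^bsub>?K\<^esub> \<psi> q"
      by (cases p; cases q) (auto simp: \<psi>_def fun_eq_iff c node_comp[symmetric] node_comp[of id _ id, simplified, symmetric])
  qed
  moreover have "inj_on \<psi> (carrier (stream_F \<times>\<times> stream_F))"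
  proof (rule inj_onI)
    fix p q assume eq: "\<psi> p = \<psi> q"
    obtain f g f' g' where pq: "p = (f, g)" "q = (f', g')" by (cases p; cases q) auto
    have "node f (node id g) u = node f' (node id g') u" for u
      using fun_cong[OF eq, of "?i u"] c unfolding pq \<psi>_def by (simp, metis c(2))
    then have "node f (node id g) = node f' (node id g')" by blast
    then show "p = q" using node_eqD pq by blast
  qed
  moreover have "carrier ?K \<subseteq> \<psi> ` carrier (stream_F \<times>\<times> stream_F)"
  proof
    fix k assume "k \<in> carrier ?K"
    then have k: "k \<in> carrier stream_F" "\<And>u. k (v @- u) = v @- u" by (auto simp: fixing_def)
    have "\<gamma> \<circ> k \<circ> ?i \<in> fixing [True, False]"
      using k \<gamma> by (auto simp: fixing_def \<gamma>i intro!: stream_F_mult_closed)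
    then obtain f g where fg: "f \<in> carrier stream_F" "g \<in> carrier stream_F" "\<gamma> \<circ> k \<circ> ?i = node f (node id g)"
      by (rule fixing_10_decomp)
    have "k = \<psi> (f, g)" unfolding \<psi>_def prod.case fg(3)[symmetric] by (auto simp: fun_eq_iff c)
    then show "k \<in> \<psi> ` carrier (stream_F \<times>\<times> stream_F)" using fg by auto
  qed
  ultimately have "\<psi> \<in> iso (stream_F \<times>\<times> stream_F) ?K"
    unfolding iso_def bij_betw_def using hom_carrier[OF hom] by blast
  then show ?thesis using presents_iso[OF presents_DirProd[OF presents_stream_F presents_stream_F] grp] by blast
qed

lemma length_concat_replicate: "length (concat (replicate n w)) = n * length w"
  by (induction n) simp_all

lemma shift_fixed_point_unique:
  assumes "r \<noteq> []" "x = r @- x" "y = r @- y"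
  shows "x = y"
proof -
  have *: "z = concat (replicate n r) @- z" if "z = r @- z" for n z
  proof (induction n)
    case (Suc n)
    have "concat (replicate (Suc n) r) @- z = r @- concat (replicate n r) @- z" by simp
    then show ?case using Suc that by metis
  qed simp
  have "x !! k = y !! k" for k
  proof -
    have "Suc k * 1 \<le> Suc k * length r" using assms(1) by (intro mult_le_mono) (auto simp: Suc_le_eq)
    then have "k < length (concat (replicate (Suc k) r))" unfolding length_concat_replicate by simp
    then show ?thesis using *[OF assms(2), of "Suc k"] *[OF assms(3), of "Suc k"] by (metis shift_snth_less)
  qed
  then have "snth x = snth y" by blast
  then show ?thesis by (metis stream_smap_nats)
qed

text \<open>Remove \<open>w\<close> from the front of \<open>r\<close> as often as possible. A nonempty remainder would be a period shorter than
  \<open>w\<close>.\<close>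

lemma period_power:
  assumes min: "\<And>r. r \<noteq> [] \<Longrightarrow> cycle w = cycle r \<Longrightarrow> length w \<le> length r" and w: "w \<noteq> []"
    and r: "r @- cycle w = cycle w"
  shows "\<exists>k. r = concat (replicate k w)"
  using r
proof (induction "length r" arbitrary: r rule: less_induct)
  case less
  show ?case
  proof (cases "length w \<le> length r")
    case True
    have eq: "r @- cycle w = w @- cycle w" using less.prems cycle_decomp[OF w] by simp
    have "w = take (length w) r"
      using True arg_cong[OF eq, of "stake (length w)"] by (simp add: stake_shift)
    then obtain r' where r': "r = w @ r'" by (metis append_take_drop_id)
    have "w @- r' @- cycle w = w @- cycle w" using eq r' by simp
    then have "r' @- cycle w = cycle w" by (simp add: shift_left_inj)
    moreover have "length r' < length r" using r' w by simp
    ultimately obtain k where "r' = concat (replicate k w)" using less.hyps by blast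
    then have "r = concat (replicate (Suc k) w)" using r' by simp
    then show ?thesis by blast
  next
    case False
    have "r = []"
    proof (rule ccontr)
      assume ne: "r \<noteq> []"
      have "cycle w = cycle r"
        by (rule shift_fixed_point_unique[OF ne less.prems[symmetric] cycle_decomp[OF ne]])
      then show False using min[OF ne] False by simp
    qed
    then have "r = concat (replicate 0 w)" by simp
    then show ?thesis by blast
  qed
qed

text \<open>A word with both letters has an ascending HNN extension as stabilizer: the base group fixes the
  cylinder of a prefix \<open>v\<close>, and the stable letter \<open>s\<close> maps \<open>v u\<close> to \<open>v w u\<close>. The two constant words are fixed by all
  elements.\<close>

lemma finitely_presented_St:
  assumes "rational_point b"
  shows "finitely_presented (stream_F\<lparr>carrier := stream_St b\<rparr>)"
proof (cases "True \<in> sset b \<and> False \<in> sset b")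
  case False
  have "sset b \<noteq> {}" using snth_sset by blast
  then have "sset b = {False} \<or> sset b = {True}" using False by (metis (full_types) insertI1 is_singletonI' is_singleton_def singletonD)
  then have "b = zeros \<or> b = ones" by (simp add: zeros_def ones_def sconst_alt)
  then have "stream_St b = carrier stream_F"
    using stream_F_bv_0[of _ zeros] stream_F_bv_1[of _ ones] by (auto simp: stream_St_def bv_eq_0_iff bv_eq_1_iff)
  then show ?thesis using presents_finitely_presented[OF presents_stream_F] by simp
next
  case True
  \<comment> \<open>Minimality is over all ways of writing \<open>b\<close>, so \<open>w\<close> is a shortest period of the tail.\<close>
  define P where "P n \<longleftrightarrow> (\<exists>v w. w \<noteq> [] \<and> b = v @- cycle w \<and> length w = n)" for n
  have "\<exists>n. P n" using assms by (auto simp: rational_point_def P_def)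
  then have least: "P (LEAST n. P n)" by (rule LeastI_ex)
  then obtain v0 w where w: "w \<noteq> []" and b0: "b = v0 @- cycle w" and len: "length w = (LEAST n. P n)"
    unfolding P_def by blast
  have min: "length w \<le> length r" if "r \<noteq> []" "cycle w = cycle r" for r
    unfolding len by (rule Least_le) (use that b0 in \<open>auto simp: P_def\<close>)
  \<comment> \<open>One period is appended to make sure that \<open>v\<close> contains both letters.\<close>
  define v where "v = v0 @ w"
  have b: "b = v @- cycle w" using b0 cycle_decomp[OF w] by (simp add: v_def)
  have "sset (cycle w) = set w" using w by (rule sset_cycle)
  then have both: "True \<in> set v" "False \<in> set v" using True by (auto simp: b0 v_def)
  obtain \<gamma> where \<gamma>: "\<gamma> \<in> carrier stream_F" "\<And>u. \<gamma> (v @- u) = [True, False] @- u"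
    using move_to_10[OF both] by blast
  obtain \<delta> where \<delta>: "\<delta> \<in> carrier stream_F" "\<And>u. \<delta> ((v @ w) @- u) = [True, False] @- u"
    using move_to_10[of "v @ w"] both by auto
  define s where "s = inv_into UNIV \<delta> \<circ> \<gamma>"
  have sTF: "s \<in> carrier stream_F" using \<gamma> \<delta> by (simp add: s_def stream_F_mult_closed)
  have s: "s (v @- u) = v @- w @- u" for u
    using stream_F_inv_cancel(1)[OF \<delta>(1), of "(v @ w) @- u"] \<delta>(2)[of u] \<gamma>(2)[of u] by (simp add: s_def)
  let ?G = "stream_F\<lparr>carrier := stream_St b\<rparr>"
  interpret G: group ?G by (rule stream_F.subgroup_imp_group[OF subgroup_St])
  have inv_G: "inv\<^bsub>?G\<^esub> g = inv\<^bsub>stream_F\<^esub> g" if "g \<in> stream_St b" for g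
    by (rule stream_F.m_inv_consistent[OF subgroup_St that])
  have sG: "s \<in> stream_St b" using s[of "cycle w"] sTF cycle_decomp[OF w] by (simp add: stream_St_def b)
  have fix_sub: "fixing v \<subseteq> stream_St b" by (auto simp: fixing_def stream_St_def b)
  have pow_G: "s [^]\<^bsub>?G\<^esub> (n :: nat) \<in> stream_St b" for n using G.nat_pow_closed[of s n] sG by simp
  have pow: "(s [^]\<^bsub>?G\<^esub> n) (v @- u) = v @- concat (replicate n w) @- u" for n :: nat and u
  proof (induction n)
    case (Suc n)
    then show ?case by (simp add: s)
  qed simp
  have inv_pow: "(inv\<^bsub>?G\<^esub> (s [^]\<^bsub>?G\<^esub> n)) (v @- concat (replicate n w) @- u) = v @- u" for n :: nat and u
    unfolding inv_G[OF pow_G] by (rule stream_F_inv_apply) (use pow_G pow in \<open>auto simp: stream_St_def\<close>)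
  have "\<exists>R'. presents ?G (insert None (Some ` S)) (case_option s g) R'"
    if "presents (?G\<lparr>carrier := fixing v\<rparr>) S g R" for S :: "(nat + nat) set" and g R
  proof (rule G.presents_ascending_HNN[OF _ _ _ _ _ that])
    show "subgroup (fixing v) ?G"
      by (rule stream_F.subgroup_incl[OF subgroup_fixing subgroup_St fix_sub])
    show "s \<in> carrier ?G" using sG by simp
  next
    fix k assume k: "k \<in> fixing v"
    then have "s \<otimes>\<^bsub>?G\<^esub> k \<otimes>\<^bsub>?G\<^esub> inv\<^bsub>?G\<^esub> s \<in> carrier ?G" using fix_sub sG by (intro G.m_closed G.inv_closed) auto
    moreover have "(inv\<^bsub>?G\<^esub> s) (v @- w @- u) = v @- u" for u
      unfolding inv_G[OF sG] by (rule stream_F_inv_apply[OF sTF s])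
    moreover have "k (v @- w @- u) = v @- w @- u" for u using k by (simp add: fixing_def)
    ultimately show "s \<otimes>\<^bsub>?G\<^esub> k \<otimes>\<^bsub>?G\<^esub> inv\<^bsub>?G\<^esub> s \<in> fixing v"
      by (auto simp: fixing_def stream_St_def s)
  next
    fix n :: nat assume "s [^]\<^bsub>?G\<^esub> n \<in> fixing v"
    then have "(v @ concat (replicate n w)) @- u = v @- u" for u using pow[of n u] by (simp add: fixing_def)
    then have "v @ concat (replicate n w) = v" by (rule shift_same_tail_cancel)
    then have "length (concat (replicate n w)) = 0" by simp
    then show "n = 0" using w unfolding length_concat_replicate by simp
  next
    fix g assume "g \<in> carrier ?G"
    then have g: "g \<in> carrier stream_F" "g b = b" and gG: "g \<in> stream_St b" by (auto simp: stream_St_def)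
    obtain N where N: "prefix_map g N" using stream_F_prefix[OF g(1)] by blast
    \<comment> \<open>Besides the \<open>N\<close> periods that put \<open>g\<close> into its domain of prefix replacement, \<open>length v\<close> further ones make \<open>q\<close> at least as long as \<open>v\<close>.\<close>
    define m where "m = N + length v"
    have le: "n \<le> length (concat (replicate n w))" for n
      using w unfolding length_concat_replicate by (cases w) auto
    obtain q0 where q0: "\<And>u. g ((v @ concat (replicate N w)) @- u) = q0 @- u"
      using prefix_map_long[OF N, of "v @ concat (replicate N w)"] le[of N] by auto
    define q where "q = q0 @ concat (replicate (length v) w)"
    have q: "g (v @- concat (replicate m w) @- u) = q @- u" for u
      using q0[of "concat (replicate (length v) w) @- u"] by (simp add: m_def q_def replicate_add)
    have cyc: "concat (replicate n w) @- cycle w = cycle w" for n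
      by (induction n) (use cycle_decomp[OF w] in simp_all)
    have qv: "q @- cycle w = v @- cycle w"
      using q[of "cycle w"] g(2) by (simp add: cyc b)
    have "v = take (length v) q"
      using arg_cong[OF qv, of "stake (length v)"] le[of "length v"] by (simp add: stake_shift q_def)
    then obtain r where r: "q = v @ r" by (metis append_take_drop_id)
    then have "r @- cycle w = cycle w" using qv by (simp add: shift_left_inj)
    then obtain n where n: "r = concat (replicate n w)" using period_power[OF min w] by blast
    define k where "k = s [^]\<^bsub>?G\<^esub> m \<otimes>\<^bsub>?G\<^esub> g \<otimes>\<^bsub>?G\<^esub> inv\<^bsub>?G\<^esub> (s [^]\<^bsub>?G\<^esub> n)"
    have c: "g \<in> carrier ?G" "s \<in> carrier ?G" using gG sG by auto
    have "k \<in> carrier ?G" unfolding k_def by (intro G.m_closed G.inv_closed G.nat_pow_closed c)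
    moreover have "k (v @- u) = v @- u" for u
      by (simp add: k_def pow q r n inv_pow)
    ultimately have "k \<in> fixing v" by (auto simp: fixing_def stream_St_def)
    moreover have "g = inv\<^bsub>?G\<^esub> (s [^]\<^bsub>?G\<^esub> m) \<otimes>\<^bsub>?G\<^esub> k \<otimes>\<^bsub>?G\<^esub> s [^]\<^bsub>?G\<^esub> n"
    proof -
      have "inv\<^bsub>?G\<^esub> a \<otimes>\<^bsub>?G\<^esub> (a \<otimes>\<^bsub>?G\<^esub> g \<otimes>\<^bsub>?G\<^esub> inv\<^bsub>?G\<^esub> c) \<otimes>\<^bsub>?G\<^esub> c = g"
        if "a \<in> carrier ?G" "c \<in> carrier ?G" for a c
        using G.m_assoc G.l_inv G.r_inv G.l_one G.r_one G.inv_closed G.m_closed that \<open>g \<in> carrier ?G\<close>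
        by (metis (no_types, lifting))
      then show ?thesis unfolding k_def using c by (metis G.nat_pow_closed)
    qed
    ultimately show "\<exists>m n. \<exists>k\<in>fixing v. g = inv\<^bsub>?G\<^esub> (s [^]\<^bsub>?G\<^esub> (m::nat)) \<otimes>\<^bsub>?G\<^esub> k \<otimes>\<^bsub>?G\<^esub> s [^]\<^bsub>?G\<^esub> (n::nat)"
      by blast
  qed
  moreover obtain S :: "(nat + nat) set" and g R where "presents (stream_F\<lparr>carrier := fixing v\<rparr>) S g R"
    using presents_fixing[OF both] by blast
  ultimately obtain R' where "presents ?G (insert None (Some ` S)) (case_option s g) R'" by fastforce
  then show ?thesis by (rule presents_finitely_presented)
qed

section \<open>From infinite words to piecewise linear maps\<close>

primcorec binexp :: "real \<Rightarrow> bool stream" where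
  "shd (binexp x) = (1 / 2 \<le> x)"
| "stl (binexp x) = binexp (if 1 / 2 \<le> x then 2 * x - 1 else 2 * x)"

lemma bv_binexp:
  assumes "x \<in> {0..1}"
  shows "bv (binexp x) = x"
proof -
  have "\<bar>bv (binexp x) - x\<bar> \<le> (1 / 2) ^ n" if "x \<in> {0..1}" for n x
    using that
  proof (induction n arbitrary: x)
    case 0
    then show ?case using binary_value_nonneg[of "binexp x"] binary_value_le_1[of "binexp x"] by auto
  next
    case (Suc n)
    define y where "y = (if 1 / 2 \<le> x then 2 * x - 1 else 2 * x)"
    have "binexp x = (1 / 2 \<le> x) ## binexp y" unfolding y_def by (subst binexp.ctr) simp
    then have "bv (binexp x) = (of_bool (1 / 2 \<le> x) + bv (binexp y)) / 2" by (simp only: binary_value_Cons)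
    then have "bv (binexp x) - x = (bv (binexp y) - y) / 2" by (simp add: y_def field_simps)
    then have "\<bar>bv (binexp x) - x\<bar> = \<bar>bv (binexp y) - y\<bar> / 2" by (simp only: abs_divide abs_numeral)
    moreover have "\<bar>bv (binexp y) - y\<bar> \<le> (1 / 2) ^ n" by (rule Suc.IH) (use Suc.prems in \<open>auto simp: y_def\<close>)
    ultimately show ?case by simp
  qed
  then have "\<bar>bv (binexp x) - x\<bar> \<le> (1 / 2) ^ n" for n using assms by blast
  moreover have "(\<lambda>n. (1 / 2 :: real) ^ n) \<longlonglongrightarrow> 0" by (rule LIMSEQ_power_zero) simp
  ultimately have "\<bar>bv (binexp x) - x\<bar> \<le> 0" by (intro LIMSEQ_le_const[of _ 0]) auto
  then show ?thesis by simp
qed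

lemma bv_in [simp]: "bv u \<in> {0..1}"
  using binary_value_nonneg binary_value_le_1 by auto

lemma word_of_numerator:
  "M < 2 ^ L \<Longrightarrow> \<exists>q. length q = L \<and> bv (q @- zeros) = real M / 2 ^ L"
proof (induction L arbitrary: M)
  case (Suc L)
  define a where "a \<longleftrightarrow> 2 ^ L \<le> M"
  define M' where "M' = (if a then M - 2 ^ L else M)"
  have M: "real M = of_bool a * 2 ^ L + real M'" by (auto simp: M'_def a_def of_nat_diff)
  have "M' < 2 ^ L" using Suc.prems by (auto simp: M'_def a_def)
  then obtain q where "length q = L" "bv (q @- zeros) = real M' / 2 ^ L" using Suc.IH by blast
  then show ?case by (intro exI[of _ "a # q"]) (simp add: M binary_value_Cons field_simps)
qed simp

lemma numerator_of_word: "\<exists>i :: int. bv (p @- zeros) = of_int i / 2 ^ length p"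
proof (induction p)
  case Nil
  show ?case by (intro exI[of _ 0]) simp
next
  case (Cons a p)
  then obtain i :: int where "bv (p @- zeros) = of_int i / 2 ^ length p" by blast
  then show ?case
    by (intro exI[of _ "of_bool a * 2 ^ length p + i"]) (simp add: binary_value_Cons field_simps)
qed

definition cyl :: "bool list \<Rightarrow> real set" where
  "cyl p = {bv (p @- zeros) .. bv (p @- ones)}"

lemma bv_ones_shift: "bv (p @- ones) = bv (p @- zeros) + 1 / 2 ^ length p"
  using bv_shift[of p ones] by simp

lemma bv_in_cyl: "bv (p @- u) \<in> cyl p"
  unfolding cyl_def bv_ones_shift bv_shift[of p u]
  using binary_value_nonneg[of u] binary_value_le_1[of u] by (simp add: divide_right_mono)

lemma cylE:
  assumes "x \<in> cyl p"
  obtains u where "x = bv (p @- u)"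
proof
  have "2 ^ length p * (x - bv (p @- zeros)) \<in> {0..1}"
    using assms unfolding cyl_def bv_ones_shift by (simp add: field_simps)
  then show "x = bv (p @- binexp (2 ^ length p * (x - bv (p @- zeros))))"
    by (subst bv_shift) (simp add: bv_binexp)
qed

definition prefix_fun :: "(real \<Rightarrow> real) \<Rightarrow> nat \<Rightarrow> bool" where
  "prefix_fun f N \<longleftrightarrow> (\<forall>p. length p = N \<longrightarrow> (\<exists>q. \<forall>u. f (bv (p @- u)) = bv (q @- u)))"

lemma thompson_F_carrierD:
  assumes "f \<in> carrier thompson_F"
  shows "f \<in> extensional {0..1}" "\<exists>g. homeomorphism {0..1} {0..1} f g" "strict_mono_on {0..1} f"
    "piecewise_linear f"
    "\<exists>D. finite D \<and> D \<subseteq> dyadic_rationals \<and> (\<forall>t\<in>{0<..<1} - D. f differentiable (at t))"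
    "\<And>t d. t \<in> {0<..<1} \<Longrightarrow> (f has_real_derivative d) (at t) \<Longrightarrow> \<exists>k::int. d = 2 powi k"
  using assms by (auto simp: thompson_F_def)

lemma thompson_F_image: "f \<in> carrier thompson_F \<Longrightarrow> f ` {0..1} = {0..1}"
  using thompson_F_carrierD(2) homeomorphism_image1 by blast

lemma thompson_F_endpoints:
  assumes "f \<in> carrier thompson_F"
  shows "f 0 = 0" "f 1 = 1"
proof -
  have im: "f ` {0..1} = {0..1}" by (rule thompson_F_image[OF assms])
  have mono: "x \<le> y \<Longrightarrow> f x \<le> f y" if "x \<in> {0..1}" "y \<in> {0..1}" for x y
    using thompson_F_carrierD(3)[OF assms] that by (auto simp: strict_mono_on_leD)
  obtain x y where "x \<in> {0..1}" "f x = 0" "y \<in> {0..1}" "f y = 1"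
    using im by (metis (no_types, lifting) atLeastAtMost_iff imageE order_refl zero_le_one)
  moreover have "f 0 \<in> {0..1}" "f 1 \<in> {0..1}" using im by auto
  ultimately show "f 0 = 0" "f 1 = 1" using mono[of 0 x] mono[of y 1] by auto
qed

lemma has_real_derivative_transform_within:
  fixes f :: "real \<Rightarrow> real"
  assumes "x \<in> S" "\<And>y. y \<in> S \<Longrightarrow> g y = f y" "(f has_real_derivative D) (at x within S)"
  shows "(g has_real_derivative D) (at x within S)"
  using has_derivative_transform[of x S g f] assms by (simp add: has_field_derivative_def)

text \<open>At a break point inside the interval the one-sided derivatives are the slopes of the adjacent
  pieces, so differentiability makes the pieces fit together.\<close>

lemma affine_glue:
  fixes f :: "real \<Rightarrow> real"
  assumes fin: "finite P"
    and pl: "\<And>a b. A \<le> a \<Longrightarrow> a < b \<Longrightarrow> b \<le> B \<Longrightarrow> {a<..<b} \<inter> P = {} \<Longrightarrow> \<exists>c d. \<forall>t\<in>{a..b}. f t = c * t + d"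
    and diff: "\<And>t. t \<in> {A<..<B} \<Longrightarrow> f differentiable (at t)"
    and "A \<le> a" "a < b" "b \<le> B"
  shows "\<exists>c d. \<forall>t\<in>{a..b}. f t = c * t + d"
  using assms(4-6)
proof (induction "card ({a<..<b} \<inter> P)" arbitrary: a b rule: less_induct)
  case less
  show ?case
  proof (cases "{a<..<b} \<inter> P = {}")
    case True
    then show ?thesis using pl less.prems by blast
  next
    case False
    then obtain x where x: "x \<in> P" "a < x" "x < b" by auto
    have "card ({a<..<x} \<inter> P) < card ({a<..<b} \<inter> P)" "card ({x<..<b} \<inter> P) < card ({a<..<b} \<inter> P)"
      using fin x by (auto intro!: psubset_card_mono)
    then obtain c d c' d' where l: "\<And>t. t \<in> {a..x} \<Longrightarrow> f t = c * t + d"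
      and r: "\<And>t. t \<in> {x..b} \<Longrightarrow> f t = c' * t + d'"
      using less.hyps[of a x] less.hyps[of x b] x less.prems by (metis less_imp_le order_trans)
    have "f differentiable (at x)" using diff x less.prems by auto
    then obtain D where D: "(f has_real_derivative D) (at x)" by (auto simp: real_differentiable_def)
    have "((\<lambda>t. c * t + d) has_real_derivative D) (at x within {a..x})"
      by (rule has_real_derivative_transform_within[OF _ _ has_field_derivative_at_within[OF D]]) (use l x in auto)
    moreover have "((\<lambda>t. c * t + d) has_real_derivative c) (at x within {a..x})"
      by (auto intro!: derivative_eq_intros)
    ultimately have "D = c"
      using vector_derivative_unique_within_closed_interval[of a x x] x
      by (auto simp: has_real_derivative_iff_has_vector_derivative)
    have "((\<lambda>t. c' * t + d') has_real_derivative D) (at x within {x..b})"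
      by (rule has_real_derivative_transform_within[OF _ _ has_field_derivative_at_within[OF D]]) (use r x in auto)
    moreover have "((\<lambda>t. c' * t + d') has_real_derivative c') (at x within {x..b})"
      by (auto intro!: derivative_eq_intros)
    ultimately have "D = c'"
      using vector_derivative_unique_within_closed_interval[of x b x] x
      by (auto simp: has_real_derivative_iff_has_vector_derivative)
    then have "c' = c" "d' = d" using l[of x] r[of x] x \<open>D = c\<close> by auto
    then show ?thesis using l r by (metis atLeastAtMost_iff le_cases)
  qed
qed

lemma dyadic_common_denominator:
  assumes "finite D" "D \<subseteq> dyadic_rationals"
  shows "\<exists>N. \<forall>x\<in>D. \<exists>m :: int. x = of_int m / 2 ^ N"
proof -
  have "\<exists>n. \<exists>m :: int. x = of_int m / 2 ^ n" if "x \<in> D" for x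
    using assms(2) that unfolding dyadic_rationals_def by blast
  then obtain e where e: "\<And>x. x \<in> D \<Longrightarrow> \<exists>m :: int. x = of_int m / 2 ^ e x" by metis
  have "\<exists>m :: int. x = of_int m / 2 ^ Max (e ` D)" if x: "x \<in> D" for x
  proof -
    obtain m :: int where m: "x = of_int m / 2 ^ e x" using e x by blast
    have le: "e x \<le> Max (e ` D)" using x assms(1) by simp
    have "(2 :: real) ^ Max (e ` D) = 2 ^ (Max (e ` D) - e x) * 2 ^ e x" using le by (simp flip: power_add)
    then have "x = of_int (m * 2 ^ (Max (e ` D) - e x)) / 2 ^ Max (e ` D)"
      using m by simp
    then show ?thesis by blast
  qed
  then show ?thesis by blast
qed

text \<open>If the finitely many points without derivative are multiples of \<open>1 / 2\<^sup>N\<close>, they do not lie inside any cylinder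
  of a word of length \<open>N\<close>.\<close>

lemma thompson_F_affine_on_cylinders:
  assumes f: "f \<in> carrier thompson_F"
  shows "\<exists>N. \<forall>p. length p = N \<longrightarrow> (\<exists>e :: int. \<forall>u. f (bv (p @- u)) = f (bv (p @- zeros)) + 2 powi e * bv u)"
proof -
  obtain D where D: "finite D" "D \<subseteq> dyadic_rationals" "\<And>t. t \<in> {0<..<1} - D \<Longrightarrow> f differentiable (at t)"
    using thompson_F_carrierD(5)[OF f] by blast
  obtain P where P: "finite P" "\<And>a b. 0 \<le> a \<Longrightarrow> a < b \<Longrightarrow> b \<le> 1 \<Longrightarrow> {a<..<b} \<inter> P = {} \<Longrightarrow>
      \<exists>c d. \<forall>t\<in>{a..b}. f t = c * t + d"
    using thompson_F_carrierD(4)[OF f] unfolding piecewise_linear_def by blast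
  obtain N where N: "\<And>x. x \<in> D \<Longrightarrow> \<exists>m :: int. x = of_int m / 2 ^ N"
    using dyadic_common_denominator[OF D(1,2)] by blast
  have "\<exists>e :: int. \<forall>u. f (bv (p @- u)) = f (bv (p @- zeros)) + 2 powi e * bv u" if p: "length p = N" for p
  proof -
    let ?a = "bv (p @- zeros)" and ?b = "bv (p @- ones)"
    have ab: "0 \<le> ?a" "?a < ?b" "?b \<le> 1" "?b = ?a + 1 / 2 ^ N"
      by (rule binary_value_nonneg binary_value_le_1 bv_zeros_less_ones | simp add: bv_ones_shift p)+
    obtain i :: int where i: "?a = of_int i / 2 ^ N" using numerator_of_word[of p] p by auto
    have "t \<notin> D" if t: "t \<in> {?a<..<?b}" for t
    proof
      assume "t \<in> D"
      then obtain m :: int where "t = of_int m / 2 ^ N" using N by blast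
      then have "real_of_int i < of_int m" "real_of_int m < of_int (i + 1)"
        using t unfolding greaterThanLessThan_iff ab(4) i by (auto simp: field_simps)
      then have "i < m" "m < i + 1" by (simp_all only: of_int_less_iff)
      then show False by simp
    qed
    then have diff: "f differentiable (at t)" if "t \<in> {?a<..<?b}" for t
      using D(3)[of t] that ab by auto
    have "\<exists>c d. \<forall>t\<in>{?a..?b}. f t = c * t + d"
    proof (rule affine_glue[OF P(1) _ diff])
      fix a b assume *: "?a \<le> a" "a < b" "b \<le> ?b" "{a<..<b} \<inter> P = {}"
      show "\<exists>c d. \<forall>t\<in>{a..b}. f t = c * t + d"
        by (rule P(2)[OF _ *(2) _ *(4)]) (use * ab in linarith)+
    qed (use ab in auto)
    then obtain c d where cd: "\<And>t. t \<in> {?a..?b} \<Longrightarrow> f t = c * t + d" by blast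
    \<comment> \<open>The slope is the derivative at any interior point, hence a power of 2.\<close>
    let ?m = "(?a + ?b) / 2"
    have m: "?m \<in> {?a<..<?b}" "?m \<in> {0<..<1}" using ab(1-3) by auto
    have "((\<lambda>t. c * t + d) has_real_derivative c) (at ?m)"
      by (auto intro!: derivative_eq_intros)
    then have "(f has_real_derivative c) (at ?m)"
      by (rule has_field_derivative_transform_within_open[of _ _ _ "{?a<..<?b}"]) (use m cd in auto)
    then obtain k :: int where k: "c = 2 powi k" using thompson_F_carrierD(6)[OF f m(2)] by blast
    have "f (bv (p @- u)) = f ?a + 2 powi (k - int N) * bv u" for u
    proof -
      have "f (bv (p @- u)) = c * (?a + bv u / 2 ^ N) + d"
        using cd[of "bv (p @- u)"] bv_in_cyl[of p u] unfolding cyl_def by (simp add: bv_shift[of p u] p)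
      moreover have "f ?a = c * ?a + d" using cd[of ?a] ab by simp
      moreover have "2 powi (k - int N) = c / 2 ^ N" unfolding k by (simp add: power_int_diff)
      ultimately show ?thesis by (simp add: algebra_simps)
    qed
    then show ?thesis by blast
  qed
  then show ?thesis by blast
qed

lemma dyadic_add_powi:
  assumes "y \<in> dyadic_rationals"
  shows "y + 2 powi e \<in> dyadic_rationals"
proof -
  obtain m :: int and n where y: "y = of_int m / 2 ^ n" using assms by (auto simp: dyadic_rationals_def)
  show ?thesis
  proof (cases "0 \<le> e")
    case True
    then have "y + 2 powi e = of_int (m + 2 ^ nat e * 2 ^ n) / 2 ^ n"
      by (simp add: y power_int_def field_simps)
    then show ?thesis unfolding dyadic_rationals_def by blast
  next
    case False
    then have "y + 2 powi e = of_int (m * 2 ^ nat (- e) + 2 ^ n) / 2 ^ (n + nat (- e))"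
      by (simp add: y power_int_def field_simps power_add)
    then show ?thesis unfolding dyadic_rationals_def by blast
  qed
qed

text \<open>For long \<open>z\<close> the image of the cylinder of \<open>p @ z\<close> has length \<open>1 / 2\<^sup>L\<close> with \<open>L\<close> so large that its left end point
  is a multiple of \<open>1 / 2\<^sup>L\<close>; it is then a cylinder itself.\<close>

lemma affine_cylinder_prefix:
  assumes aff: "\<And>u. f (bv (p @- u)) = y + 2 powi e * bv u" and y: "y = of_int m / 2 ^ d"
    and range: "\<And>u. f (bv (p @- u)) \<in> {0..1}" and long: "nat \<bar>e\<bar> + d \<le> length z"
  shows "\<exists>q. \<forall>u. f (bv ((p @ z) @- u)) = bv (q @- u)"
proof -
  let ?n = "length z"
  define L where "L = nat (int ?n - e)"
  have L: "int L = int ?n - e" "d \<le> L" using long by (auto simp: L_def)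
  obtain i :: int where i: "bv (z @- zeros) = of_int i / 2 ^ ?n" using numerator_of_word by blast
  define M where "M = m * 2 ^ (L - d) + i"
  have e: "2 powi e = (2 ^ ?n / 2 ^ L :: real)"
  proof -
    have "e = int ?n - int L" using L by simp
    then show ?thesis by (simp add: power_int_diff)
  qed
  have val: "f (bv ((p @ z) @- u)) = (of_int M + bv u) / 2 ^ L" for u
  proof -
    have "f (bv ((p @ z) @- u)) = y + 2 powi e * (of_int i / 2 ^ ?n + bv u / 2 ^ ?n)"
      using aff[of "z @- u"] bv_shift[of z u] i by simp
    also have "\<dots> = of_int m / 2 ^ d + (of_int i + bv u) / 2 ^ L"
      unfolding e y by (simp add: field_simps)
    also have "of_int m / 2 ^ d = (of_int (m * 2 ^ (L - d)) / 2 ^ L :: real)"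
    proof -
      have "(2 :: real) ^ L = 2 ^ (L - d) * 2 ^ d" using L(2) by (simp flip: power_add)
      then show ?thesis by simp
    qed
    finally show ?thesis by (simp add: M_def add_divide_distrib)
  qed
  have "0 \<le> real_of_int M / 2 ^ L" "(real_of_int M + 1) / 2 ^ L \<le> 1"
    using range[of "z @- zeros"] range[of "z @- ones"] val[of zeros] val[of ones] by auto
  then have "real_of_int 0 \<le> of_int M" "real_of_int (M + 1) \<le> of_int (2 ^ L)"
    by (simp_all add: field_simps)
  then have "0 \<le> M" "M + 1 \<le> 2 ^ L" by (simp_all only: of_int_le_iff)
  then have "0 \<le> M" "M < 2 ^ L" by simp_all
  then have "nat M < 2 ^ L" by (simp add: nat_less_iff)
  then obtain q where q: "length q = L" "bv (q @- zeros) = real (nat M) / 2 ^ L"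
    using word_of_numerator by blast
  have "f (bv ((p @ z) @- u)) = bv (q @- u)" for u
    unfolding val bv_shift[of q u] q using \<open>0 \<le> M\<close> by (simp add: add_divide_distrib)
  then show ?thesis by blast
qed

text \<open>The left end points of the cylinders have dyadic images, by induction from left to right, because
  along each cylinder the function increases by a power of 2. The sufficient lengths of \<open>z\<close> in
  \<open>affine_cylinder_prefix\<close> are bounded over the finitely many cylinders.\<close>

lemma thompson_F_prefix_fun:
  assumes f: "f \<in> carrier thompson_F"
  shows "\<exists>N. prefix_fun f N"
proof -
  obtain N e where aff: "\<And>p u. length p = N \<Longrightarrow> f (bv (p @- u)) = f (bv (p @- zeros)) + 2 powi (e p :: int) * bv u"
    using thompson_F_affine_on_cylinders[OF f] by metis
  have range: "f (bv u) \<in> {0..1}" for u using thompson_F_image[OF f] bv_in by blast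
  have dy: "\<forall>p\<in>set ps. f (bv (p @- zeros)) \<in> dyadic_rationals"
    if "chain a ps b" "f a \<in> dyadic_rationals" "\<And>p. p \<in> set ps \<Longrightarrow> length p = N" for a b ps
    using that
  proof (induction ps arbitrary: a)
    case (Cons p ps)
    have "f (bv (p @- ones)) = f (bv (p @- zeros)) + 2 powi e p" using aff[of p ones] Cons.prems by simp
    then have "f (bv (p @- ones)) \<in> dyadic_rationals" using dyadic_add_powi Cons.prems by auto
    then show ?case using Cons by auto
  qed simp
  have set_full: "p \<in> set (leaves (full N)) \<longleftrightarrow> length p = N" for N p
  proof (induction N arbitrary: p)
    case (Suc N)
    then show ?case by (cases p) auto
  qed simp
  have "f 0 \<in> dyadic_rationals" using thompson_F_endpoints[OF f] unfolding dyadic_rationals_def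
    by (auto intro!: exI[of _ 0])
  then have "f (bv (p @- zeros)) \<in> dyadic_rationals" if "length p = N" for p
    using dy[OF chain_leaves, of "full N"] that by (auto simp: set_full)
  then have "\<exists>d m. f (bv (p @- zeros)) = of_int m / 2 ^ d" if "length p = N" for p
    using that unfolding dyadic_rationals_def by blast
  then obtain d m where dm: "\<And>p. length p = N \<Longrightarrow> f (bv (p @- zeros)) = of_int (m p) / 2 ^ d p" by metis
  let ?L = "{p :: bool list. length p = N}"
  define M where "M = Max ((\<lambda>p. nat \<bar>e p\<bar> + d p) ` ?L)"
  have fin: "finite ?L" using finite_lists_length_eq[of "UNIV :: bool set" N] by simp
  have M: "nat \<bar>e p\<bar> + d p \<le> M" if "length p = N" for p
    unfolding M_def using fin that by (intro Max_ge) auto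
  have "prefix_fun f (N + M)" unfolding prefix_fun_def
  proof (intro allI impI)
    fix P :: "bool list" assume P: "length P = N + M"
    let ?p = "take N P" and ?z = "drop N P"
    have p: "length ?p = N" using P by simp
    have "\<exists>q. \<forall>u. f (bv ((?p @ ?z) @- u)) = bv (q @- u)"
      by (rule affine_cylinder_prefix[OF aff[OF p] dm[OF p] range]) (use M[OF p] P in simp)
    then show "\<exists>q. \<forall>u. f (bv (P @- u)) = bv (q @- u)" by simp
  qed
  then show ?thesis by blast
qed

lemma F_action_stream_F:
  assumes f: "f \<in> carrier thompson_F"
  shows bv_F_action: "bv (F_action f u) = f (bv u)" and F_action_closed: "F_action f \<in> carrier stream_F"
proof -
  obtain N where "prefix_fun f N" using thompson_F_prefix_fun[OF f] by blast
  then obtain Q where Q: "\<And>p u. length p = N \<Longrightarrow> f (bv (p @- u)) = bv (Q p @- u)"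
    unfolding prefix_fun_def by metis
  have act: "F_action f (p @- u) = Q p @- u" if "length p = N" for p u
    using Q[OF that] by (intro F_action_eqI) auto
  have bv: "bv (F_action f u) = f (bv u)" for u
    using act[of "stake N u" "sdrop N u"] Q[of "stake N u" "sdrop N u"] by (simp add: stake_sdrop)
  then show "bv (F_action f u) = f (bv u)" .
  have pre: "prefix_map (F_action f) N" unfolding prefix_map_def using act by blast
  have le: "bv u \<le> bv v \<longleftrightarrow> bv (F_action f u) \<le> bv (F_action f v)" for u v
    unfolding bv using strict_mono_on_less_eq[OF thompson_F_carrierD(3)[OF f] bv_in bv_in] by simp
  \<comment> \<open>The leaves of the second tree cover all infinite words, which shows surjectivity.\<close>
  have "\<exists>T. matches (F_action f) (full N) T"
    by (rule prefix_map_matches[OF pre])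
      (use le thompson_F_endpoints[OF f] in \<open>auto simp: bv intro: order_antisym\<close>)
  then have "surj (F_action f)" using matches_surj by blast
  then show "F_action f \<in> carrier stream_F" using le pre by (intro stream_F_I)
qed

text \<open>The map of the unit interval that \<open>g\<close> induces on values, the inverse of the passage from \<open>f\<close> to
  \<^term>\<open>F_action f\<close>.\<close>

definition realize :: "(bool stream \<Rightarrow> bool stream) \<Rightarrow> real \<Rightarrow> real" where
  "realize g = (\<lambda>x\<in>{0..1}. bv (g (binexp x)))"

lemma realize_bv:
  assumes "g \<in> carrier stream_F"
  shows "realize g (bv u) = bv (g u)"
  using bv_in[of u] stream_F_eq_iff[OF assms, of "binexp (bv u)" u] by (simp add: realize_def bv_binexp del: bv_in)

lemma F_action_realize: "g \<in> carrier stream_F \<Longrightarrow> F_action (realize g) = g"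
  by (rule ext, rule F_action_eqI) (simp_all add: realize_bv stream_F_ends_in_ones)

lemma bvE:
  assumes "x \<in> {0..1}"
  obtains u where "x = bv u"
proof
  show "x = bv (binexp x)" by (rule bv_binexp[OF assms, symmetric])
qed

lemma realize_F_action:
  assumes f: "f \<in> carrier thompson_F"
  shows "realize (F_action f) = f"
proof
  fix x
  show "realize (F_action f) x = f x"
  proof (cases "x \<in> {0..1}")
    case True
    then obtain u where "x = bv u" by (rule bvE)
    then show ?thesis using realize_bv[OF F_action_closed[OF f]] bv_F_action[OF f] by simp
  next
    case False
    then show ?thesis using thompson_F_carrierD(1)[OF f] by (auto simp: realize_def extensional_def)
  qed
qed

lemma realize_affine:
  assumes g: "g \<in> carrier stream_F" and q: "\<And>u. g (p @- u) = q @- u" and x: "x \<in> cyl p"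
  shows "realize g x = 2 powi (int (length p) - int (length q)) * (x - bv (p @- zeros)) + bv (q @- zeros)"
proof -
  obtain u where u: "x = bv (p @- u)" using x by (rule cylE)
  have "realize g x = bv (q @- u)" using u q realize_bv[OF g] by simp
  then show ?thesis unfolding u bv_shift[of p u] bv_shift[of q u] by (simp add: power_int_diff)
qed

text \<open>On the cylinder of each word of length \<open>N\<close> the map is affine with a power of 2 as slope, so all
  analytic conditions can be checked cylinder by cylinder; \<open>P\<close> is the set of end points.\<close>

lemma realize_closed:
  assumes g: "g \<in> carrier stream_F"
  shows "realize g \<in> carrier thompson_F"
proof -
  let ?f = "realize g"
  obtain N where N: "prefix_map g N" using stream_F_prefix[OF g] by blast
  then obtain Q where Q: "\<And>p u. length p = N \<Longrightarrow> g (p @- u) = Q p @- u"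
    unfolding prefix_map_def by metis
  let ?c = "\<lambda>p. 2 powi (int (length p) - int (length (Q p))) :: real"
  have aff: "?f x = ?c p * (x - bv (p @- zeros)) + bv (Q p @- zeros)" if "length p = N" "x \<in> cyl p" for p x
    using realize_affine[OF g Q[OF that(1)] that(2)] .
  have aff_deriv: "((\<lambda>x. ?c p * (x - bv (p @- zeros)) + bv (Q p @- zeros)) has_real_derivative ?c p) (at x within S)" for p x S
    by (auto intro!: derivative_eq_intros)
  let ?L = "{p :: bool list. length p = N}"
  have fin: "finite ?L" using finite_lists_length_eq[of "UNIV :: bool set" N] by simp
  have cover: "\<exists>p\<in>?L. x \<in> cyl p" if x: "x \<in> {0..1}" for x
  proof -
    obtain u where u: "x = bv u" using x by (rule bvE)
    then show ?thesis using bv_in_cyl[of "stake N u" "sdrop N u"]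
      by (intro bexI[of _ "stake N u"]) (simp_all add: stake_sdrop)
  qed
  have cyl_sub: "cyl p \<subseteq> {0..1}" for p
    using binary_value_nonneg binary_value_le_1 by (auto simp: cyl_def intro: order_trans)
  define P where "P = (\<lambda>p. bv (p @- zeros)) ` ?L \<union> (\<lambda>p. bv (p @- ones)) ` ?L"
  have finP: "finite P" using fin by (simp add: P_def)
  \<comment> \<open>The cylinder that contains the midpoint contains the whole interval, since its end points are in \<open>P\<close>.\<close>
  have inside: "\<exists>p\<in>?L. {a..b} \<subseteq> cyl p" if "0 \<le> a" "a < b" "b \<le> 1" "{a<..<b} \<inter> P = {}" for a b
  proof -
    obtain p where p: "p \<in> ?L" "(a + b) / 2 \<in> cyl p" using cover[of "(a + b) / 2"] \<open>0 \<le> a\<close> \<open>a < b\<close> \<open>b \<le> 1\<close> by auto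
    have "bv (p @- zeros) \<in> P" "bv (p @- ones) \<in> P" using p(1) by (auto simp: P_def)
    then have "bv (p @- zeros) \<notin> {a<..<b}" "bv (p @- ones) \<notin> {a<..<b}" using that(4) by auto
    then have "bv (p @- zeros) \<le> a" "b \<le> bv (p @- ones)" using p(2) \<open>a < b\<close> unfolding cyl_def by auto
    then show ?thesis using p(1) by (intro bexI[of _ p]) (auto simp: cyl_def)
  qed
  have ext: "?f \<in> extensional {0..1}" by (simp add: realize_def)
  have mono: "strict_mono_on {0..1} ?f"
  proof (rule strict_mono_onI)
    fix x y :: real assume "x \<in> {0..1}" "y \<in> {0..1}" "x < y"
    moreover from this obtain u v where "x = bv u" "y = bv v" by (metis bvE)
    ultimately show "?f x < ?f y" using stream_F_le_iff[OF g, of v u] by (simp add: realize_bv[OF g])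
  qed
  have im: "?f ` {0..1} = {0..1}"
  proof (intro equalityI subsetI)
    fix y assume "y \<in> ?f ` {0..1}"
    then show "y \<in> {0..1}" using binary_value_nonneg binary_value_le_1 by (auto simp: realize_def)
  next
    fix y :: real assume "y \<in> {0..1}"
    then obtain v where v: "y = bv v" by (rule bvE)
    obtain u where "g u = v" using stream_F_surj[OF g] by (metis surjD)
    then show "y \<in> ?f ` {0..1}" using v realize_bv[OF g, of u] by (intro image_eqI[of _ _ "bv u"] bv_in) simp
  qed
  have cont: "continuous_on {0..1} ?f"
  proof -
    have "continuous_on (\<Union>p\<in>?L. cyl p) ?f"
    proof (rule continuous_on_closed_Union[OF fin])
      fix p assume p: "p \<in> ?L"
      show "closed (cyl p)" by (simp add: cyl_def)
      have "continuous_on (cyl p) (\<lambda>x. ?c p * (x - bv (p @- zeros)) + bv (Q p @- zeros))"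
        by (intro continuous_intros)
      then show "continuous_on (cyl p) ?f" by (rule continuous_on_eq) (use aff p in auto)
    qed
    moreover have "(\<Union>p\<in>?L. cyl p) = {0..1}" using cover cyl_sub by blast
    ultimately show ?thesis by simp
  qed
  have "\<exists>h. homeomorphism {0..1} {0..1} ?f h"
    using homeomorphism_compact[OF _ cont im strict_mono_on_imp_inj_on[OF mono]] by auto
  moreover have "piecewise_linear ?f"
    unfolding piecewise_linear_def
  proof (intro exI[of _ P] conjI allI impI finP)
    fix a b :: real assume "0 \<le> a \<and> a < b \<and> b \<le> 1 \<and> {a<..<b} \<inter> P = {}"
    then obtain p where p: "p \<in> ?L" "{a..b} \<subseteq> cyl p" using inside by blast
    show "\<exists>c d. \<forall>t\<in>{a..b}. ?f t = c * t + d"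
      by (rule exI[of _ "?c p"], rule exI[of _ "bv (Q p @- zeros) - ?c p * bv (p @- zeros)"])
        (use p aff[of p] in \<open>auto simp: algebra_simps\<close>)
  qed
  moreover have "P \<subseteq> dyadic_rationals"
  proof -
    have "bv (p @- zeros) \<in> dyadic_rationals" for p
      using numerator_of_word[of p] unfolding dyadic_rationals_def by blast
    moreover have "bv (p @- ones) = bv (p @- zeros) + 2 powi (- int (length p))" for p
      by (simp add: bv_ones_shift power_int_minus field_simps)
    ultimately show ?thesis unfolding P_def using dyadic_add_powi by auto
  qed
  moreover have "?f differentiable (at t)" if "t \<in> {0<..<1} - P" for t
  proof -
    obtain p where p: "p \<in> ?L" "t \<in> cyl p" using cover[of t] \<open>t \<in> {0<..<1} - P\<close> by auto
    have "bv (p @- zeros) \<in> P" "bv (p @- ones) \<in> P" using p(1) by (auto simp: P_def)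
    then have t: "t \<in> {bv (p @- zeros)<..<bv (p @- ones)}" using p(2) that unfolding cyl_def by (auto simp: order_less_le)
    have "(?f has_real_derivative ?c p) (at t)"
      by (rule has_field_derivative_transform_within_open[OF aff_deriv _ t])
        (use p aff[of p] in \<open>auto simp: cyl_def\<close>)
    then show ?thesis by (auto simp: real_differentiable_def)
  qed
  moreover have "\<exists>k::int. d = 2 powi k" if t: "t \<in> {0<..<1}" and d: "(?f has_real_derivative d) (at t)" for t d
  proof -
    obtain p where p: "p \<in> ?L" "t \<in> cyl p" using cover[of t] t by auto
    have "((\<lambda>x. ?c p * (x - bv (p @- zeros)) + bv (Q p @- zeros)) has_real_derivative d) (at t within cyl p)"
      by (rule has_real_derivative_transform_within[OF p(2) _ has_field_derivative_at_within[OF d]]) (use aff p in auto)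
    then have "d = ?c p"
      using vector_derivative_unique_within_closed_interval[of "bv (p @- zeros)" "bv (p @- ones)" t]
        aff_deriv[of p t "cyl p"] p(2) bv_zeros_less_ones[of p]
      by (auto simp: has_real_derivative_iff_has_vector_derivative cyl_def)
    then show ?thesis by blast
  qed
  ultimately show ?thesis using ext mono finP by (auto simp: thompson_F_def)
qed

lemma realize_hom: "realize \<in> hom stream_F thompson_F"
proof (rule homI)
  fix f g assume f: "f \<in> carrier stream_F" and g: "g \<in> carrier stream_F"
  show "realize (f \<otimes>\<^bsub>stream_F\<^esub> g) = realize f \<otimes>\<^bsub>thompson_F\<^esub> realize g"
  proof
    fix x show "realize (f \<otimes>\<^bsub>stream_F\<^esub> g) x = (realize f \<otimes>\<^bsub>thompson_F\<^esub> realize g) x"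
    proof (cases "x \<in> {0..1}")
      case True
      then obtain u where "x = bv u" by (rule bvE)
      then show ?thesis using True f g by (simp add: thompson_F_def compose_def realize_bv stream_F_mult_closed)
    next
      case False
      then show ?thesis by (auto simp: thompson_F_def compose_def realize_def)
    qed
  qed
qed (rule realize_closed)

lemma realize_id: "realize id = \<one>\<^bsub>thompson_F\<^esub>"
  by (auto simp: thompson_F_def realize_def bv_binexp)

lemma realize_St: "realize \<in> iso (stream_F\<lparr>carrier := stream_St b\<rparr>) (St_F b)"
proof -
  have "realize \<in> hom (stream_F\<lparr>carrier := stream_St b\<rparr>) (St_F b)"
    using realize_hom by (auto simp: hom_def St_F_def stream_St_def stabilizer_def F_action_realize Pi_def)
  moreover have "inj_on realize (stream_St b)"
    by (rule inj_on_inverseI[of _ F_action]) (simp add: stream_St_def F_action_realize)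
  moreover have "realize ` stream_St b = carrier (St_F b)"
  proof (intro equalityI subsetI)
    fix f assume "f \<in> carrier (St_F b)"
    then have f: "f \<in> carrier thompson_F" "F_action f b = b" by (auto simp: St_F_def stabilizer_def)
    then show "f \<in> realize ` stream_St b"
      using realize_F_action[OF f(1)] F_action_closed[OF f(1)]
      by (intro image_eqI[of _ _ "F_action f"]) (auto simp: stream_St_def)
  qed (auto simp: St_F_def stabilizer_def stream_St_def realize_closed F_action_realize)
  ultimately show ?thesis by (simp add: iso_def bij_betw_def)
qed

lemma finitely_presented_iso:
  assumes "finitely_presented G" "G \<cong> H" "group H"
  shows "finitely_presented H"
proof -
  have G: "group G" using assms(1) by (simp add: finitely_presented_def)
  have "H \<cong> G" using group.iso_sym[OF G assms(2)] .
  then show ?thesis using assms(1,3) iso_trans unfolding finitely_presented_def by blast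
qed

theorem proposition4p9:
  fixes b :: "bool stream"
  assumes "rational_point b"
  shows "finitely_presented (St_F b)"
proof (rule finitely_presented_iso)
  let ?G = "stream_F\<lparr>carrier := stream_St b\<rparr>"
  show "finitely_presented ?G" by (rule finitely_presented_St[OF assms])
  show "?G \<cong> St_F b" using realize_St by (auto simp: is_iso_def)
  have "group (St_F b\<lparr>one := realize \<one>\<^bsub>?G\<^esub>\<rparr>)"
    by (rule group.iso_imp_img_group[OF stream_F.subgroup_imp_group[OF subgroup_St] realize_St])
  moreover have "St_F b\<lparr>one := realize \<one>\<^bsub>?G\<^esub>\<rparr> = St_F b"
    using realize_id by (simp add: St_F_def thompson_F_def)
  ultimately show "group (St_F b)" by simp
qed

end
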